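(* Let $(X,f)$ be a (homeomorphic) proximal Cantor system with topological rank $2$, let $d$ be a compatible metric on $X$ and let $p\in X$ be its unique fixed point. Put $W^s(p)=\{x\in X: \lim_{i\to+\infty}f^i(x)=p\}$, $W^u(p)=\{x\in X:\lim_{i\to+\infty}f^{-i}(x)=p\}$ and $K:=X\setminus(W^s(p)\cup W^u(p))$. Then $K$ is scrambled in both ways, i.e. for all $x,y\in K$ with $x\neq y$, $$\liminf_{n\to+\infty}d(f^n(x),f^n(y))=0,\quad \limsup_{n\to+\infty}d(f^n(x),f^n(y))>0,$$ and the same two relations hold with $f$ replaced by $f^{-1}$. In particular, $(X,f)$ is residually scrambled. Furthermore, $(X,f)$ is expansive, and if $(X,f)$ is represented as the inverse limit of a bidirectional proximal KR-covering $G_0\xleftarrow{\varphi_1}G_1\xleftarrow{\varphi_2}\cdots$ all of whose graphs $G_n$, $n\ge 1$, have rank $2$, then $(X,f)$ is topologically conjugate to $(\bar X_1,\sigma)$, which is a subshift on two symbols.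
   Context: Systems. A (homeomorphic) zero-dimensional system is a pair $(X,f)$ with $X$ a compact totally disconnected metric space and $f:X\to X$ a homeomorphism; it is a Cantor system if $X$ is homeomorphic to the Cantor set. It is proximal if $\liminf_{n\to+\infty}d(f^n(x),f^n(y))=0$ for all $x,y\in X$ (equivalently, it has a fixed point that is its unique minimal set). It is essentially minimal if it has a unique minimal set. It is residually scrambled if there is a dense $G_\delta$ set $S\subseteq X$ such that every pair $x\ne y$ in $S$ satisfies $\liminf_{n\to+\infty}d(f^n(x),f^n(y))=0$ and $\limsup_{n\to+\infty}d(f^n(x),f^n(y))>0$. It is expansive if there is $\varepsilon>0$ such that for all $x\ne y$ there is $n\in\mathbb Z$ with $d(f^n(x),f^n(y))\ge\varepsilon$. Topological rank. A Bratteli diagram is an infinite directed graph $(V,E)$ with $V=V_0\sqcup V_1\sqcup\cdots$, $E=E_1\sqcup E_2\sqcup\cdots$ (all parts finite and non-empty), $V_0=\{v_0\}$, source and range maps $s:E_n\to V_{n-1}$, $r:E_n\to V_n$ with $s^{-1}(v)\neq\emptyset$ for all $v\in V$ and $r^{-1}(v)\ne\emptyset$ for all $v\in V\setminus V_0$ (multiple edges allowed). Its rank is $\liminf_{n\to\infty}|V_n|$. It is ordered if each $r^{-1}(v)$, $v\in V\setminus V_0$, carries a linear order. It is essentially simple if there is a unique infinite path $p_{\max}$ from $V_0$ all of whose edges are maximal in their sets $r^{-1}(\cdot)$, and a unique infinite path $p_{\min}$ from $V_0$ all of whose edges are minimal. Let $E_{0,\infty}=\{(e_1,e_2,\dots):e_i\in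 E_i,\ r(e_i)=s(e_{i+1})\}$ with the product topology. The Vershik map $\phi:E_{0,\infty}\to E_{0,\infty}$ sends $p_{\max}$ to $p_{\min}$, and for $e\ne p_{\max}$, with $n$ least such that $e_n$ is not maximal, $f_n$ the successor of $e_n$ in $r^{-1}(r(e_n))$ and $(f_1,\dots,f_{n-1})$ the path of minimal edges from $v_0$ to $s(f_n)$, $\phi(e)=(f_1,\dots,f_n,e_{n+1},e_{n+2},\dots)$. An essentially minimal zero-dimensional system has topological rank $K$ ($1\le K\le\infty$) if $K$ is the minimum of the ranks of the essentially simple ordered Bratteli diagrams whose Vershik system $(E_{0,\infty},\phi)$ is topologically conjugate to it. Graph coverings. A finite directed graph $G=(V(G),E(G))$ has $E(G)\subseteq V(G)\times V(G)$, and every vertex is assumed to have an incoming and an outgoing edge. A graph homomorphism $\varphi:G_1\to G_2$ is edge-surjective if $\varphi(E(G_1))=E(G_2)$; it is $+$directional if $(u,v),(u,v')\in E(G_1)$ implies $\varphi(v)=\varphi(v')$; it is bidirectional if moreover $(u,v),(u',v)\in E(G_1)$ implies $\varphi(u)=\varphi(u')$. A cover is a $+$directional edge-surjective homomorphism. A covering is a sequence of covers $G_0\xleftarrow{\varphi_1}G_1\xleftarrow{\varphi_2}\cdots$ with $G_0$ the graph with one vertex and one loop; it is bidirectional if all $\varphi_n$ are. Its inverse limit is $(X,f)$ with $X=\{(v_0,v_1,\dots)\in\prod_nV(G_n): v_n=\varphi_{n+1}(v_{n+1})\}$ and $f(x)=y$ iff $(u_n,v_n)\in E(G_n)$ for all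 $n$, where $x=(u_n)_n$, $y=(v_n)_n$. A circuit of length (period) $l\geq 1$ is a closed walk $(v_0,\dots,v_l=v_0)$ with $v_0,\dots,v_{l-1}$ distinct. A generalized figure 8 is a graph $G$ with a center $v_0$ and distinct circuits $c_1,\dots,c_r$ starting at $v_0$, pairwise meeting only in $v_0$, whose edges exhaust $E(G)$; $r$ is its rank. A KR-covering is a covering in which each $G_n$ is a generalized figure 8 with center $v_{n,0}$ and $\varphi_{n+1}(v_{n+1,0})=v_{n,0}$ for all $n\ge0$. It is proximal if for each $n\ge1$ the graph $G_n$ has a unique circuit of length $1$. If all $G_n$ ($n\ge 1$) have rank $2$, the circuits of $G_n$ are written $e_n$ (length $1$) and $c_n$. Every proximal Cantor system with topological rank $2$ is (up to conjugacy) the inverse limit of a bidirectional proximal KR-covering with all $G_n$, $n\ge1$, of rank $2$. The system $(\bar X_1,\sigma)$: for $x\in X$ and $i\in\mathbb Z$ let $\bar x(1,i)\in\{e_1,c_1\}$ be the unique circuit of $G_1$ containing the edge $(u,u')$, where $u,u'$ are the $G_1$-coordinates of $f^i(x)$ and $f^{i+1}(x)$. Put $\bar x[1]=(\bar x(1,i))_{i\in\mathbb Z}$, $\bar X_1=\{\bar x[1]:x\in X\}\subseteq\{e_1,c_1\}^{\mathbb Z}$, and let $\sigma$ be the left shift. *)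

theory Defs
  imports "HOL-Analysis.Analysis" "Graph_Theory.Pair_Digraph" "Graph_Theory.Vertex_Walk"
begin

section \<open>Zero-dimensional systems\<close>

text \<open>A system is a topology \<open>X :: 'a topology\<close> with a self-map of its underlying set;
  only the values of the map on \<^term>\<open>topspace X\<close> matter.\<close>

definition compatible_metric :: "'a topology \<Rightarrow> ('a \<Rightarrow> 'a \<Rightarrow> real) \<Rightarrow> bool" where
  "compatible_metric X d \<longleftrightarrow>
     Metric_space (topspace X) d \<and> Metric_space.mtopology (topspace X) d = X"

definition totally_disconnected_space :: "'a topology \<Rightarrow> bool" where
  "totally_disconnected_space X \<longleftrightarrow> (\<forall>C. connectedin X C \<longrightarrow> (\<exists>a. C \<subseteq> {a}))"

definition zero_dim_system :: "'a topology \<Rightarrow> ('a \<Rightarrow> 'a) \<Rightarrow> bool" where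
  "zero_dim_system X f \<longleftrightarrow>
     compact_space X \<and> metrizable_space X \<and> totally_disconnected_space X \<and> homeomorphic_map X X f"

text \<open>The Cantor set, as the countable power of the two-point discrete space.\<close>

definition cantor_space :: "(nat \<Rightarrow> bool) topology" where
  "cantor_space = product_topology (\<lambda>_. discrete_topology UNIV) UNIV"

definition cantor_system :: "'a topology \<Rightarrow> ('a \<Rightarrow> 'a) \<Rightarrow> bool" where
  "cantor_system X f \<longleftrightarrow> zero_dim_system X f \<and> X homeomorphic_space cantor_space"

definition inv_map :: "'a topology \<Rightarrow> ('a \<Rightarrow> 'a) \<Rightarrow> 'a \<Rightarrow> 'a" where
  "inv_map X f = inv_into (topspace X) f"

definition iter :: "'a topology \<Rightarrow> ('a \<Rightarrow> 'a) \<Rightarrow> int \<Rightarrow> 'a \<Rightarrow> 'a" where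
  "iter X f i = (if 0 \<le> i then f ^^ nat i else inv_map X f ^^ nat (- i))"

definition conjugate :: "'a topology \<Rightarrow> ('a \<Rightarrow> 'a) \<Rightarrow> 'b topology \<Rightarrow> ('b \<Rightarrow> 'b) \<Rightarrow> bool" where
  "conjugate X f Y g \<longleftrightarrow>
     (\<exists>h. homeomorphic_map X Y h \<and> (\<forall>x\<in>topspace X. h (f x) = g (h x)))"

text \<open>The lower and upper limits are taken in the extended reals.\<close>

definition liminf_dist :: "('a \<Rightarrow> 'a \<Rightarrow> real) \<Rightarrow> ('a \<Rightarrow> 'a) \<Rightarrow> 'a \<Rightarrow> 'a \<Rightarrow> ereal" where
  "liminf_dist d f x y = liminf (\<lambda>n. ereal (d ((f ^^ n) x) ((f ^^ n) y)))"

definition limsup_dist :: "('a \<Rightarrow> 'a \<Rightarrow> real) \<Rightarrow> ('a \<Rightarrow> 'a) \<Rightarrow> 'a \<Rightarrow> 'a \<Rightarrow> ereal" where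
  "limsup_dist d f x y = limsup (\<lambda>n. ereal (d ((f ^^ n) x) ((f ^^ n) y)))"

definition scrambled :: "('a \<Rightarrow> 'a \<Rightarrow> real) \<Rightarrow> ('a \<Rightarrow> 'a) \<Rightarrow> 'a set \<Rightarrow> bool" where
  "scrambled d f S \<longleftrightarrow>
     (\<forall>x\<in>S. \<forall>y\<in>S. x \<noteq> y \<longrightarrow> liminf_dist d f x y = 0 \<and> limsup_dist d f x y > 0)"

definition proximal :: "'a topology \<Rightarrow> ('a \<Rightarrow> 'a \<Rightarrow> real) \<Rightarrow> ('a \<Rightarrow> 'a) \<Rightarrow> bool" where
  "proximal X d f \<longleftrightarrow> (\<forall>x\<in>topspace X. \<forall>y\<in>topspace X. liminf_dist d f x y = 0)"

definition residually_scrambled :: "'a topology \<Rightarrow> ('a \<Rightarrow> 'a \<Rightarrow> real) \<Rightarrow> ('a \<Rightarrow> 'a) \<Rightarrow> bool" where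
  "residually_scrambled X d f \<longleftrightarrow>
     (\<exists>S. gdelta_in X S \<and> X closure_of S = topspace X \<and> scrambled d f S)"

definition expansive :: "'a topology \<Rightarrow> ('a \<Rightarrow> 'a \<Rightarrow> real) \<Rightarrow> ('a \<Rightarrow> 'a) \<Rightarrow> bool" where
  "expansive X d f \<longleftrightarrow>
     (\<exists>\<epsilon>>0. \<forall>x\<in>topspace X. \<forall>y\<in>topspace X. x \<noteq> y \<longrightarrow>
        (\<exists>i. d (iter X f i x) (iter X f i y) \<ge> \<epsilon>))"

definition invariant_closed :: "'a topology \<Rightarrow> ('a \<Rightarrow> 'a) \<Rightarrow> 'a set \<Rightarrow> bool" where
  "invariant_closed X f M \<longleftrightarrow> closedin X M \<and> M \<noteq> {} \<and> f ` M \<subseteq> M"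

definition minimal_set :: "'a topology \<Rightarrow> ('a \<Rightarrow> 'a) \<Rightarrow> 'a set \<Rightarrow> bool" where
  "minimal_set X f M \<longleftrightarrow>
     invariant_closed X f M \<and> (\<forall>N. invariant_closed X f N \<and> N \<subseteq> M \<longrightarrow> N = M)"

definition essentially_minimal :: "'a topology \<Rightarrow> ('a \<Rightarrow> 'a) \<Rightarrow> bool" where
  "essentially_minimal X f \<longleftrightarrow> (\<exists>!M. minimal_set X f M)"

definition stable_set :: "'a topology \<Rightarrow> ('a \<Rightarrow> 'a) \<Rightarrow> 'a \<Rightarrow> 'a set" where
  "stable_set X f p = {x \<in> topspace X. limitin X (\<lambda>i. (f ^^ i) x) p sequentially}"

definition unstable_set :: "'a topology \<Rightarrow> ('a \<Rightarrow> 'a) \<Rightarrow> 'a \<Rightarrow> 'a set" where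
  "unstable_set X f p = {x \<in> topspace X. limitin X (\<lambda>i. (inv_map X f ^^ i) x) p sequentially}"


section \<open>Ordered Bratteli diagrams and topological rank\<close>

text \<open>Vertex and edge sets are indexed by their level, so that the disjointness of different levels
  is implicit. Edges are labels with source and range, which allows multiple edges.
  \<open>bedges B n\<close> is the set of edges from level \<open>n\<close> to level \<open>Suc n\<close>
  (usually denoted \<open>E\<close> with index \<open>n + 1\<close>), and \<open>bord B n v\<close> is the (reflexive) linear order on the
  edges in \<open>bedges B n\<close> with range \<open>v\<close>.\<close>

record ('v, 'e) bratteli =
  bverts :: "nat \<Rightarrow> 'v set"
  bedges :: "nat \<Rightarrow> 'e set"
  bsrc :: "nat \<Rightarrow> 'e \<Rightarrow> 'v"
  brng :: "nat \<Rightarrow> 'e \<Rightarrow> 'v"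
  bord :: "nat \<Rightarrow> 'v \<Rightarrow> 'e rel"

definition in_bedges :: "('v, 'e) bratteli \<Rightarrow> nat \<Rightarrow> 'v \<Rightarrow> 'e set" where
  "in_bedges B n v = {e \<in> bedges B n. brng B n e = v}"

definition bratteli_diagram :: "('v, 'e) bratteli \<Rightarrow> bool" where
  "bratteli_diagram B \<longleftrightarrow>
     (\<exists>v0. bverts B 0 = {v0}) \<and>
     (\<forall>n. finite (bverts B n) \<and> bverts B n \<noteq> {} \<and> finite (bedges B n) \<and> bedges B n \<noteq> {}) \<and>
     (\<forall>n. \<forall>e\<in>bedges B n. bsrc B n e \<in> bverts B n \<and> brng B n e \<in> bverts B (Suc n)) \<and>
     (\<forall>n. \<forall>v\<in>bverts B n. \<exists>e\<in>bedges B n. bsrc B n e = v) \<and>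
     (\<forall>n. \<forall>v\<in>bverts B (Suc n). in_bedges B n v \<noteq> {})"

definition ordered_bratteli_diagram :: "('v, 'e) bratteli \<Rightarrow> bool" where
  "ordered_bratteli_diagram B \<longleftrightarrow>
     bratteli_diagram B \<and>
     (\<forall>n. \<forall>v\<in>bverts B (Suc n). linear_order_on (in_bedges B n v) (bord B n v))"

definition bratteli_rank :: "('v, 'e) bratteli \<Rightarrow> enat" where
  "bratteli_rank B = liminf (\<lambda>n. enat (card (bverts B n)))"

definition max_bedge :: "('v, 'e) bratteli \<Rightarrow> nat \<Rightarrow> 'e \<Rightarrow> bool" where
  "max_bedge B n e \<longleftrightarrow> e \<in> bedges B n \<and>
     (\<forall>e'\<in>in_bedges B n (brng B n e). (e', e) \<in> bord B n (brng B n e))"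

definition min_bedge :: "('v, 'e) bratteli \<Rightarrow> nat \<Rightarrow> 'e \<Rightarrow> bool" where
  "min_bedge B n e \<longleftrightarrow> e \<in> bedges B n \<and>
     (\<forall>e'\<in>in_bedges B n (brng B n e). (e, e') \<in> bord B n (brng B n e))"

definition succ_bedge :: "('v, 'e) bratteli \<Rightarrow> nat \<Rightarrow> 'e \<Rightarrow> 'e" where
  "succ_bedge B n e = (let v = brng B n e in
     THE e'. e' \<in> in_bedges B n v \<and> e' \<noteq> e \<and> (e, e') \<in> bord B n v \<and>
       (\<forall>e''\<in>in_bedges B n v. e'' \<noteq> e \<and> (e, e'') \<in> bord B n v \<longrightarrow> (e', e'') \<in> bord B n v))"

definition bratteli_paths :: "('v, 'e) bratteli \<Rightarrow> (nat \<Rightarrow> 'e) set" where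
  "bratteli_paths B =
     {e. \<forall>n. e n \<in> bedges B n \<and> brng B n (e n) = bsrc B (Suc n) (e (Suc n))}"

definition bratteli_space :: "('v, 'e) bratteli \<Rightarrow> (nat \<Rightarrow> 'e) topology" where
  "bratteli_space B =
     subtopology (product_topology (\<lambda>n. discrete_topology (bedges B n)) UNIV) (bratteli_paths B)"

definition max_bpath :: "('v, 'e) bratteli \<Rightarrow> (nat \<Rightarrow> 'e) \<Rightarrow> bool" where
  "max_bpath B e \<longleftrightarrow> e \<in> bratteli_paths B \<and> (\<forall>n. max_bedge B n (e n))"

definition min_bpath :: "('v, 'e) bratteli \<Rightarrow> (nat \<Rightarrow> 'e) \<Rightarrow> bool" where
  "min_bpath B e \<longleftrightarrow> e \<in> bratteli_paths B \<and> (\<forall>n. min_bedge B n (e n))"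

definition essentially_simple :: "('v, 'e) bratteli \<Rightarrow> bool" where
  "essentially_simple B \<longleftrightarrow> (\<exists>!e. max_bpath B e) \<and> (\<exists>!e. min_bpath B e)"

definition vershik_map :: "('v, 'e) bratteli \<Rightarrow> (nat \<Rightarrow> 'e) \<Rightarrow> nat \<Rightarrow> 'e" where
  "vershik_map B e =
     (if max_bpath B e then (THE e'. min_bpath B e')
      else let n = (LEAST n. \<not> max_bedge B n (e n)) in
        (THE e'. e' \<in> bratteli_paths B \<and> (\<forall>k<n. min_bedge B k (e' k)) \<and>
                 e' n = succ_bedge B n (e n) \<and> (\<forall>k>n. e' k = e k)))"

definition bratteli_model :: "'a topology \<Rightarrow> ('a \<Rightarrow> 'a) \<Rightarrow> ('v, 'e) bratteli \<Rightarrow> bool" where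
  "bratteli_model X f B \<longleftrightarrow> ordered_bratteli_diagram B \<and> essentially_simple B \<and>
     conjugate (bratteli_space B) (vershik_map B) X f"

text \<open>As all vertex and edge sets are finite, it is no restriction to consider only diagrams
  whose vertices and edges are natural numbers.\<close>

definition has_topological_rank :: "'a topology \<Rightarrow> ('a \<Rightarrow> 'a) \<Rightarrow> enat \<Rightarrow> bool" where
  "has_topological_rank X f k \<longleftrightarrow>
     zero_dim_system X f \<and> essentially_minimal X f \<and>
     (\<exists>B :: (nat, nat) bratteli. bratteli_model X f B \<and> bratteli_rank B = k) \<and>
     (\<forall>B :: (nat, nat) bratteli. bratteli_model X f B \<longrightarrow> k \<le> bratteli_rank B)"


section \<open>Graph coverings\<close>

definition finite_graph :: "'v pair_pre_digraph \<Rightarrow> bool" where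
  "finite_graph G \<longleftrightarrow> pair_fin_digraph G \<and>
     (\<forall>v\<in>pverts G. (\<exists>u. (u, v) \<in> parcs G) \<and> (\<exists>w. (v, w) \<in> parcs G))"

definition graph_hom :: "'v pair_pre_digraph \<Rightarrow> 'w pair_pre_digraph \<Rightarrow> ('v \<Rightarrow> 'w) \<Rightarrow> bool" where
  "graph_hom G H \<phi> \<longleftrightarrow>
     \<phi> ` pverts G \<subseteq> pverts H \<and> (\<forall>(u, v)\<in>parcs G. (\<phi> u, \<phi> v) \<in> parcs H)"

definition edge_surjective :: "'v pair_pre_digraph \<Rightarrow> 'w pair_pre_digraph \<Rightarrow> ('v \<Rightarrow> 'w) \<Rightarrow> bool" where
  "edge_surjective G H \<phi> \<longleftrightarrow> map_prod \<phi> \<phi> ` parcs G = parcs H"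

definition plus_directional :: "'v pair_pre_digraph \<Rightarrow> ('v \<Rightarrow> 'w) \<Rightarrow> bool" where
  "plus_directional G \<phi> \<longleftrightarrow>
     (\<forall>u v v'. (u, v) \<in> parcs G \<and> (u, v') \<in> parcs G \<longrightarrow> \<phi> v = \<phi> v')"

definition bidirectional :: "'v pair_pre_digraph \<Rightarrow> ('v \<Rightarrow> 'w) \<Rightarrow> bool" where
  "bidirectional G \<phi> \<longleftrightarrow> plus_directional G \<phi> \<and>
     (\<forall>u u' v. (u, v) \<in> parcs G \<and> (u', v) \<in> parcs G \<longrightarrow> \<phi> u = \<phi> u')"

definition graph_cover :: "'v pair_pre_digraph \<Rightarrow> 'w pair_pre_digraph \<Rightarrow> ('v \<Rightarrow> 'w) \<Rightarrow> bool" where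
  "graph_cover G H \<phi> \<longleftrightarrow> graph_hom G H \<phi> \<and> edge_surjective G H \<phi> \<and> plus_directional G \<phi>"

text \<open>In a covering, \<open>\<phi> (Suc n)\<close> maps \<open>G (Suc n)\<close> to \<open>G n\<close>; the value \<open>\<phi> 0\<close> is irrelevant.\<close>

definition graph_covering :: "(nat \<Rightarrow> 'v pair_pre_digraph) \<Rightarrow> (nat \<Rightarrow> 'v \<Rightarrow> 'v) \<Rightarrow> bool" where
  "graph_covering G \<phi> \<longleftrightarrow>
     (\<forall>n. finite_graph (G n)) \<and>
     (\<exists>v. pverts (G 0) = {v} \<and> parcs (G 0) = {(v, v)}) \<and>
     (\<forall>n. graph_cover (G (Suc n)) (G n) (\<phi> (Suc n)))"

definition bidirectional_covering :: "(nat \<Rightarrow> 'v pair_pre_digraph) \<Rightarrow> (nat \<Rightarrow> 'v \<Rightarrow> 'v) \<Rightarrow> bool" where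
  "bidirectional_covering G \<phi> \<longleftrightarrow>
     graph_covering G \<phi> \<and> (\<forall>n. bidirectional (G (Suc n)) (\<phi> (Suc n)))"

definition inv_limit_set :: "(nat \<Rightarrow> 'v pair_pre_digraph) \<Rightarrow> (nat \<Rightarrow> 'v \<Rightarrow> 'v) \<Rightarrow> (nat \<Rightarrow> 'v) set" where
  "inv_limit_set G \<phi> = {x. \<forall>n. x n \<in> pverts (G n) \<and> x n = \<phi> (Suc n) (x (Suc n))}"

definition inv_limit :: "(nat \<Rightarrow> 'v pair_pre_digraph) \<Rightarrow> (nat \<Rightarrow> 'v \<Rightarrow> 'v) \<Rightarrow> (nat \<Rightarrow> 'v) topology" where
  "inv_limit G \<phi> =
     subtopology (product_topology (\<lambda>n. discrete_topology (pverts (G n))) UNIV) (inv_limit_set G \<phi>)"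

definition inv_limit_map ::
    "(nat \<Rightarrow> 'v pair_pre_digraph) \<Rightarrow> (nat \<Rightarrow> 'v \<Rightarrow> 'v) \<Rightarrow> (nat \<Rightarrow> 'v) \<Rightarrow> nat \<Rightarrow> 'v" where
  "inv_limit_map G \<phi> x = (THE y. y \<in> inv_limit_set G \<phi> \<and> (\<forall>n. (x n, y n) \<in> parcs (G n)))"

text \<open>A circuit of length \<open>l\<close> is the vertex list \<open>[v0, \<dots>, vl]\<close> with \<open>vl = v0\<close>.\<close>

definition circuit :: "'v pair_pre_digraph \<Rightarrow> 'v list \<Rightarrow> bool" where
  "circuit G c \<longleftrightarrow>
     vwalk c (with_proj G) \<and> vwalk_length c \<ge> 1 \<and> hd c = last c \<and> distinct (butlast c)"

text \<open>The graph \<open>G\<close> is a generalized figure 8 with center \<open>v0\<close> and set of circuits \<open>C\<close>;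
  its rank is \<^term>\<open>card C\<close>.\<close>

definition generalized_figure8 :: "'v pair_pre_digraph \<Rightarrow> 'v \<Rightarrow> 'v list set \<Rightarrow> bool" where
  "generalized_figure8 G v0 C \<longleftrightarrow>
     finite_graph G \<and> finite C \<and> C \<noteq> {} \<and>
     (\<forall>c\<in>C. circuit G c \<and> hd c = v0) \<and>
     (\<forall>c\<in>C. \<forall>c'\<in>C. c \<noteq> c' \<longrightarrow> set c \<inter> set c' = {v0}) \<and>
     (\<Union>c\<in>C. set (vwalk_arcs c)) = parcs G"

text \<open>A KR-covering is given together with the centers \<open>ctr n\<close> and the sets of
  circuits \<open>C n\<close> of its graphs.\<close>

definition KR_covering ::
    "(nat \<Rightarrow> 'v pair_pre_digraph) \<Rightarrow> (nat \<Rightarrow> 'v \<Rightarrow> 'v) \<Rightarrow> (nat \<Rightarrow> 'v) \<Rightarrow> (nat \<Rightarrow> 'v list set) \<Rightarrow> bool" where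
  "KR_covering G \<phi> ctr C \<longleftrightarrow>
     graph_covering G \<phi> \<and>
     (\<forall>n. generalized_figure8 (G n) (ctr n) (C n)) \<and>
     (\<forall>n. \<phi> (Suc n) (ctr (Suc n)) = ctr n)"

definition proximal_KR_covering ::
    "(nat \<Rightarrow> 'v pair_pre_digraph) \<Rightarrow> (nat \<Rightarrow> 'v \<Rightarrow> 'v) \<Rightarrow> (nat \<Rightarrow> 'v) \<Rightarrow> (nat \<Rightarrow> 'v list set) \<Rightarrow> bool" where
  "proximal_KR_covering G \<phi> ctr C \<longleftrightarrow>
     KR_covering G \<phi> ctr C \<and> (\<forall>n\<ge>1. \<exists>!c. circuit (G n) c \<and> vwalk_length c = 1)"


section \<open>Subshifts and the coding by the circuits of the first graph\<close>

definition full_shift :: "'s set \<Rightarrow> (int \<Rightarrow> 's) topology" where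
  "full_shift A = product_topology (\<lambda>_. discrete_topology A) UNIV"

definition left_shift :: "(int \<Rightarrow> 's) \<Rightarrow> int \<Rightarrow> 's" where
  "left_shift z = (\<lambda>i. z (i + 1))"

definition subshift :: "'s set \<Rightarrow> (int \<Rightarrow> 's) set \<Rightarrow> bool" where
  "subshift A Y \<longleftrightarrow> finite A \<and> closedin (full_shift A) Y \<and> left_shift ` Y = Y"

definition circuit_coding ::
    "(nat \<Rightarrow> 'v pair_pre_digraph) \<Rightarrow> (nat \<Rightarrow> 'v \<Rightarrow> 'v) \<Rightarrow> (nat \<Rightarrow> 'v list set) \<Rightarrow>
     (nat \<Rightarrow> 'v) \<Rightarrow> int \<Rightarrow> 'v list" where
  "circuit_coding G \<phi> C x i =
     (let F = iter (inv_limit G \<phi>) (inv_limit_map G \<phi>) in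
      THE c. c \<in> C 1 \<and> (F i x 1, F (i + 1) x 1) \<in> set (vwalk_arcs c))"

definition coded_set ::
    "(nat \<Rightarrow> 'v pair_pre_digraph) \<Rightarrow> (nat \<Rightarrow> 'v \<Rightarrow> 'v) \<Rightarrow> (nat \<Rightarrow> 'v list set) \<Rightarrow>
     (int \<Rightarrow> 'v list) set" where
  "coded_set G \<phi> C = circuit_coding G \<phi> C ` inv_limit_set G \<phi>"

end

theory Submission
  imports Defs
begin

text \<open>
  The mechanism behind all claims is that the coding of an orbit by the two towers of one level
  determines the position of the orbit in the towers of the next level.

  Every nonempty closed invariant set contains a fixed point: the distance from \<open>x\<close> to \<open>f x\<close> attains its
  minimum there, and proximality of \<open>x\<close> and \<open>f x\<close> makes this minimum \<open>0\<close>. As there is only one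
  minimal set, there is only one fixed point \<open>p\<close>, it lies in all these sets, and by
  compactness every orbit visits a given neighbourhood of \<open>p\<close> within a bounded time, and stays
  there for as long as one likes, since \<open>p\<close> is fixed (\<open>proximal_attracting_fixed_point\<close>,
  \<open>long_visit\<close>).

  In an ordered Bratteli diagram of rank two the path \<open>p\<close> is fixed by the Vershik map, so it is
  both maximal and minimal. At a level with two vertices the vertex on \<open>p\<close> is therefore reached by a
  single path, and the paths to the other vertex form one tower. This gives a sequence of finer and
  finer clopen partitions of \<open>X\<close>, each consisting of one set \<open>E\<close> around \<open>p\<close> and one tower \<open>A\<close> of
  some height, and the partitions together separate points. The locale \<open>tower_labelling\<close>
  records this by the number of the floor that contains a point, with \<open>0\<close> for the set \<open>E\<close>. Its
  axioms are symmetric under time reversal (\<open>reversed\<close>). Graph coverings of rank two produce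
  the same structure, with the position of an arc in the nontrivial circuit as the label.

  The pattern of \<open>E\<close> and \<open>A\<close> seen at level \<open>n\<close> while climbing the tower of level \<open>n + 1\<close> is a fixed
  finite word. If two orbits show the same pattern at level \<open>n\<close>, then after a stretch in \<open>E\<close> that
  is at least as long as this word, the next visit of \<open>A\<close> must come from the first letter \<open>A\<close> of the word
  for both of them, and from then on the word is parsed in the same way
  (\<open>tower_seq_resynchronise\<close>). Such stretches occur arbitrarily far in the past, hence orbits with
  the same bi-infinite pattern at one level have the same pattern at all levels
  (\<open>same_code_imp_eq\<close>). This is expansivity, and it is injectivity of the two-symbol coding.

  For forward asymptotic \<open>x\<close> and \<open>y\<close> with \<open>x\<close> not in the stable set of \<open>p\<close>, the patterns of some level
  agree from a time \<open>T\<close> on at which both orbits are in \<open>A\<close>. The next level agrees far in the future,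
  and parsing backwards from there by means of the last letter \<open>A\<close> of the word, it agrees from \<open>T\<close>
  on (\<open>tower_seq_agree_backwards\<close>). By induction the orbits meet at time \<open>T\<close> in the same
  floor of every level, so \<open>x = y\<close> (\<open>eventual_code_imp_eq\<close>). Hence the complement of the stable
  set is scrambled, and time reversal gives the statement for the inverse map.

  Finally, the points that visit \<open>A\<close> infinitely often in the future avoid the stable set and form
  a \<open>G\<^sub>\<delta>\<close> set. It is dense by Baire's theorem, because a tower to which no orbit returns would have
  floors consisting of one isolated point (\<open>floor_returns\<close>).
\<close>

section \<open>Label sequences of towers\<close>

text \<open>The successive labels along an orbit when one tower has height \<open>1\<close> and label \<open>0\<close> and the floors of
  the other are numbered from \<open>1\<close> to \<open>H\<close>: floors are climbed one by one, and from the label \<open>0\<close> or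
  from the top floor the orbit enters either tower at its base.\<close>

definition tower_seq :: "nat \<Rightarrow> (nat \<Rightarrow> nat) \<Rightarrow> bool" where
  "tower_seq H l \<longleftrightarrow> (\<forall>s. l s \<le> H \<and>
     (0 < l s \<and> l s < H \<longrightarrow> l (Suc s) = Suc (l s)) \<and>
     (l s = 0 \<or> l s = H \<longrightarrow> l (Suc s) \<le> 1))"

lemma tower_seq_forward:
  assumes "tower_seq H l" "0 < l s" "l s + j \<le> H"
  shows "l (s + j) = l s + j"
  using assms(3)
proof (induction j)
  case (Suc j)
  then have "l (s + j) = l s + j" "l (s + j) < H" "0 < l (s + j)" using assms(2) by auto
  with assms(1) show ?case unfolding tower_seq_def by auto
qed auto

lemma tower_seq_backward:
  assumes "tower_seq H l" "j < l (s + j)"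
  shows "l s = l (s + j) - j"
  using assms(2)
proof (induction j)
  case (Suc j)
  have *: "l (s + j) \<le> H" "0 < l (s + j) \<and> l (s + j) < H \<longrightarrow> l (Suc (s + j)) = Suc (l (s + j))"
    "l (s + j) = 0 \<or> l (s + j) = H \<longrightarrow> l (Suc (s + j)) \<le> 1"
    using assms(1) unfolding tower_seq_def by auto
  have "l (s + j) \<noteq> 0" "l (s + j) \<noteq> H" using * Suc.prems by auto
  then have "l (s + Suc j) = Suc (l (s + j))" using * by auto
  then show ?case using Suc by auto
qed auto

text \<open>The predicate \<open>\<alpha>\<close> tells which floors of the tall tower lie in the tall tower of the coarser level,
  and \<open>a\<close> is the first of them. The times at which a sequence is in floor \<open>a\<close> can be read off from
  \<open>\<alpha>\<close> alone after a gap of length \<open>H\<close>: a time satisfying \<open>\<alpha>\<close> lies in a floor not below \<open>a\<close>, and in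
  floor \<open>a\<close> exactly if the climb it belongs to has not passed floor \<open>a\<close> earlier; no climb reaches
  across the gap. Once the times in floor \<open>a\<close> are known, so are all labels.\<close>

lemma tower_seq_resynchronise:
  assumes l: "tower_seq H l" and l': "tower_seq H l'"
    and eq: "\<And>s. \<alpha> (l s) \<longleftrightarrow> \<alpha> (l' s)"
    and a: "\<alpha> a" "\<And>k. k < a \<Longrightarrow> \<not> \<alpha> k" and a0: "0 < a" and aleH: "a \<le> H"
    and gap: "\<And>s. t \<le> s \<Longrightarrow> s < t + H \<Longrightarrow> \<not> \<alpha> (l s)"
    and "t + H \<le> s"
  shows "l s = l' s"
proof -
  have le: "m s \<le> H" if "tower_seq H m" for m s
    using that unfolding tower_seq_def by auto
  \<comment> \<open>a visit of floor \<open>a\<close> by one sequence forces one by the other; otherwise the other sequence would be in the middle of a climb that visited \<open>a\<close> at the earlier time \<open>v\<close>\<close>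
  have step: "m' u = a" if m: "tower_seq H m" and m': "tower_seq H m'"
    and e: "\<And>s. \<alpha> (m s) \<longleftrightarrow> \<alpha> (m' s)" and g: "\<And>s. t \<le> s \<Longrightarrow> s < t + H \<Longrightarrow> \<not> \<alpha> (m s)"
    and IH: "\<And>v. t + H \<le> v \<Longrightarrow> v < u \<Longrightarrow> m' v = a \<Longrightarrow> m v = a"
    and u: "t + H \<le> u" "m u = a" for m m' u
  proof (rule ccontr)
    assume ne: "m' u \<noteq> a"
    define k where "k = m' u"
    have "\<alpha> k" using e[of u] u a k_def by auto
    then have ka: "a < k" using a(2) ne k_def by (meson linorder_neqE_nat)
    have kH: "k \<le> H" using le[OF m'] k_def by auto
    define v where "v = u - (k - a)"
    have vu: "v + (k - a) = u" "v < u" using u(1) kH ka a0 unfolding v_def by auto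
    have m'v: "m' v = a" using tower_seq_backward[OF m', of "k - a" v] vu ka a0 k_def by auto
    have "t \<le> v" using u(1) kH ka a0 unfolding v_def by auto
    moreover have "\<alpha> (m v)" using e[of v] m'v a by auto
    ultimately have "t + H \<le> v" using g[of v] by (meson not_le)
    then have mv: "m v = a" using IH vu m'v by auto
    then have "m u = k" using tower_seq_forward[OF m, of v "k - a"] vu ka kH a0 by auto
    with u(2) ka show False by auto
  qed
  have first: "l u = a \<longleftrightarrow> l' u = a" if "t + H \<le> u" for u
    using that
  proof (induction u rule: less_induct)
    case (less u)
    have gap': "\<And>s. t \<le> s \<Longrightarrow> s < t + H \<Longrightarrow> \<not> \<alpha> (l' s)" using gap eq by auto
    show ?case
      using step[OF l l' eq gap, of u] step[OF l' l eq[symmetric] gap', of u] less by auto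
  qed
  have main: "m' s = m s" if m: "tower_seq H m" and m': "tower_seq H m'"
    and e: "\<And>u. t + H \<le> u \<Longrightarrow> m u = a \<longleftrightarrow> m' u = a" and g: "\<And>s. t \<le> s \<Longrightarrow> s < t + H \<Longrightarrow> \<not> \<alpha> (m s)"
    and pos: "0 < m s" for m m'
  proof -
    define k where "k = m s"
    have aH: "k \<le> H" "0 < k" using le[OF m] pos k_def by auto
    show ?thesis
    proof (cases "k \<le> a")
      case True
      have "m (s + (a - k)) = a" using tower_seq_forward[OF m, of s "a - k"] aleH aH True k_def by auto
      then have "m' (s + (a - k)) = a" using e assms(9) by auto
      then show ?thesis using tower_seq_backward[OF m', of "a - k" s] True aH a0 k_def by auto
    next
      case False
      define u where "u = s - (k - a)"
      have us: "u + (k - a) = s" using assms(9) aH False a0 unfolding u_def by auto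
      have mu: "m u = a" using tower_seq_backward[OF m, of "k - a" u] us False a0 k_def by auto
      have "t \<le> u" using assms(9) aH False a0 unfolding u_def by auto
      then have "t + H \<le> u" using g[of u] mu a(1) by (meson not_le)
      then have "m' u = a" using e mu by auto
      then show ?thesis using tower_seq_forward[OF m', of u "k - a"] us False aH a0 k_def by auto
    qed
  qed
  have gap': "\<And>s. t \<le> s \<Longrightarrow> s < t + H \<Longrightarrow> \<not> \<alpha> (l' s)" using gap eq by auto
  show ?thesis
    using main[OF l l' first gap] main[OF l' l first[symmetric] gap'] by (metis neq0_conv)
qed

text \<open>The mirror image of the previous argument, with the last floor \<open>b\<close> satisfying \<open>\<alpha>\<close> in place of the
  first one and with agreement in the far future in place of the gap. At time \<open>0\<close> the climb is not yet
  above floor \<open>b\<close>, so that every climb in progress after time \<open>0\<close> passes floor \<open>b\<close> at a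
  nonnegative time; this is what extends the agreement down to time \<open>0\<close> itself.\<close>

lemma tower_seq_agree_backwards:
  assumes l: "tower_seq H l" and l': "tower_seq H l'"
    and eq: "\<And>s. \<alpha> (l s) \<longleftrightarrow> \<alpha> (l' s)"
    and b: "\<And>k. b < k \<Longrightarrow> k \<le> H \<Longrightarrow> \<not> \<alpha> k" and \<alpha>0: "\<not> \<alpha> 0"
    and bH: "\<alpha> b" "b \<le> H"
    and start: "\<alpha> (l 0)"
    and far: "\<And>s. S \<le> s \<Longrightarrow> l s = l' s"
  shows "l s = l' s"
proof -
  have le: "m s \<le> H" if "tower_seq H m" for m s
    using that unfolding tower_seq_def by auto
  have b0: "0 < b" using bH \<alpha>0 by (cases b) auto
  \<comment> \<open>as before, but the conflicting visit of floor \<open>b\<close> now lies in the future\<close>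
  have step: "m' u = b" if m: "tower_seq H m" and m': "tower_seq H m'"
    and e: "\<And>s. \<alpha> (m s) \<longleftrightarrow> \<alpha> (m' s)"
    and IH: "\<And>v. u < v \<Longrightarrow> m' v = b \<Longrightarrow> m v = b"
    and u: "m u = b" for m m' u
  proof (rule ccontr)
    assume ne: "m' u \<noteq> b"
    define k where "k = m' u"
    have ak: "\<alpha> k" using e[of u] u bH k_def by auto
    then have kb: "k < b" using b[of k] le[OF m'] ne k_def by (meson linorder_neqE_nat)
    have k0: "0 < k" using ak \<alpha>0 by (cases k) auto
    have "m' (u + (b - k)) = b" using tower_seq_forward[OF m', of u "b - k"] kb k0 bH k_def by auto
    then have "m (u + (b - k)) = b" using IH kb by auto
    then have "m u = k" using tower_seq_backward[OF m, of "b - k" u] kb k0 by auto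
    with u kb show False by auto
  qed
  have last: "l u = b \<longleftrightarrow> l' u = b" for u
  \<comment> \<open>the times before \<open>S\<close> are settled in descending order\<close>
  proof (induction "S - u" arbitrary: u rule: less_induct)
    case less
    show ?case
    proof (cases "S \<le> u")
      case False
      then have IH: "l v = b \<longleftrightarrow> l' v = b" if "u < v" for v
        using less[of v] that by auto
      show ?thesis
        using step[OF l l' eq, of u] step[OF l' l eq[symmetric], of u] IH by auto
    qed (use far in auto)
  qed
  have main: "m' s = m s" if m: "tower_seq H m" and m': "tower_seq H m'"
    and e: "\<And>u. m u = b \<longleftrightarrow> m' u = b" and st: "\<alpha> (m 0)"
    and pos: "0 < m s" for m m'
  proof -
    define k where "k = m s"
    have aH: "k \<le> H" "0 < k" using le[OF m] pos k_def by auto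
    show ?thesis
    proof (cases "k \<le> b")
      case True
      have "m (s + (b - k)) = b" using tower_seq_forward[OF m, of s "b - k"] bH aH True k_def by auto
      then have "m' (s + (b - k)) = b" using e by auto
      then show ?thesis using tower_seq_backward[OF m', of "b - k" s] True aH k_def by auto
    next
      case False
      show ?thesis
      proof (cases "k - b \<le> s")
        case True
        define u where "u = s - (k - b)"
        have us: "u + (k - b) = s" using True unfolding u_def by auto
        have mu: "m u = b" using tower_seq_backward[OF m, of "k - b" u] us False b0 k_def by auto
        then have "m' u = b" using e by auto
        then show ?thesis using tower_seq_forward[OF m', of u "k - b"] us False aH b0 k_def by auto
      next
        case far: False
        then have "m 0 = k - s" using tower_seq_backward[OF m, of s 0] k_def by auto
        then have "\<not> \<alpha> (m 0)" using b[of "k - s"] far aH by auto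
        with st show ?thesis by auto
      qed
    qed
  qed
  show ?thesis
    using main[OF l l' last start] main[OF l' l last[symmetric]] start eq by (metis neq0_conv)
qed

section \<open>Invertible maps and attracting fixed points\<close>

lemma funpow_Suc_shift: "(k ^^ Suc i) z = (k ^^ i) (k z)"
  by (simp add: funpow_Suc_right del: funpow.simps)

locale invertible_dynamics =
  fixes S :: "'a set" and f g :: "'a \<Rightarrow> 'a"
  assumes f_in: "\<And>x. x \<in> S \<Longrightarrow> f x \<in> S" and g_in: "\<And>x. x \<in> S \<Longrightarrow> g x \<in> S"
    and gf: "\<And>x. x \<in> S \<Longrightarrow> g (f x) = x" and fg: "\<And>x. x \<in> S \<Longrightarrow> f (g x) = x"
begin

lemma fn_in: "x \<in> S \<Longrightarrow> (f ^^ i) x \<in> S"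
  by (induction i) (auto simp: f_in)

lemma gn_in: "x \<in> S \<Longrightarrow> (g ^^ i) x \<in> S"
  by (induction i) (auto simp: g_in)

lemma fn_gn: "x \<in> S \<Longrightarrow> (f ^^ i) ((g ^^ i) x) = x"
proof (induction i arbitrary: x)
  case (Suc i)
  have "(f ^^ Suc i) ((g ^^ Suc i) x) = (f ^^ i) (f (g ((g ^^ i) x)))"
    unfolding funpow_Suc_shift[of _ f] by simp
  with Suc fg gn_in show ?case by auto
qed auto

lemma gn_fn: "x \<in> S \<Longrightarrow> (g ^^ i) ((f ^^ i) x) = x"
proof (induction i arbitrary: x)
  case (Suc i)
  have "(g ^^ Suc i) ((f ^^ Suc i) x) = (g ^^ i) (g (f ((f ^^ i) x)))"
    unfolding funpow_Suc_shift[of _ g] by simp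
  with Suc gf fn_in show ?case by auto
qed auto

lemma fn_gm:
  assumes "x \<in> S"
  shows "(f ^^ i) ((g ^^ j) x) = (if j \<le> i then (f ^^ (i - j)) x else (g ^^ (j - i)) x)"
proof (cases "j \<le> i")
  case True
  then have "(f ^^ i) ((g ^^ j) x) = (f ^^ (i - j)) ((f ^^ j) ((g ^^ j) x))"
    by (metis comp_apply funpow_add le_add_diff_inverse2)
  with True show ?thesis using fn_gn assms by auto
next
  case False
  then have "(g ^^ j) x = (g ^^ i) ((g ^^ (j - i)) x)"
    by (metis comp_apply funpow_add le_add_diff_inverse nat_le_linear)
  with False show ?thesis using fn_gn gn_in assms by auto
qed

end

lemma homeomorphic_maps_inv_map:
  assumes "homeomorphic_map X X f"
  shows "homeomorphic_maps X X f (inv_map X f)"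
proof -
  obtain f' where f': "homeomorphic_maps X X f f'" using assms homeomorphic_map_maps by blast
  have "inj_on f (topspace X)" using assms homeomorphic_imp_injective_map by blast
  then have "inv_map X f x = f' x" if "x \<in> topspace X" for x
    using that f' unfolding inv_map_def homeomorphic_maps_map
    by (metis homeomorphic_imp_surjective_map image_eqI inv_into_f_f)
  with f' show ?thesis using homeomorphic_maps_eq by metis
qed

text \<open>By compactness the last clause says that \<open>p\<close> belongs to every nonempty closed invariant set. The
  uniform time bound makes it usable in both directions of time.\<close>

definition attracts :: "'a topology \<Rightarrow> ('a \<Rightarrow> 'a) \<Rightarrow> 'a \<Rightarrow> bool" where
  "attracts X f p \<longleftrightarrow> p \<in> topspace X \<and> f p = p \<and>
     (\<forall>U. openin X U \<and> p \<in> U \<longrightarrow> (\<exists>T. \<forall>x\<in>topspace X. \<exists>t\<le>T. (f ^^ t) x \<in> U))"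

section \<open>Nested two-tower partitions\<close>

text \<open>The label \<open>lab n x\<close> is \<open>0\<close> if \<open>x\<close> lies in the tower of height one of level \<open>n\<close>, the tower that
  contains the fixed point; otherwise it is the number, starting from \<open>1\<close>, of the floor of the other
  tower that contains \<open>x\<close>. A nonempty tall tower at level \<open>0\<close> forces one at every level, so every climb of
  the tall tower of a level meets the tall tower of the level before.\<close>

locale tower_labelling =
  fixes X :: "'a topology" and f g :: "'a \<Rightarrow> 'a" and p :: 'a
    and lab :: "nat \<Rightarrow> 'a \<Rightarrow> nat" and h :: "nat \<Rightarrow> nat"
  assumes compact: "compact_space X"
    and cont_f: "continuous_map X X f" and cont_g: "continuous_map X X g"
    and left_inverse: "\<And>x. x \<in> topspace X \<Longrightarrow> g (f x) = x"
    and right_inverse: "\<And>x. x \<in> topspace X \<Longrightarrow> f (g x) = x"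
    and attracting: "attracts X f p"
    and lab_open: "\<And>n k. openin X {x \<in> topspace X. lab n x = k}"
    and lab_le: "\<And>n x. x \<in> topspace X \<Longrightarrow> lab n x \<le> h n"
    and lab_Suc: "\<And>n x. x \<in> topspace X \<Longrightarrow> 0 < lab n x \<Longrightarrow> lab n x < h n \<Longrightarrow>
                    lab n (f x) = Suc (lab n x)"
    and lab_exit: "\<And>n x. x \<in> topspace X \<Longrightarrow> lab n x = 0 \<or> lab n x = h n \<Longrightarrow> lab n (f x) \<le> 1"
    and lab_refine: "\<And>n x y. x \<in> topspace X \<Longrightarrow> y \<in> topspace X \<Longrightarrow>
                    lab (Suc n) x = lab (Suc n) y \<Longrightarrow> lab n x = lab n y"
    and lab_p: "\<And>n. lab n p = 0"
    and lab_separates: "\<And>x y. x \<in> topspace X \<Longrightarrow> y \<in> topspace X \<Longrightarrow>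
                    (\<And>n. lab n x = lab n y) \<Longrightarrow> x = y"
    and lab_nontrivial: "\<exists>x\<in>topspace X. 0 < lab 0 x"
begin

sublocale invertible_dynamics "topspace X" f g
  using cont_f cont_g left_inverse right_inverse by unfold_locales (auto simp: continuous_map_def)

lemma p_in: "p \<in> topspace X" and fp: "f p = p"
  using attracting unfolding attracts_def by auto

lemma visits: "openin X U \<Longrightarrow> p \<in> U \<Longrightarrow> \<exists>T. \<forall>x\<in>topspace X. \<exists>t\<le>T. (f ^^ t) x \<in> U"
  using attracting unfolding attracts_def by blast

lemma gp: "g p = p"
  using gf[OF p_in] fp by simp

lemma fn_p: "(f ^^ i) p = p"
  by (induction i) (auto simp: fp)

lemma inv_map_eq: "x \<in> topspace X \<Longrightarrow> inv_map X f x = g x"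
proof -
  assume x: "x \<in> topspace X"
  have "inj_on f (topspace X)" using gf by (metis inj_onI)
  then show ?thesis unfolding inv_map_def using inv_into_f_f[of f "topspace X" "g x"] g_in fg x by auto
qed

lemma inv_map_funpow: "x \<in> topspace X \<Longrightarrow> (inv_map X f ^^ i) x = (g ^^ i) x"
  by (induction i) (auto simp: inv_map_eq gn_in)

lemma lab_mono_refine:
  assumes "x \<in> topspace X" "y \<in> topspace X" "m \<le> n" "lab n x = lab n y"
  shows "lab m x = lab m y"
  using assms(3,4)
proof (induction n rule: dec_induct)
  case (step n)
  then show ?case using lab_refine[OF assms(1,2)] by simp
qed simp

lemma lab_pos_mono:
  assumes "x \<in> topspace X" "m \<le> n" "0 < lab m x"
  shows "0 < lab n x"
  using lab_mono_refine[OF assms(1) p_in assms(2)] lab_p assms(3) by (metis neq0_conv)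

lemma lab_nontrivial': "\<exists>x\<in>topspace X. 0 < lab n x"
  using lab_nontrivial lab_pos_mono by blast

lemma tower_seq_lab: "x \<in> topspace X \<Longrightarrow> tower_seq (h n) (\<lambda>s. lab n ((f ^^ s) x))"
  unfolding tower_seq_def using lab_le lab_Suc lab_exit fn_in by auto

lemma lab_forward:
  assumes "x \<in> topspace X" "0 < lab n x" "lab n x + j \<le> h n"
  shows "lab n ((f ^^ j) x) = lab n x + j"
  using tower_seq_forward[OF tower_seq_lab[OF assms(1), of n], of 0 j] assms by auto

lemma lab_backward:
  assumes "x \<in> topspace X" "j < lab n ((f ^^ j) x)"
  shows "lab n x = lab n ((f ^^ j) x) - j"
  using tower_seq_backward[OF tower_seq_lab[OF assms(1), of n], of j 0] assms by auto

lemma lab_g: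
  assumes "x \<in> topspace X" "j < lab n x"
  shows "lab n ((g ^^ j) x) = lab n x - j"
  using lab_backward[OF gn_in[OF assms(1)], of j n] fn_gn assms by auto

lemma lab_set_open: "openin X {x \<in> topspace X. lab n x \<in> K}"
proof -
  have "{x \<in> topspace X. lab n x \<in> K} = (\<Union>k\<in>K. {x \<in> topspace X. lab n x = k})" by auto
  then show ?thesis using lab_open by (metis (no_types, lifting) imageE openin_Union)
qed

lemma cont_fn: "continuous_map X X (f ^^ i)"
proof (induction i)
  case (Suc i)
  then show ?case using continuous_map_compose[OF Suc cont_f] by (simp add: o_def)
qed (simp add: id_def)

lemma cont_gn: "continuous_map X X (g ^^ i)"
proof (induction i)
  case (Suc i)
  then show ?case using continuous_map_compose[OF Suc cont_g] by (simp add: o_def)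
qed (simp add: id_def)

text \<open>Increasing open sets of points whose label already differs from that of \<open>x\<close> cover, together with
  \<open>U\<close>, the whole space; one of them suffices by compactness.\<close>

lemma lab_basis:
  assumes U: "openin X U" and x: "x \<in> U"
  shows "\<exists>m. \<forall>y\<in>topspace X. lab m y = lab m x \<longrightarrow> y \<in> U"
proof (rule ccontr)
  assume no: "\<not> ?thesis"
  have xT: "x \<in> topspace X" using U x openin_subset by blast
  define A where "A m = {y \<in> topspace X. lab m y \<in> - {lab m x}}" for m
  have "openin X (A m)" for m unfolding A_def by (rule lab_set_open)
  moreover have "topspace X \<subseteq> \<Union>(insert U (range A))"
    using lab_separates[OF _ xT] x unfolding A_def by auto
  ultimately obtain \<F> where F: "finite \<F>" "\<F> \<subseteq> insert U (range A)" "topspace X \<subseteq> \<Union>\<F>"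
    using compact U unfolding compact_space_alt by (smt (verit) imageE insertE)
  have "finite (\<F> - {U})" "\<F> - {U} \<subseteq> range A" using F by auto
  then obtain I where I: "finite I" "\<F> - {U} = A ` I" by (meson finite_subset_image)
  obtain M where M: "\<forall>i\<in>I. i \<le> M" using I(1) finite_nat_set_iff_bounded_le by blast
  obtain y where y: "y \<in> topspace X" "lab M y = lab M x" "y \<notin> U" using no by blast
  then obtain i where "i \<in> I" "y \<in> A i" using F(3) I by blast
  then show False using lab_mono_refine[OF y(1) xT, of i M] M y unfolding A_def by auto
qed

text \<open>Refinement makes membership in the tall tower of level \<open>n\<close> a property \<open>\<alpha>\<close> of the label of level
  \<open>n + 1\<close>; \<open>a\<close> and \<open>b\<close> are the first and the last floor of the tall tower of level \<open>n + 1\<close> with this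
  property.\<close>

lemma level_code:
  obtains \<alpha> a b where "\<And>x. x \<in> topspace X \<Longrightarrow> \<alpha> (lab (Suc n) x) \<longleftrightarrow> 0 < lab n x"
    "\<not> \<alpha> 0" "\<alpha> a" "\<And>k. k < a \<Longrightarrow> \<not> \<alpha> k" "0 < a" "a \<le> h (Suc n)"
    "\<alpha> b" "b \<le> h (Suc n)" "\<And>k. b < k \<Longrightarrow> k \<le> h (Suc n) \<Longrightarrow> \<not> \<alpha> k"
proof -
  define \<alpha> where "\<alpha> k \<longleftrightarrow> (\<exists>x\<in>topspace X. lab (Suc n) x = k \<and> 0 < lab n x)" for k
  have 1: "\<alpha> (lab (Suc n) x) \<longleftrightarrow> 0 < lab n x" if "x \<in> topspace X" for x
    unfolding \<alpha>_def using lab_refine that by metis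
  have 2: "\<not> \<alpha> 0" using 1[OF p_in] lab_p by auto
  obtain w where w: "w \<in> topspace X" "0 < lab n w" using lab_nontrivial' by blast
  have 3: "\<exists>k. \<alpha> k" using 1 w by blast
  have 4: "k \<le> h (Suc n)" if "\<alpha> k" for k using that lab_le unfolding \<alpha>_def by auto
  have a: "\<alpha> (Least \<alpha>)" using 3 by (metis LeastI_ex)
  have a': "\<And>k. k < Least \<alpha> \<Longrightarrow> \<not> \<alpha> k" by (rule not_less_Least)
  have b: "\<alpha> (Greatest \<alpha>)" using 3 4 by (metis GreatestI_ex_nat)
  have b': "\<not> \<alpha> k" if "Greatest \<alpha> < k" for k
    using that 4 Greatest_le_nat[of \<alpha> k "h (Suc n)"] by fastforce
  have "0 < Least \<alpha>" using a 2 by (metis neq0_conv)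
  show ?thesis using that[OF 1 2 a a' \<open>0 < Least \<alpha>\<close> 4[OF a] b 4[OF b] b'] by blast
qed

text \<open>As \<open>p\<close> is fixed, the points that stay in \<open>U\<close> for the times up to \<open>N\<close> form a neighbourhood of
  \<open>p\<close>.\<close>

lemma long_visit:
  assumes "openin X U" "p \<in> U"
  shows "\<exists>T. \<forall>x\<in>topspace X. \<exists>t\<le>T. \<forall>i\<le>N. (f ^^ (t + i)) x \<in> U"
proof -
  define V where "V = (\<Inter>i\<in>{..N}. {x \<in> topspace X. (f ^^ i) x \<in> U})"
  have "openin X V" unfolding V_def
    by (rule openin_INT2) (use openin_continuous_map_preimage[OF cont_fn assms(1)] in auto)
  moreover have "p \<in> V" unfolding V_def using p_in fn_p assms by auto
  ultimately obtain T where T: "\<forall>x\<in>topspace X. \<exists>t\<le>T. (f ^^ t) x \<in> V" using visits by presburger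
  have "\<forall>i\<le>N. (f ^^ (t + i)) x \<in> U" if "(f ^^ t) x \<in> V" for t x
    using that unfolding V_def by (auto simp: add.commute[of t] funpow_add)
  then have "\<exists>t\<le>T. \<forall>i\<le>N. (f ^^ (t + i)) x \<in> U" if "x \<in> topspace X" for x
    using T that by meson
  then show ?thesis by auto
qed

text \<open>A long visit to the tower of height one at level \<open>n\<close> is the gap that
  \<open>tower_seq_resynchronise\<close> asks for. The time \<open>S\<close> depends on the level only, which allows
  starting the orbits in the past below.\<close>

lemma next_level_synchronised:
  obtains S where "\<And>x y s. x \<in> topspace X \<Longrightarrow> y \<in> topspace X \<Longrightarrow>
      (\<And>i. 0 < lab n ((f ^^ i) x) \<longleftrightarrow> 0 < lab n ((f ^^ i) y)) \<Longrightarrow> S \<le> s \<Longrightarrow>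
      lab (Suc n) ((f ^^ s) x) = lab (Suc n) ((f ^^ s) y)"
proof -
  obtain \<alpha> a b where \<alpha>: "\<And>x. x \<in> topspace X \<Longrightarrow> \<alpha> (lab (Suc n) x) \<longleftrightarrow> 0 < lab n x"
    and a: "\<alpha> a" "\<And>k. k < a \<Longrightarrow> \<not> \<alpha> k" "0 < a" "a \<le> h (Suc n)"
    by (rule level_code[of n]) blast
  have "openin X {x \<in> topspace X. lab n x = 0}" "p \<in> {x \<in> topspace X. lab n x = 0}"
    using lab_open p_in lab_p by auto
  from long_visit[OF this, of "h (Suc n)"] obtain T where
    T: "\<And>x. x \<in> topspace X \<Longrightarrow> \<exists>t\<le>T. \<forall>i\<le>h (Suc n). lab n ((f ^^ (t + i)) x) = 0"
    unfolding mem_Collect_eq by metis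
  show ?thesis
  proof (rule that[of "T + h (Suc n)"])
    fix x y s
    assume x: "x \<in> topspace X" and y: "y \<in> topspace X"
      and eq: "\<And>i. 0 < lab n ((f ^^ i) x) \<longleftrightarrow> 0 < lab n ((f ^^ i) y)" and s: "T + h (Suc n) \<le> s"
    obtain t where t: "t \<le> T" "\<forall>i\<le>h (Suc n). lab n ((f ^^ (t + i)) x) = 0" using T x by blast
    have "\<not> \<alpha> (lab (Suc n) ((f ^^ u) x))" if "t \<le> u" "u < t + h (Suc n)" for u
      using t(2)[rule_format, of "u - t"] that \<alpha>[OF fn_in[OF x, of u]] by auto
    then show "lab (Suc n) ((f ^^ s) x) = lab (Suc n) ((f ^^ s) y)"
      using tower_seq_resynchronise[OF tower_seq_lab[OF x] tower_seq_lab[OF y], of \<alpha> "Suc n" a t s]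
        eq \<alpha> fn_in x y a t s by auto
  qed
qed

text \<open>Agreement of the two-symbol codings of the full orbits, with the past expressed through the
  iterates of the inverse.\<close>

definition same_code :: "nat \<Rightarrow> 'a \<Rightarrow> 'a \<Rightarrow> bool" where
  "same_code n x y \<longleftrightarrow>
     (\<forall>i. (0 < lab n ((f ^^ i) x) \<longleftrightarrow> 0 < lab n ((f ^^ i) y)) \<and>
          (0 < lab n ((g ^^ i) x) \<longleftrightarrow> 0 < lab n ((g ^^ i) y)))"

lemma same_code_orbit:
  assumes x: "x \<in> topspace X" and y: "y \<in> topspace X" and s: "same_code n x y"
  shows "same_code n (f x) (f y)" "same_code n (g x) (g y)"
proof -
  have f: "(f ^^ i) (f z) = (f ^^ Suc i) z" for i z by (rule funpow_Suc_shift[symmetric])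
  have g: "(g ^^ i) (g z) = (g ^^ Suc i) z" for i z by (rule funpow_Suc_shift[symmetric])
  have gf': "(g ^^ i) (f z) = (case i of 0 \<Rightarrow> (f ^^ 1) z | Suc j \<Rightarrow> (g ^^ j) z)"
    if "z \<in> topspace X" for i z
    using that gf by (cases i) (auto simp: funpow_Suc_shift simp del: funpow.simps(2))
  have fg': "(f ^^ i) (g z) = (case i of 0 \<Rightarrow> (g ^^ 1) z | Suc j \<Rightarrow> (f ^^ j) z)"
    if "z \<in> topspace X" for i z
    using that fg by (cases i) (auto simp: funpow_Suc_shift simp del: funpow.simps(2))
  show "same_code n (f x) (f y)" unfolding same_code_def f gf'[OF x] gf'[OF y]
    using s unfolding same_code_def by (auto split: nat.split simp del: funpow.simps)
  show "same_code n (g x) (g y)" unfolding same_code_def g fg'[OF x] fg'[OF y]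
    using s unfolding same_code_def by (auto split: nat.split simp del: funpow.simps)
qed

text \<open>Synchronisation is applied to the points that lie \<open>S\<close> steps in the past.\<close>

lemma same_code_Suc_lab:
  assumes x: "x \<in> topspace X" and y: "y \<in> topspace X" and s: "same_code n x y"
  shows "lab (Suc n) x = lab (Suc n) y"
proof -
  obtain S where S: "\<And>x y s. x \<in> topspace X \<Longrightarrow> y \<in> topspace X \<Longrightarrow>
      (\<And>i. 0 < lab n ((f ^^ i) x) \<longleftrightarrow> 0 < lab n ((f ^^ i) y)) \<Longrightarrow> S \<le> s \<Longrightarrow>
      lab (Suc n) ((f ^^ s) x) = lab (Suc n) ((f ^^ s) y)"
    by (rule next_level_synchronised[of n]) blast
  have "lab (Suc n) ((f ^^ S) ((g ^^ S) x)) = lab (Suc n) ((f ^^ S) ((g ^^ S) y))"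
    by (rule S) (use s x y gn_in in \<open>auto simp: fn_gm same_code_def\<close>)
  then show ?thesis using fn_gn x y by auto
qed

lemma same_code_Suc:
  assumes x: "x \<in> topspace X" and y: "y \<in> topspace X" and s: "same_code n x y"
  shows "same_code (Suc n) x y"
proof -
  have "same_code n ((f ^^ i) x) ((f ^^ i) y)" for i
    by (induction i) (simp_all add: s same_code_orbit(1) fn_in x y)
  moreover have "same_code n ((g ^^ i) x) ((g ^^ i) y)" for i
    by (induction i) (simp_all add: s same_code_orbit(2) gn_in x y)
  ultimately have "lab (Suc n) ((f ^^ i) x) = lab (Suc n) ((f ^^ i) y)"
    "lab (Suc n) ((g ^^ i) x) = lab (Suc n) ((g ^^ i) y)" for i
    using same_code_Suc_lab[OF fn_in fn_in] same_code_Suc_lab[OF gn_in gn_in] x y by blast+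
  then show ?thesis unfolding same_code_def by auto
qed

text \<open>Agreement climbs from each level to the next one, and all labels together separate points.\<close>

theorem same_code_imp_eq:
  assumes x: "x \<in> topspace X" and y: "y \<in> topspace X" and s: "same_code 0 x y"
  shows "x = y"
proof -
  have c: "same_code n x y" for n
    by (induction n) (simp_all add: s same_code_Suc x y)
  have "lab n x = lab n y" for n
    using lab_refine same_code_Suc_lab[OF x y c] x y by blast
  then show ?thesis using lab_separates x y by blast
qed

text \<open>Agreement of labels for all nonnegative times also climbs through the levels, without losing any
  initial times: the next level agrees in the far future by synchronisation, and from there back to
  time \<open>0\<close> because at time \<open>0\<close> the orbits are in the tall tower.\<close>

lemma eventual_code_imp_eq:
  assumes x: "x \<in> topspace X" and y: "y \<in> topspace X"
    and eq: "\<And>i. lab n ((f ^^ i) x) = lab n ((f ^^ i) y)" and pos: "0 < lab n x"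
  shows "x = y"
proof -
  have all: "\<forall>i. lab m ((f ^^ i) x) = lab m ((f ^^ i) y)" if "n \<le> m" for m
    using that
  proof (induction m rule: dec_induct)
    case (step m)
    obtain \<alpha> a b where \<alpha>: "\<And>x. x \<in> topspace X \<Longrightarrow> \<alpha> (lab (Suc m) x) \<longleftrightarrow> 0 < lab m x"
      and \<alpha>0: "\<not> \<alpha> 0"
      and b: "\<alpha> b" "b \<le> h (Suc m)" "\<And>k. b < k \<Longrightarrow> k \<le> h (Suc m) \<Longrightarrow> \<not> \<alpha> k"
      by (rule level_code[of m]) blast
    obtain S where S: "\<And>x y s. x \<in> topspace X \<Longrightarrow> y \<in> topspace X \<Longrightarrow>
        (\<And>i. 0 < lab m ((f ^^ i) x) \<longleftrightarrow> 0 < lab m ((f ^^ i) y)) \<Longrightarrow> S \<le> s \<Longrightarrow>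
        lab (Suc m) ((f ^^ s) x) = lab (Suc m) ((f ^^ s) y)"
      by (rule next_level_synchronised[of m]) blast
    have far: "\<And>s. S \<le> s \<Longrightarrow> lab (Suc m) ((f ^^ s) x) = lab (Suc m) ((f ^^ s) y)"
      by (rule S[OF x y]) (simp_all add: step.IH)
    have "0 < lab m x" using lab_pos_mono x step.hyps pos by blast
    then have "\<alpha> (lab (Suc m) ((f ^^ 0) x))" by (simp add: \<alpha> x)
    moreover have "\<alpha> (lab (Suc m) ((f ^^ s) x)) \<longleftrightarrow> \<alpha> (lab (Suc m) ((f ^^ s) y))" for s
      by (simp add: \<alpha> fn_in x y step.IH)
    ultimately show ?case
      using tower_seq_agree_backwards[OF tower_seq_lab[OF x] tower_seq_lab[OF y] _ b(3) \<alpha>0 b(1,2) _ far]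
      by blast
  qed (use eq in auto)
  have "lab m x = lab m y" for m
  proof -
    have "lab (max m n) x = lab (max m n) y" using all[rule_format, of "max m n" 0] by auto
    then show ?thesis using lab_mono_refine[OF x y] by (metis max.cobounded1)
  qed
  then show ?thesis using lab_separates x y by blast
qed

text \<open>A visit of the forward orbit of \<open>(g ^^ T) x\<close> within time \<open>T\<close> is a visit of the backward orbit of
  \<open>x\<close>.\<close>

lemma visits_g:
  assumes "openin X U" "p \<in> U"
  shows "\<exists>T. \<forall>x\<in>topspace X. \<exists>t\<le>T. (g ^^ t) x \<in> U"
proof -
  obtain T where T: "\<forall>x\<in>topspace X. \<exists>t\<le>T. (f ^^ t) x \<in> U" using visits assms by blast
  have "\<exists>t\<le>T. (g ^^ t) x \<in> U" if x: "x \<in> topspace X" for x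
  proof -
    obtain t where t: "t \<le> T" "(f ^^ t) ((g ^^ T) x) \<in> U" using T gn_in x by blast
    then have "(g ^^ (T - t)) x \<in> U" using fn_gm[OF x, of t T] by (cases "T = t") auto
    then show ?thesis by (meson diff_le_self)
  qed
  then show ?thesis by blast
qed

text \<open>Under time reversal the tall towers are traversed from the top, so their floors are numbered in the
  opposite order.\<close>

definition reversed_lab :: "nat \<Rightarrow> 'a \<Rightarrow> nat" where
  "reversed_lab n x = (if lab n x = 0 then 0 else Suc (h n) - lab n x)"

lemma reversed_lab_eq_iff:
  "x \<in> topspace X \<Longrightarrow> y \<in> topspace X \<Longrightarrow> reversed_lab n x = reversed_lab n y \<longleftrightarrow> lab n x = lab n y"
  using lab_le[of x n] lab_le[of y n] unfolding reversed_lab_def by auto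

lemma reversed_lab_pos_iff: "x \<in> topspace X \<Longrightarrow> 0 < reversed_lab n x \<longleftrightarrow> 0 < lab n x"
  using lab_le[of x n] unfolding reversed_lab_def by auto

lemma reversed: "tower_labelling X g f p reversed_lab h"
proof
  show "openin X {x \<in> topspace X. reversed_lab n x = k}" for n k
  proof -
    have "{x \<in> topspace X. reversed_lab n x = k} =
        {x \<in> topspace X. lab n x \<in> {j. (if j = 0 then 0 else Suc (h n) - j) = k}}"
      unfolding reversed_lab_def by auto
    then show ?thesis using lab_set_open[of n "{j. (if j = 0 then 0 else Suc (h n) - j) = k}"] by simp
  qed
  fix n x assume x: "x \<in> topspace X"
  show "reversed_lab n x \<le> h n" unfolding reversed_lab_def by auto
  have le: "lab n (g x) \<le> h n" "lab n x \<le> h n" using lab_le g_in x by auto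
  show "reversed_lab n (g x) = Suc (reversed_lab n x)" if "0 < reversed_lab n x" "reversed_lab n x < h n"
  proof -
    have "1 < lab n x" using that le unfolding reversed_lab_def by (auto split: if_splits)
    then have "lab n (g x) = lab n x - 1" using lab_g[OF x, of 1 n] by auto
    then show ?thesis using \<open>1 < lab n x\<close> le unfolding reversed_lab_def by auto
  qed
  show "reversed_lab n (g x) \<le> 1" if "reversed_lab n x = 0 \<or> reversed_lab n x = h n"
  proof (rule ccontr)
    assume "\<not> ?thesis"
    then have "0 < lab n (g x)" "lab n (g x) < h n" unfolding reversed_lab_def by (auto split: if_splits)
    then have "lab n x = Suc (lab n (g x))" using lab_Suc[OF g_in[OF x], of n] fg[OF x] by auto
    then show False using that le \<open>0 < lab n (g x)\<close> unfolding reversed_lab_def by auto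
  qed
next
  fix n x y assume "x \<in> topspace X" "y \<in> topspace X" "reversed_lab (Suc n) x = reversed_lab (Suc n) y"
  then show "reversed_lab n x = reversed_lab n y" using reversed_lab_eq_iff lab_refine by blast
next
  fix x y assume "x \<in> topspace X" "y \<in> topspace X" "\<And>n. reversed_lab n x = reversed_lab n y"
  then show "x = y" using reversed_lab_eq_iff lab_separates by blast
next
  show "\<exists>x\<in>topspace X. 0 < reversed_lab 0 x"
    using lab_nontrivial reversed_lab_pos_iff by blast
next
  show "attracts X g p" unfolding attracts_def using p_in gp visits_g by blast
qed (simp_all add: compact cont_f cont_g gf fg lab_p reversed_lab_def)

end

section \<open>Expansivity and scrambled pairs\<close>

lemma compatible_metricD:
  assumes "compatible_metric X d"
  shows "mtopology_of (metric (topspace X, d)) = X" "mdist (metric (topspace X, d)) = d"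
    "mspace (metric (topspace X, d)) = topspace X"
proof -
  interpret Metric_space "topspace X" d using assms unfolding compatible_metric_def by auto
  show "mtopology_of (metric (topspace X, d)) = X" "mdist (metric (topspace X, d)) = d"
    "mspace (metric (topspace X, d)) = topspace X"
    using assms unfolding compatible_metric_def by (auto simp: mtopology_of_def)
qed

lemma continuous_map_dist:
  assumes "compatible_metric X d" "continuous_map X X a" "continuous_map X X b"
  shows "continuous_map X euclideanreal (\<lambda>x. d (a x) (b x))"
  using continuous_map_mdist[of X "metric (topspace X, d)" a b] assms
  by (simp add: compatible_metricD)

lemma frequently_nearby_imp_liminf_dist_0:
  assumes "\<And>n. 0 \<le> d ((f ^^ n) x) ((f ^^ n) y)"
    and "\<And>\<epsilon> N. 0 < \<epsilon> \<Longrightarrow> \<exists>n\<ge>N. d ((f ^^ n) x) ((f ^^ n) y) < \<epsilon>"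
  shows "liminf_dist d f x y = 0"
proof (rule antisym)
  show "0 \<le> liminf_dist d f x y" unfolding liminf_dist_def
    by (rule Liminf_bounded) (simp add: assms(1))
  show "liminf_dist d f x y \<le> 0"
  proof (rule ccontr)
    assume "\<not> ?thesis"
    then have "0 < liminf_dist d f x y" by simp
    then obtain e where e: "0 < ereal e" "ereal e < liminf_dist d f x y"
      using ereal_dense2 by blast
    from less_LiminfD[OF e(2)[unfolded liminf_dist_def]]
    obtain N where N: "\<And>n. n \<ge> N \<Longrightarrow> ereal e < ereal (d ((f ^^ n) x) ((f ^^ n) y))"
      unfolding eventually_sequentially by blast
    obtain n where "n \<ge> N" "d ((f ^^ n) x) ((f ^^ n) y) < e" using assms(2)[of e N] e(1) by auto
    with N[of n] show False by simp
  qed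
qed

locale metric_tower_labelling = tower_labelling +
  fixes d :: "'a \<Rightarrow> 'a \<Rightarrow> real"
  assumes metric: "compatible_metric X d"
begin

sublocale Metric_space "topspace X" d
  using metric unfolding compatible_metric_def by auto

lemma mtopology_eq: "mtopology = X"
  using metric unfolding compatible_metric_def by auto

lemma reversed_metric: "metric_tower_labelling X g f p reversed_lab h d"
  using reversed metric unfolding metric_tower_labelling_def metric_tower_labelling_axioms_def by blast

text \<open>While the orbit of \<open>x\<close> pays a sufficiently long visit to \<open>U\<close>, the orbit of \<open>y\<close> is bound to pass
  through \<open>U\<close>.\<close>

lemma common_visit:
  assumes "x \<in> topspace X" "y \<in> topspace X" "openin X U" "p \<in> U"
  shows "\<exists>t. (f ^^ t) x \<in> U \<and> (f ^^ t) y \<in> U"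
proof -
  obtain N where N: "\<forall>z\<in>topspace X. \<exists>t\<le>N. (f ^^ t) z \<in> U" using visits assms by blast
  obtain T where "\<forall>z\<in>topspace X. \<exists>t\<le>T. \<forall>i\<le>N. (f ^^ (t + i)) z \<in> U"
    using long_visit[OF assms(3,4), of N] by auto
  then obtain t where t: "\<forall>i\<le>N. (f ^^ (t + i)) x \<in> U" using assms by meson
  obtain i where i: "i \<le> N" "(f ^^ i) ((f ^^ t) y) \<in> U" using N fn_in[OF assms(2)] by meson
  then have "(f ^^ (t + i)) y \<in> U" by (simp add: add.commute[of t] funpow_add)
  with t i show ?thesis by blast
qed

lemma liminf_dist_0:
  assumes x: "x \<in> topspace X" and y: "y \<in> topspace X"
  shows "liminf_dist d f x y = 0"
proof (rule frequently_nearby_imp_liminf_dist_0)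
  fix \<epsilon> :: real and N :: nat assume "0 < \<epsilon>"
  then have "openin X (mball p (\<epsilon> / 2))" "p \<in> mball p (\<epsilon> / 2)"
    using openin_mball p_in mtopology_eq by auto
  from common_visit[OF fn_in[OF x] fn_in[OF y] this, of N N]
  obtain t where t: "(f ^^ t) ((f ^^ N) x) \<in> mball p (\<epsilon> / 2)" "(f ^^ t) ((f ^^ N) y) \<in> mball p (\<epsilon> / 2)"
    by blast
  then have "d ((f ^^ (t + N)) x) ((f ^^ (t + N)) y) < \<epsilon>"
    using triangle[of "(f ^^ (t + N)) x" p "(f ^^ (t + N)) y"] fn_in[of _ "t + N"] x y p_in
      commute[of p "(f ^^ (t + N)) x"]
    by (simp add: funpow_add)
  then show "\<exists>n\<ge>N. d ((f ^^ n) x) ((f ^^ n) y) < \<epsilon>" by (meson le_add2)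
qed auto

text \<open>The label is a continuous function on a compact metric space, hence uniformly continuous, and it is
  integer valued.\<close>

lemma close_imp_same_label: "\<exists>\<epsilon>>0. \<forall>x\<in>topspace X. \<forall>y\<in>topspace X. d x y < \<epsilon> \<longrightarrow> lab n x = lab n y"
proof -
  have "continuous_map X euclideanreal (\<lambda>x. real (lab n x))"
    unfolding continuous_map_def
  proof (intro conjI allI impI)
    fix U :: "real set"
    have "{x \<in> topspace X. real (lab n x) \<in> U} = {x \<in> topspace X. lab n x \<in> {k. real k \<in> U}}" by auto
    then show "openin X {x \<in> topspace X. real (lab n x) \<in> U}"
      using lab_set_open[of n "{k. real k \<in> U}"] by simp
  qed auto
  then have "uniformly_continuous_map (metric (topspace X, d)) euclidean_metric (\<lambda>x. real (lab n x))"
    by (intro continuous_imp_uniformly_continuous_map) (simp add: compatible_metricD metric compact mtopology_eq)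
  then have "\<forall>\<epsilon>>0. \<exists>\<delta>>0. \<forall>x\<in>topspace X. \<forall>y\<in>topspace X. d y x < \<delta> \<longrightarrow>
      dist (real (lab n y)) (real (lab n x)) < \<epsilon>"
    unfolding uniformly_continuous_map_def by (simp add: compatible_metricD[OF metric])
  from this[rule_format, OF zero_less_one] obtain \<delta> where "0 < \<delta>"
    "\<forall>x\<in>topspace X. \<forall>y\<in>topspace X. d y x < \<delta> \<longrightarrow> dist (real (lab n y)) (real (lab n x)) < 1"
    by blast
  moreover have "lab n x = lab n y" if "dist (real (lab n x)) (real (lab n y)) < 1" for x y
    using that by (simp add: dist_real_def)
  ultimately show ?thesis by blast
qed

text \<open>Outside the stable set of \<open>p\<close>, the orbit of \<open>x\<close> leaves some neighbourhood of \<open>p\<close> infinitely often,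
  so it is infinitely often in the tall tower of a suitable level. At such a time \<open>T\<close>, late enough for
  the orbits to have the same labels of this level from then on, \<open>eventual_code_imp_eq\<close> applies.\<close>

lemma asymptotic_imp_eq:
  assumes x: "x \<in> topspace X" and y: "y \<in> topspace X" and xs: "x \<notin> stable_set X f p"
    and lim: "limsup_dist d f x y \<le> 0"
  shows "x = y"
proof -
  obtain U where U: "openin X U" "p \<in> U" "\<not> eventually (\<lambda>i. (f ^^ i) x \<in> U) sequentially"
    using xs x p_in unfolding stable_set_def limitin_def by auto
  obtain m where m: "\<forall>y\<in>topspace X. lab m y = lab m p \<longrightarrow> y \<in> U" using lab_basis U by blast
  obtain \<epsilon> where e: "0 < \<epsilon>" "\<forall>x\<in>topspace X. \<forall>y\<in>topspace X. d x y < \<epsilon> \<longrightarrow> lab m x = lab m y"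
    using close_imp_same_label by blast
  have "limsup_dist d f x y < ereal \<epsilon>"
    using lim e(1) by (metis ereal_less(2) order_le_less_trans)
  from Limsup_lessD[OF this[unfolded limsup_dist_def]]
  obtain N where N: "\<And>n. n \<ge> N \<Longrightarrow> d ((f ^^ n) x) ((f ^^ n) y) < \<epsilon>"
    unfolding eventually_sequentially by auto
  obtain T where T: "T \<ge> N" "(f ^^ T) x \<notin> U" using U(3) unfolding eventually_sequentially by auto
  have "0 < lab m ((f ^^ T) x)" using m T(2) fn_in[OF x] lab_p by (metis neq0_conv)
  moreover have "lab m ((f ^^ i) ((f ^^ T) x)) = lab m ((f ^^ i) ((f ^^ T) y))" for i
    using e(2) N[of "i + T"] T(1) fn_in x y by (simp add: funpow_add)
  ultimately have "(f ^^ T) x = (f ^^ T) y" using eventual_code_imp_eq fn_in x y by blast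
  then show ?thesis using gn_fn x y by metis
qed

theorem scrambled_off_stable_set:
  "K \<subseteq> topspace X - stable_set X f p \<Longrightarrow> scrambled d f K"
  unfolding scrambled_def using liminf_dist_0 asymptotic_imp_eq by (meson DiffD1 DiffD2 not_le subsetD)

lemma expansive: "expansive X d f"
proof -
  obtain \<epsilon> where e: "0 < \<epsilon>" "\<forall>x\<in>topspace X. \<forall>y\<in>topspace X. d x y < \<epsilon> \<longrightarrow> lab 0 x = lab 0 y"
    using close_imp_same_label by blast
  have "\<exists>i. d (iter X f i x) (iter X f i y) \<ge> \<epsilon>"
    if x: "x \<in> topspace X" and y: "y \<in> topspace X" and ne: "x \<noteq> y" for x y
  proof (rule ccontr)
    assume no: "\<not> ?thesis"
    have "d ((f ^^ i) x) ((f ^^ i) y) < \<epsilon>" for i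
      using no[simplified, rule_format, of "int i"] by (simp add: iter_def not_le)
    moreover have "d ((g ^^ i) x) ((g ^^ i) y) < \<epsilon>" for i
      using no[simplified, rule_format, of "- int i"]
      by (cases "i = 0") (auto simp add: iter_def not_le inv_map_funpow x y)
    ultimately have "same_code 0 x y"
      unfolding same_code_def using e(2) fn_in[OF x] fn_in[OF y] gn_in[OF x] gn_in[OF y] by metis
    with ne show False using same_code_imp_eq x y by blast
  qed
  with e(1) show ?thesis unfolding expansive_def by blast
qed

text \<open>If no point of the base of the tall tower of level \<open>m\<close> returned to the base, then every tall tower of
  a finer level would meet this base in a single floor. All points of the base would then have the
  same labels at all levels, and the base would be an isolated point.\<close>

lemma floor_returns:
  assumes "\<And>x. x \<in> topspace X \<Longrightarrow> \<not> openin X {x}"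
  shows "\<exists>z\<in>topspace X. lab m z = 1 \<and> (\<exists>i>0. lab m ((f ^^ i) z) = 1)"
proof (rule ccontr)
  assume no: "\<not> ?thesis"
  obtain w where w: "w \<in> topspace X" "0 < lab m w" using lab_nontrivial' by blast
  define x where "x = (g ^^ (lab m w - 1)) w"
  have x: "x \<in> topspace X" "lab m x = 1"
    unfolding x_def using gn_in w lab_g[of w "lab m w - 1" m] by auto
  \<comment> \<open>a higher floor of level \<open>n\<close> over the base of level \<open>m\<close> is reached from the lower one, which would be a return\<close>
  have not_less: "\<not> lab n y < lab n z"
    if y: "y \<in> topspace X" "lab m y = 1" and z: "z \<in> topspace X" "lab m z = 1" and mn: "m \<le> n" for n y z
  proof
    assume less: "lab n y < lab n z"
    have "0 < lab n y" using lab_pos_mono[OF y(1) mn] y by auto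
    then have "lab n ((f ^^ (lab n z - lab n y)) y) = lab n z"
      using lab_forward[OF y(1)] lab_le[OF z(1), of n] less by auto
    then have "lab m ((f ^^ (lab n z - lab n y)) y) = 1"
      using lab_mono_refine[OF fn_in[OF y(1)] z(1) mn] z by auto
    then show False using no y less by (metis zero_less_diff)
  qed
  have "y = x" if y: "y \<in> topspace X" "lab m y = 1" for y
  proof (rule lab_separates[OF y(1) x(1)])
    fix n
    have "lab (max m n) y = lab (max m n) x"
      using not_less[OF y x, of "max m n"] not_less[OF x y, of "max m n"] by auto
    then show "lab n y = lab n x" using lab_mono_refine[OF y(1) x(1)] by (metis max.cobounded2)
  qed
  then have "{y \<in> topspace X. lab m y = 1} = {x}" using x by blast
  then have "openin X {x}" using lab_open[of m 1] by simp
  then show False using assms[OF x(1)] by simp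
qed

text \<open>The set \<open>U\<close> contains a floor of some tall tower, of level \<open>m\<close> say. A point of the base of this tower
  that returns to the base passes through the floor in \<open>U\<close> and climbs the whole tower once more
  afterwards, and some floor of this tower lies in the tall tower of level \<open>0\<close>.\<close>

lemma open_set_leaves_tower_0:
  assumes perfect: "\<And>x. x \<in> topspace X \<Longrightarrow> \<not> openin X {x}"
    and U: "openin X U" "U \<noteq> {}"
  shows "\<exists>x\<in>U. \<exists>i. 0 < lab 0 ((f ^^ i) x)"
proof -
  have "U \<noteq> {p}" using perfect p_in U by auto
  then obtain x where x: "x \<in> U" "x \<noteq> p" using U(2) by auto
  have xT: "x \<in> topspace X" using x U openin_subset by blast
  obtain m1 where m1: "\<forall>y\<in>topspace X. lab m1 y = lab m1 x \<longrightarrow> y \<in> U" using lab_basis U x by blast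
  obtain m2 where m2: "lab m2 x \<noteq> lab m2 p" using lab_separates[OF xT p_in] x by blast
  define m where "m = max m1 m2"
  have m: "y \<in> U" if "y \<in> topspace X" "lab m y = lab m x" for y
    using m1 lab_mono_refine[OF that(1) xT _ that(2), of m1] that unfolding m_def by auto
  have pos: "0 < lab m x" using lab_pos_mono[OF xT, of m2 m] m2 lab_p unfolding m_def by auto
  obtain z i where z: "z \<in> topspace X" "lab m z = 1" "i > 0" "lab m ((f ^^ i) z) = 1"
    using floor_returns[OF perfect] by blast
  have i: "lab m x \<le> i"
  proof (rule ccontr)
    assume "\<not> ?thesis"
    then have "lab m ((f ^^ i) z) = 1 + i"
      using lab_forward[OF z(1), of m i] z lab_le[OF xT, of m] by auto
    with z show False by auto
  qed
  obtain w where w: "w \<in> topspace X" "0 < lab 0 w" using lab_nontrivial by blast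
  have w': "0 < lab m w" using lab_pos_mono w by blast
  define y where "y = (f ^^ (lab m x - 1)) z"
  have "lab m y = lab m x" unfolding y_def
    using lab_forward[OF z(1), of m "lab m x - 1"] z pos lab_le[OF xT, of m] by auto
  then have y: "y \<in> topspace X" "y \<in> U" using m fn_in z unfolding y_def by auto
  have "lab m ((f ^^ (lab m w - 1)) ((f ^^ i) z)) = lab m w"
    using lab_forward[OF fn_in[OF z(1)], of m i "lab m w - 1"] z w' lab_le[OF w(1), of m] by auto
  then have "lab 0 ((f ^^ (lab m w - 1)) ((f ^^ i) z)) = lab 0 w"
    using lab_mono_refine[OF fn_in[OF fn_in[OF z(1)]] w(1), of 0 m] by auto
  moreover have "(f ^^ (lab m w - 1)) ((f ^^ i) z) = (f ^^ (lab m w - 1 + (i - (lab m x - 1)))) y"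
  proof -
    have "i = (i - (lab m x - 1)) + (lab m x - 1)" using i by auto
    then have "(f ^^ i) z = (f ^^ (i - (lab m x - 1))) y" unfolding y_def
      by (metis comp_apply funpow_add)
    then show ?thesis by (simp add: funpow_add)
  qed
  ultimately show ?thesis using w y by metis
qed

text \<open>The scrambled set consists of the points that visit the tall tower of level \<open>0\<close> infinitely often in
  the future.\<close>

theorem residually_scrambled:
  assumes perfect: "\<And>x. x \<in> topspace X \<Longrightarrow> \<not> openin X {x}"
  shows "residually_scrambled X d f"
proof -
  define Q where "Q N = {x \<in> topspace X. \<exists>i\<ge>N. 0 < lab 0 ((f ^^ i) x)}" for N
  define S where "S = \<Inter>(range Q)"
  have op: "openin X (Q N)" for N
  proof -
    have "Q N = (\<Union>i\<in>{N..}. {x \<in> topspace X. (f ^^ i) x \<in> {y \<in> topspace X. lab 0 y \<in> {0<..}}})"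
      unfolding Q_def using fn_in by auto
    moreover have "openin X {x \<in> topspace X. (f ^^ i) x \<in> {y \<in> topspace X. lab 0 y \<in> {0<..}}}" for i
      by (rule openin_continuous_map_preimage[OF cont_fn lab_set_open])
    ultimately show ?thesis by auto
  qed
  have dense: "X closure_of (Q N) = topspace X" for N
    unfolding dense_intersects_open
  proof (intro allI impI, elim conjE)
    fix U assume U: "openin X U" "U \<noteq> {}"
    \<comment> \<open>visits after time \<open>N\<close> of points of \<open>U\<close> are visits after time \<open>0\<close> of points of the image of \<open>U\<close> under \<open>f ^^ N\<close>\<close>
    define V where "V = {x \<in> topspace X. (g ^^ N) x \<in> U}"
    have "openin X V" unfolding V_def by (rule openin_continuous_map_preimage[OF cont_gn U(1)])
    moreover obtain u where u: "u \<in> U" "u \<in> topspace X" using U openin_subset by blast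
    then have "(f ^^ N) u \<in> V" unfolding V_def using fn_in gn_fn by auto
    ultimately obtain x i where x: "x \<in> V" "0 < lab 0 ((f ^^ i) x)"
      using open_set_leaves_tower_0[OF perfect, of V] by blast
    then have xT: "x \<in> topspace X" "(g ^^ N) x \<in> U" unfolding V_def by auto
    have "(f ^^ (i + N)) ((g ^^ N) x) = (f ^^ i) x" using fn_gm[OF xT(1), of "i + N" N] by simp
    then have "(g ^^ N) x \<in> Q N" unfolding Q_def using x gn_in[OF xT(1)]
      by (metis (mono_tags, lifting) le_add2 mem_Collect_eq)
    with xT show "Q N \<inter> U \<noteq> {}" by auto
  qed
  have "gdelta_in X S" unfolding S_def
    by (rule gdelta_in_Inter) (auto intro: open_imp_gdelta_in op)
  moreover have "X closure_of S = topspace X" unfolding S_def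
  proof (rule Baire_category)
    have "Hausdorff_space X" using Hausdorff_space_mtopology mtopology_eq by simp
    then show "completely_metrizable_space X \<or> locally_compact_space X \<and> regular_space X"
      using compact compact_imp_locally_compact_space compact_Hausdorff_imp_regular_space by blast
  qed (use op dense in auto)
  moreover have "scrambled d f S"
  proof (rule scrambled_off_stable_set, rule subsetI)
    fix x assume x: "x \<in> S"
    then have xT: "x \<in> topspace X" unfolding S_def Q_def by auto
    have "x \<notin> stable_set X f p"
    proof
      assume "x \<in> stable_set X f p"
      then have "eventually (\<lambda>i. (f ^^ i) x \<in> {y \<in> topspace X. lab 0 y = 0}) sequentially"
        using lab_open[of 0 0] p_in lab_p unfolding stable_set_def limitin_def by auto
      then obtain N where "\<And>i. i \<ge> N \<Longrightarrow> lab 0 ((f ^^ i) x) = 0"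
        unfolding eventually_sequentially by auto
      moreover have "x \<in> Q N" using x unfolding S_def by auto
      ultimately show False unfolding Q_def by auto
    qed
    with xT show "x \<in> topspace X - stable_set X f p" by auto
  qed
  ultimately show ?thesis unfolding residually_scrambled_def by blast
qed

end

section \<open>The two-symbol coding\<close>

context tower_labelling
begin

lemma iter_eq: "x \<in> topspace X \<Longrightarrow> iter X f i x = (if 0 \<le> i then (f ^^ nat i) x else (g ^^ nat (- i)) x)"
  unfolding iter_def using inv_map_funpow by auto

lemma iter_in: "x \<in> topspace X \<Longrightarrow> iter X f i x \<in> topspace X"
  by (simp add: iter_eq fn_in gn_in)

lemma iter_succ: "x \<in> topspace X \<Longrightarrow> iter X f (i + 1) x = f (iter X f i x)"
proof -
  assume x: "x \<in> topspace X"
  consider "0 \<le> i" | "i = - 1" | "i < - 1" by linarith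
  then show ?thesis
  proof cases
    case 1
    then have "nat (i + 1) = Suc (nat i)" by simp
    with 1 x show ?thesis by (simp add: iter_eq)
  next
    case 2
    then show ?thesis using fg x by (simp add: iter_eq)
  next
    case 3
    then have "nat (- i) = Suc (nat (- (i + 1)))" by simp
    with 3 x show ?thesis using fg gn_in by (simp add: iter_eq)
  qed
qed

lemma iter_f: "x \<in> topspace X \<Longrightarrow> iter X f i (f x) = iter X f (i + 1) x"
proof -
  assume x: "x \<in> topspace X"
  consider "0 \<le> i" | "i = - 1" | "i < - 1" by linarith
  then show ?thesis
  proof cases
    case 1
    then have "nat (i + 1) = Suc (nat i)" by simp
    with 1 x f_in show ?thesis by (simp add: iter_eq funpow_swap1)
  next
    case 2
    then show ?thesis using gf f_in x by (simp add: iter_eq)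
  next
    case 3
    then have n: "nat (- i) = Suc (nat (- (i + 1)))" by simp
    have "(g ^^ Suc m) (f x) = (g ^^ m) x" for m using gf[OF x] by (simp add: funpow_Suc_shift del: funpow.simps)
    with 3 x n f_in show ?thesis by (simp add: iter_eq del: funpow.simps)
  qed
qed

lemma cont_iter: "continuous_map X X (iter X f i)"
proof (cases "0 \<le> i")
  case True
  then show ?thesis using cont_fn[of "nat i"] by (simp add: iter_def)
next
  case False
  show ?thesis
    by (rule continuous_map_eq[OF cont_gn[of "nat (- i)"]]) (use False in \<open>simp add: iter_eq\<close>)
qed

definition tower_code :: "'s \<Rightarrow> 's \<Rightarrow> 'a \<Rightarrow> int \<Rightarrow> 's" where
  "tower_code a b x i = (if lab 0 (iter X f i x) = 0 then a else b)"

lemma inj_tower_code: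
  assumes ab: "a \<noteq> b" and x: "x \<in> topspace X" and y: "y \<in> topspace X"
    and eq: "tower_code a b x = tower_code a b y"
  shows "x = y"
proof -
  have *: "lab 0 (iter X f i x) = 0 \<longleftrightarrow> lab 0 (iter X f i y) = 0" for i
    using fun_cong[OF eq, of i] ab unfolding tower_code_def by (auto split: if_splits)
  have "same_code 0 x y" unfolding same_code_def
  proof (intro allI conjI)
    fix i
    show "0 < lab 0 ((f ^^ i) x) \<longleftrightarrow> 0 < lab 0 ((f ^^ i) y)"
      using *[of "int i"] by (auto simp add: iter_def)
    show "0 < lab 0 ((g ^^ i) x) \<longleftrightarrow> 0 < lab 0 ((g ^^ i) y)"
      using *[of "- int i"] by (cases "i = 0") (auto simp add: iter_eq x y)
  qed
  then show ?thesis using same_code_imp_eq x y by blast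
qed

lemma cont_tower_code: "continuous_map X (full_shift {a, b}) (tower_code a b)"
  unfolding full_shift_def continuous_map_componentwise_UNIV
proof
  fix i
  show "continuous_map X (discrete_topology {a, b}) (\<lambda>x. tower_code a b x i)"
    unfolding continuous_map_def
  proof (intro conjI allI impI)
    fix U
    have "{x \<in> topspace X. tower_code a b x i \<in> U} =
        {x \<in> topspace X. iter X f i x \<in> {y \<in> topspace X. lab 0 y \<in> {k. (if k = 0 then a else b) \<in> U}}}"
      unfolding tower_code_def using iter_in by auto
    then show "openin X {x \<in> topspace X. tower_code a b x i \<in> U}"
      using openin_continuous_map_preimage[OF cont_iter[of i] lab_set_open[of 0 "{k. (if k = 0 then a else b) \<in> U}"]]
      by simp
  qed (auto simp: tower_code_def)
qed

lemma Hausdorff_full_shift: "Hausdorff_space (full_shift A)"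
  unfolding full_shift_def by (simp add: Hausdorff_space_product_topology)

lemma tower_code_f: "x \<in> topspace X \<Longrightarrow> tower_code a b (f x) = left_shift (tower_code a b x)"
  unfolding tower_code_def left_shift_def by (simp add: iter_f)

theorem conjugate_tower_code:
  assumes "a \<noteq> b"
  shows "homeomorphic_map X (subtopology (full_shift {a, b}) (tower_code a b ` topspace X)) (tower_code a b)"
    "subshift {a, b} (tower_code a b ` topspace X)"
proof -
  have sub: "tower_code a b ` topspace X \<subseteq> topspace (full_shift {a, b})"
    using cont_tower_code[of a b] by (auto simp: continuous_map_def)
  show "homeomorphic_map X (subtopology (full_shift {a, b}) (tower_code a b ` topspace X)) (tower_code a b)"
  proof (rule continuous_imp_homeomorphic_map)
    show "continuous_map X (subtopology (full_shift {a, b}) (tower_code a b ` topspace X)) (tower_code a b)"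
      using cont_tower_code[of a b] by (auto simp: continuous_map_in_subtopology)
    show "inj_on (tower_code a b) (topspace X)" using inj_tower_code[OF assms] by (auto intro: inj_onI)
    show "tower_code a b ` topspace X = topspace (subtopology (full_shift {a, b}) (tower_code a b ` topspace X))"
      using sub by (auto simp: topspace_subtopology)
  qed (use compact Hausdorff_full_shift Hausdorff_space_subtopology in auto)
  have "compactin (full_shift {a, b}) (tower_code a b ` topspace X)"
    using image_compactin[OF _ cont_tower_code] compact by (simp add: compact_space_def)
  then have "closedin (full_shift {a, b}) (tower_code a b ` topspace X)"
    using compactin_imp_closedin Hausdorff_full_shift by blast
  moreover have "left_shift ` (tower_code a b ` topspace X) = tower_code a b ` topspace X"
  proof -
    have "f ` topspace X = topspace X"
      using f_in g_in fg by (metis (no_types, lifting) image_iff image_subsetI subsetI subset_antisym)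
    then have "tower_code a b ` topspace X = (\<lambda>x. tower_code a b (f x)) ` topspace X"
      by (metis image_image)
    also have "\<dots> = (\<lambda>x. left_shift (tower_code a b x)) ` topspace X"
      by (rule image_cong) (auto simp: tower_code_f)
    finally show ?thesis unfolding image_image by (rule sym)
  qed
  ultimately show "subshift {a, b} (tower_code a b ` topspace X)" unfolding subshift_def by auto
qed

end

section \<open>Transport along conjugacies\<close>

text \<open>Equivariance of the inverse of the conjugacy needs \<open>f\<close> to map the space into itself; the values of \<open>f\<close>
  elsewhere are arbitrary.\<close>

lemma conjugate_sym:
  assumes "conjugate X f Y F" "\<And>x. x \<in> topspace X \<Longrightarrow> f x \<in> topspace X"
  shows "conjugate Y F X f"
proof -
  obtain k where k: "homeomorphic_map X Y k" "\<And>x. x \<in> topspace X \<Longrightarrow> k (f x) = F (k x)"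
    using assms(1) unfolding conjugate_def by blast
  obtain k' where "homeomorphic_maps X Y k k'" using k(1) homeomorphic_map_maps by blast
  then have k': "homeomorphic_map Y X k'" "\<And>x. x \<in> topspace X \<Longrightarrow> k' (k x) = x"
    "\<And>y. y \<in> topspace Y \<Longrightarrow> k (k' y) = y" unfolding homeomorphic_maps_map by auto
  have k'in: "k' y \<in> topspace X" if "y \<in> topspace Y" for y
    using homeomorphic_imp_surjective_map[OF k'(1)] that by auto
  have "k' (F y) = f (k' y)" if "y \<in> topspace Y" for y
    using k(2)[OF k'in[OF that]] k'(3)[OF that] k'(2)[OF assms(2)[OF k'in[OF that]]] by simp
  with k'(1) show ?thesis unfolding conjugate_def by blast
qed

lemma equivariant_funpow:
  assumes "\<And>x. x \<in> S \<Longrightarrow> f x \<in> S" "\<And>x. x \<in> S \<Longrightarrow> k (f x) = F (k x)" "x \<in> S"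
  shows "(f ^^ i) x \<in> S" "k ((f ^^ i) x) = (F ^^ i) (k x)"
proof -
  show 1: "(f ^^ i) x \<in> S" for i by (induction i) (use assms in auto)
  show "k ((f ^^ i) x) = (F ^^ i) (k x)" by (induction i) (use assms 1 in auto)
qed

lemma attracts_transport:
  assumes a: "attracts X f p" and k: "homeomorphic_map X Y k"
    and f: "\<And>x. x \<in> topspace X \<Longrightarrow> f x \<in> topspace X"
    and eqv: "\<And>x. x \<in> topspace X \<Longrightarrow> k (f x) = F (k x)"
  shows "attracts Y F (k p)"
  unfolding attracts_def
proof (intro conjI allI impI)
  have kim: "k ` topspace X = topspace Y" and kc: "continuous_map X Y k"
    using homeomorphic_imp_surjective_map[OF k] homeomorphic_imp_continuous_map[OF k] by auto
  have p: "p \<in> topspace X" "f p = p" using a unfolding attracts_def by auto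
  show "k p \<in> topspace Y" using kim p by auto
  show "F (k p) = k p" using eqv[OF p(1)] p by simp
  fix U assume U: "openin Y U \<and> k p \<in> U"
  have "openin X {x \<in> topspace X. k x \<in> U}" using openin_continuous_map_preimage kc U by blast
  then obtain T where T: "\<forall>x\<in>topspace X. \<exists>t\<le>T. (f ^^ t) x \<in> {x \<in> topspace X. k x \<in> U}"
    using a p U unfolding attracts_def by (metis (no_types, lifting) mem_Collect_eq)
  have "\<exists>t\<le>T. (F ^^ t) y \<in> U" if y: "y \<in> topspace Y" for y
  proof -
    obtain x where x: "x \<in> topspace X" "y = k x" using y kim by auto
    then obtain t where "t \<le> T" "k ((f ^^ t) x) \<in> U" using T by blast
    then show ?thesis using equivariant_funpow(2)[of "topspace X" f k F x t] f eqv x by auto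
  qed
  then show "\<exists>T. \<forall>x\<in>topspace Y. \<exists>t\<le>T. (F ^^ t) x \<in> U" by auto
qed

lemma conjugateE:
  assumes "conjugate X f Y F" and f: "homeomorphic_map X X f"
  obtains k k' where "homeomorphic_map X Y k" "homeomorphic_map Y X k'"
    "\<And>x. x \<in> topspace X \<Longrightarrow> k' (k x) = x" "\<And>y. y \<in> topspace Y \<Longrightarrow> k (k' y) = y"
    "\<And>x. x \<in> topspace X \<Longrightarrow> k (f x) = F (k x)" "\<And>y. y \<in> topspace Y \<Longrightarrow> k' (F y) = f (k' y)"
    "homeomorphic_map Y Y F"
proof -
  obtain k where k: "homeomorphic_map X Y k" "\<And>x. x \<in> topspace X \<Longrightarrow> k (f x) = F (k x)"
    using assms(1) unfolding conjugate_def by blast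
  obtain k' where kk': "homeomorphic_maps X Y k k'" using k(1) homeomorphic_map_maps by blast
  then have k': "homeomorphic_map Y X k'" "\<And>x. x \<in> topspace X \<Longrightarrow> k' (k x) = x"
    "\<And>y. y \<in> topspace Y \<Longrightarrow> k (k' y) = y" unfolding homeomorphic_maps_map by auto
  have k'in: "k' y \<in> topspace X" if "y \<in> topspace Y" for y
    using homeomorphic_imp_surjective_map[OF k'(1)] that by auto
  have fin: "f x \<in> topspace X" if "x \<in> topspace X" for x
    using homeomorphic_imp_surjective_map[OF f] that by auto
  have eqv': "k' (F y) = f (k' y)" if "y \<in> topspace Y" for y
    using k(2)[OF k'in[OF that]] k' fin k'in that by metis
  have "homeomorphic_map Y Y (k \<circ> (f \<circ> k'))"
    using homeomorphic_map_compose k(1) k'(1) f by metis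
  moreover have "(k \<circ> (f \<circ> k')) y = F y" if "y \<in> topspace Y" for y
    using k(2)[OF k'in[OF that]] k'(3)[OF that] by simp
  ultimately have "homeomorphic_map Y Y F" by (rule homeomorphic_map_eq) 
  then show ?thesis using that k k' eqv' by blast
qed

lemma tower_labelling_transport:
  assumes Y: "tower_labelling Y F F' q lab h"
    and X: "compact_space X" "homeomorphic_map X X f" "attracts X f p"
    and k: "homeomorphic_map X Y k" "k p = q"
    and eqv: "\<And>x. x \<in> topspace X \<Longrightarrow> k (f x) = F (k x)"
  shows "tower_labelling X f (inv_map X f) p (\<lambda>n x. lab n (k x)) h"
proof -
  interpret Y: tower_labelling Y F F' q lab h by (rule Y)
  have kim: "k ` topspace X = topspace Y" and kc: "continuous_map X Y k" and ki: "inj_on k (topspace X)"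
    using homeomorphic_imp_surjective_map[OF k(1)] homeomorphic_imp_continuous_map[OF k(1)]
      homeomorphic_imp_injective_map[OF k(1)] by auto
  have kin: "k x \<in> topspace Y" if "x \<in> topspace X" for x using kim that by auto
  have "homeomorphic_maps X X f (inv_map X f)" by (rule homeomorphic_maps_inv_map[OF X(2)])
  then have maps: "continuous_map X X f" "continuous_map X X (inv_map X f)"
    "\<And>x. x \<in> topspace X \<Longrightarrow> inv_map X f (f x) = x" "\<And>x. x \<in> topspace X \<Longrightarrow> f (inv_map X f x) = x"
    unfolding homeomorphic_maps_def by auto
  show ?thesis
  proof
    show "openin X {x \<in> topspace X. lab n (k x) = j}" for n j
    proof -
      have "{x \<in> topspace X. lab n (k x) = j} = {x \<in> topspace X. k x \<in> {y \<in> topspace Y. lab n y = j}}"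
        using kin by auto
      then show ?thesis using openin_continuous_map_preimage[OF kc Y.lab_open[of n j]] by simp
    qed
    show "x = y" if "x \<in> topspace X" "y \<in> topspace X" "\<And>n. lab n (k x) = lab n (k y)" for x y
      using Y.lab_separates[OF kin kin] that ki by (metis inj_onD)
    show "\<exists>x\<in>topspace X. 0 < lab 0 (k x)" using Y.lab_nontrivial kim by (metis imageE)
    show "lab n (k x) = lab n (k y)" if "x \<in> topspace X" "y \<in> topspace X" "lab (Suc n) (k x) = lab (Suc n) (k y)" for n x y
      using Y.lab_refine[OF kin kin] that by blast
  qed (use X(1,3) maps kin Y.lab_le Y.lab_Suc Y.lab_exit Y.lab_p k(2) eqv in auto)
qed

section \<open>Ordered Bratteli diagrams of rank two\<close>

lemma finite_linear_order_least:
  assumes r: "linear_order_on A r" and S: "finite S" "S \<noteq> {}" "S \<subseteq> A"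
  shows "\<exists>m\<in>S. \<forall>s\<in>S. (m, s) \<in> r"
  using S
proof (induction S rule: finite_ne_induct)
  case (singleton x)
  then show ?case using r by (auto simp: order_on_defs refl_on_def)
next
  case (insert x S)
  then obtain m where m: "m \<in> S" "\<forall>s\<in>S. (m, s) \<in> r" by auto
  have xx: "(x, x) \<in> r" using r insert by (auto simp: order_on_defs refl_on_def)
  have tr: "trans r" using r by (auto simp: order_on_defs)
  have "x \<noteq> m" "x \<in> A" "m \<in> A" using insert m by auto
  then have "(x, m) \<in> r \<or> (m, x) \<in> r" using r by (auto simp: order_on_defs total_on_def)
  then show ?case
  proof
    assume "(x, m) \<in> r"
    then have "\<forall>s\<in>insert x S. (x, s) \<in> r" using m xx tr by (auto dest: transD)
    then show ?thesis by blast
  qed (use m in blast)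
qed

definition path_vertex :: "('v, 'e) bratteli \<Rightarrow> nat \<Rightarrow> (nat \<Rightarrow> 'e) \<Rightarrow> 'v" where
  "path_vertex B n x = bsrc B n (x n)"

definition min_prefix :: "('v, 'e) bratteli \<Rightarrow> nat \<Rightarrow> (nat \<Rightarrow> 'e) \<Rightarrow> bool" where
  "min_prefix B n x \<longleftrightarrow> (\<forall>k<n. min_bedge B k (x k))"

definition max_prefix :: "('v, 'e) bratteli \<Rightarrow> nat \<Rightarrow> (nat \<Rightarrow> 'e) \<Rightarrow> bool" where
  "max_prefix B n x \<longleftrightarrow> (\<forall>k<n. max_bedge B k (x k))"

definition same_prefix :: "nat \<Rightarrow> (nat \<Rightarrow> 'e) \<Rightarrow> (nat \<Rightarrow> 'e) \<Rightarrow> bool" where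
  "same_prefix n x y \<longleftrightarrow> (\<forall>k<n. x k = y k)"

lemma topspace_bratteli_space: "topspace (bratteli_space B) = bratteli_paths B"
  unfolding bratteli_space_def bratteli_paths_def by (auto simp: topspace_subtopology)

locale ordered_bratteli =
  fixes B :: "('v, 'e) bratteli"
  assumes ordered: "ordered_bratteli_diagram B"
begin

abbreviation "P \<equiv> bratteli_paths B"

lemma diagram:
  "finite (bedges B n)" "finite (bverts B n)"
  "e \<in> bedges B n \<Longrightarrow> bsrc B n e \<in> bverts B n" "e \<in> bedges B n \<Longrightarrow> brng B n e \<in> bverts B (Suc n)"
  "v \<in> bverts B (Suc n) \<Longrightarrow> in_bedges B n v \<noteq> {}"
  using ordered unfolding ordered_bratteli_diagram_def bratteli_diagram_def by blast+

lemma order: "v \<in> bverts B (Suc n) \<Longrightarrow> linear_order_on (in_bedges B n v) (bord B n v)"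
  using ordered unfolding ordered_bratteli_diagram_def by blast

lemma path_edge: "x \<in> P \<Longrightarrow> x n \<in> bedges B n"
  unfolding bratteli_paths_def by blast

lemma path_step: "x \<in> P \<Longrightarrow> brng B n (x n) = path_vertex B (Suc n) x"
  unfolding bratteli_paths_def path_vertex_def by blast

lemma path_vertex_in: "x \<in> P \<Longrightarrow> path_vertex B n x \<in> bverts B n"
  unfolding path_vertex_def using path_edge diagram(3) by blast

lemma order_antisym:
  assumes "e \<in> bedges B n" "e' \<in> in_bedges B n (brng B n e)"
    "(e, e') \<in> bord B n (brng B n e)" "(e', e) \<in> bord B n (brng B n e)"
  shows "e = e'"
  using order[OF diagram(4)[OF assms(1)]] assms(3,4) by (auto simp: order_on_defs antisym_def)

lemma min_bedge_unique:
  assumes "min_bedge B n e" "min_bedge B n e'" "brng B n e = brng B n e'"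
  shows "e = e'"
proof (rule order_antisym)
  show "e \<in> bedges B n" using assms(1) unfolding min_bedge_def by blast
  show "e' \<in> in_bedges B n (brng B n e)" using assms unfolding min_bedge_def in_bedges_def by auto
  then show "(e, e') \<in> bord B n (brng B n e)" using assms(1) unfolding min_bedge_def by blast
  have "e \<in> in_bedges B n (brng B n e')" using assms unfolding min_bedge_def in_bedges_def by auto
  then show "(e', e) \<in> bord B n (brng B n e)" using assms(2,3) unfolding min_bedge_def by auto
qed

lemma max_bedge_unique:
  assumes "max_bedge B n e" "max_bedge B n e'" "brng B n e = brng B n e'"
  shows "e = e'"
proof (rule order_antisym)
  show "e \<in> bedges B n" using assms(1) unfolding max_bedge_def by blast
  show "e' \<in> in_bedges B n (brng B n e)" using assms unfolding max_bedge_def in_bedges_def by auto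
  then show "(e', e) \<in> bord B n (brng B n e)" using assms(1) unfolding max_bedge_def by blast
  have "e \<in> in_bedges B n (brng B n e')" using assms unfolding max_bedge_def in_bedges_def by auto
  then show "(e, e') \<in> bord B n (brng B n e)" using assms(2,3) unfolding max_bedge_def by auto
qed

lemma min_bedge_exists:
  assumes "v \<in> bverts B (Suc n)"
  shows "\<exists>e. min_bedge B n e \<and> brng B n e = v"
proof -
  have "finite (in_bedges B n v)" using diagram(1)[of n] unfolding in_bedges_def by simp
  then obtain m where m: "m \<in> in_bedges B n v" "\<forall>s\<in>in_bedges B n v. (m, s) \<in> bord B n v"
    using finite_linear_order_least[OF order[OF assms]] diagram(5)[OF assms] by blast
  then show ?thesis unfolding min_bedge_def in_bedges_def by auto
qed

lemma succ_bedge: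
  assumes e: "e \<in> bedges B n" and nm: "\<not> max_bedge B n e"
  shows "succ_bedge B n e \<in> bedges B n" "brng B n (succ_bedge B n e) = brng B n e"
    "\<not> min_bedge B n (succ_bedge B n e)" "succ_bedge B n e \<noteq> e"
proof -
  define v where "v = brng B n e"
  have lin: "linear_order_on (in_bedges B n v) (bord B n v)" unfolding v_def by (rule order[OF diagram(4)[OF e]])
  define S where "S = {e' \<in> in_bedges B n v. e' \<noteq> e \<and> (e, e') \<in> bord B n v}"
  obtain e' where e': "e' \<in> in_bedges B n v" "(e', e) \<notin> bord B n v"
    using nm e unfolding max_bedge_def v_def by blast
  have ein: "e \<in> in_bedges B n v" using e unfolding v_def in_bedges_def by simp
  then have "e' \<noteq> e" using e' lin by (auto simp: order_on_defs refl_on_def)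
  then have "e' \<in> S" unfolding S_def using e' ein lin by (auto simp: order_on_defs total_on_def)
  moreover have "finite S" using diagram(1)[of n] unfolding S_def in_bedges_def by simp
  ultimately obtain m where m: "m \<in> S" "\<forall>s\<in>S. (m, s) \<in> bord B n v"
    using finite_linear_order_least[OF lin, of S] unfolding S_def by blast
  have "succ_bedge B n e = m"
    unfolding succ_bedge_def Let_def v_def[symmetric]
  proof (rule the_equality)
    show "m \<in> in_bedges B n v \<and> m \<noteq> e \<and> (e, m) \<in> bord B n v \<and>
       (\<forall>e''\<in>in_bedges B n v. e'' \<noteq> e \<and> (e, e'') \<in> bord B n v \<longrightarrow> (m, e'') \<in> bord B n v)"
      using m unfolding S_def by blast
    fix z assume z: "z \<in> in_bedges B n v \<and> z \<noteq> e \<and> (e, z) \<in> bord B n v \<and>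
       (\<forall>e''\<in>in_bedges B n v. e'' \<noteq> e \<and> (e, e'') \<in> bord B n v \<longrightarrow> (z, e'') \<in> bord B n v)"
    then have "(z, m) \<in> bord B n v" "(m, z) \<in> bord B n v" using m unfolding S_def by blast+
    then show "z = m" using lin by (auto simp: order_on_defs antisym_def)
  qed
  moreover have "m \<in> in_bedges B n v" "m \<noteq> e" "(e, m) \<in> bord B n v" using m unfolding S_def by auto
  ultimately show "succ_bedge B n e \<in> bedges B n" "brng B n (succ_bedge B n e) = brng B n e" "succ_bedge B n e \<noteq> e"
    unfolding in_bedges_def v_def by auto
  show "\<not> min_bedge B n (succ_bedge B n e)"
  proof
    assume "min_bedge B n (succ_bedge B n e)"
    then have "(m, e) \<in> bord B n v"
      using ein \<open>succ_bedge B n e = m\<close> \<open>m \<in> in_bedges B n v\<close> unfolding min_bedge_def in_bedges_def by auto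
    then show False using \<open>(e, m) \<in> bord B n v\<close> \<open>m \<noteq> e\<close> lin by (auto simp: order_on_defs antisym_def)
  qed
qed

lemma min_prefix_exists:
  "v \<in> bverts B n \<Longrightarrow> \<exists>e. (\<forall>k<n. min_bedge B k (e k)) \<and>
     (\<forall>k. Suc k < n \<longrightarrow> brng B k (e k) = bsrc B (Suc k) (e (Suc k))) \<and>
     (0 < n \<longrightarrow> brng B (n - 1) (e (n - 1)) = v)"
proof (induction n arbitrary: v)
  case (Suc n)
  obtain m where m: "min_bedge B n m" "brng B n m = v" using min_bedge_exists[OF Suc.prems] by blast
  then have "bsrc B n m \<in> bverts B n" using diagram(3) unfolding min_bedge_def by blast
  from Suc.IH[OF this] obtain e where e: "\<forall>k<n. min_bedge B k (e k)"
     "\<forall>k. Suc k < n \<longrightarrow> brng B k (e k) = bsrc B (Suc k) (e (Suc k))"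
     "0 < n \<longrightarrow> brng B (n - 1) (e (n - 1)) = bsrc B n m" by blast
  have "\<forall>k<Suc n. min_bedge B k ((e(n := m)) k)" using e m by (auto simp: less_Suc_eq)
  moreover have "brng B k ((e(n := m)) k) = bsrc B (Suc k) ((e(n := m)) (Suc k))" if "Suc k < Suc n" for k
  proof (cases "Suc k = n")
    case True
    then have "k = n - 1" "0 < n" by auto
    then show ?thesis using e(3) True by auto
  qed (use e that in auto)
  ultimately show ?case using m(2) by (intro exI[of _ "e(n := m)"]) auto
qed auto

text \<open>An extremal edge is determined by its range, so an extremal path into a given vertex is determined
  by tracing it back towards level \<open>0\<close>.\<close>

lemma extremal_prefix_unique:
  assumes "x \<in> P" "y \<in> P" "path_vertex B n x = path_vertex B n y"
    and "min_prefix B n x \<and> min_prefix B n y \<or> max_prefix B n x \<and> max_prefix B n y"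
  shows "same_prefix n x y"
  using assms(3,4)
proof (induction n)
  case (Suc n)
  have "brng B n (x n) = brng B n (y n)" using Suc.prems(1) path_step assms by simp
  then have "x n = y n" using Suc.prems(2) min_bedge_unique max_bedge_unique
    unfolding min_prefix_def max_prefix_def by blast
  then have "path_vertex B n x = path_vertex B n y" unfolding path_vertex_def by simp
  then have "same_prefix n x y" using Suc unfolding min_prefix_def max_prefix_def by auto
  with \<open>x n = y n\<close> show ?case unfolding same_prefix_def by (auto simp: less_Suc_eq)
qed (auto simp: same_prefix_def)

lemma splice_path:
  assumes x: "x \<in> P" and y: "y \<in> P" and v: "path_vertex B n x = path_vertex B n y"
  shows "(\<lambda>k. if k < n then x k else y k) \<in> P"
  unfolding bratteli_paths_def
proof (intro CollectI allI conjI)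
  fix k
  show "(if k < n then x k else y k) \<in> bedges B k" using path_edge x y by auto
  show "brng B k (if k < n then x k else y k) = bsrc B (Suc k) (if Suc k < n then x (Suc k) else y (Suc k))"
  proof (cases "Suc k = n")
    case True
    then show ?thesis using path_step[OF x, of k] v by (simp add: path_vertex_def)
  next
    case False
    then show ?thesis using path_step[OF x, of k] path_step[OF y, of k] by (auto simp: path_vertex_def)
  qed
qed

text \<open>The definite descriptions in the definition of the Vershik map are meaningful: there is a minimal
  path into the source of the successor edge, and only one by
  \<open>extremal_prefix_unique\<close>.\<close>

lemma vershik_step:
  assumes x: "x \<in> P" and mx: "max_prefix B n x" and nm: "\<not> max_bedge B n (x n)"
  shows "vershik_map B x \<in> P" "min_prefix B n (vershik_map B x)"
    "vershik_map B x n = succ_bedge B n (x n)" "\<And>k. n < k \<Longrightarrow> vershik_map B x k = x k"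
proof -
  define s where "s = succ_bedge B n (x n)"
  have s: "s \<in> bedges B n" "brng B n s = brng B n (x n)"
    unfolding s_def using succ_bedge path_edge x nm by auto
  obtain e where e: "\<forall>k<n. min_bedge B k (e k)"
     "\<forall>k. Suc k < n \<longrightarrow> brng B k (e k) = bsrc B (Suc k) (e (Suc k))"
     "0 < n \<longrightarrow> brng B (n - 1) (e (n - 1)) = bsrc B n s"
    using min_prefix_exists[OF diagram(3)[OF s(1)]] by blast
  define y where "y k = (if k < n then e k else if k = n then s else x k)" for k
  define Q where "Q z \<longleftrightarrow> z \<in> P \<and> (\<forall>k<n. min_bedge B k (z k)) \<and> z n = s \<and> (\<forall>k>n. z k = x k)" for z
  have "y \<in> P" unfolding bratteli_paths_def
  proof (intro CollectI allI conjI)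
    fix k
    show "y k \<in> bedges B k" unfolding y_def using e(1) s path_edge[OF x] unfolding min_bedge_def by auto
    consider "Suc k < n" | "Suc k = n" | "k = n" | "n < k" by linarith
    then show "brng B k (y k) = bsrc B (Suc k) (y (Suc k))"
    proof cases
      case 2
      then have "k = n - 1" "0 < n" by auto
      then show ?thesis unfolding y_def using e(3) by simp
    next
      case 3
      then show ?thesis unfolding y_def using s(2) path_step[OF x, of n] by (simp add: path_vertex_def)
    next
      case 4
      then show ?thesis unfolding y_def using path_step[OF x, of k] by (simp add: path_vertex_def)
    qed (use e(2) in \<open>auto simp: y_def\<close>)
  qed
  then have Qy: "Q y" unfolding Q_def y_def using e(1) by simp
  have uniq: "z = y" if "Q z" for z
  proof
    fix k
    have zy: "z n = y n" "z \<in> P" "y \<in> P" using that Qy unfolding Q_def by auto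
    then have "same_prefix n z y"
      using extremal_prefix_unique[of z y n] that Qy unfolding Q_def min_prefix_def path_vertex_def by auto
    then show "z k = y k" using that Qy unfolding Q_def same_prefix_def by (metis linorder_neqE_nat)
  qed
  have least: "(LEAST k. \<not> max_bedge B k (x k)) = n"
    using nm mx unfolding max_prefix_def by (intro Least_equality) (auto simp: not_le[symmetric])
  have "\<not> max_bpath B x" using nm unfolding max_bpath_def by blast
  then have "vershik_map B x = (THE z. Q z)"
    unfolding vershik_map_def Let_def least Q_def s_def by simp
  also have "\<dots> = y" using Qy uniq by (rule the_equality)
  finally have "Q (vershik_map B x)" using Qy by simp
  then show "vershik_map B x \<in> P" "min_prefix B n (vershik_map B x)"
    "vershik_map B x n = succ_bedge B n (x n)" "\<And>k. n < k \<Longrightarrow> vershik_map B x k = x k"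
    unfolding Q_def min_prefix_def s_def by auto
qed

lemma not_max_prefixE:
  assumes "\<not> max_prefix B n x"
  obtains m where "m < n" "max_prefix B m x" "\<not> max_bedge B m (x m)"
proof -
  define m where "m = (LEAST m. \<not> max_bedge B m (x m))"
  obtain k where k: "k < n" "\<not> max_bedge B k (x k)" using assms unfolding max_prefix_def by blast
  have "m \<le> k" "\<not> max_bedge B m (x m)" unfolding m_def using k(2) by (rule Least_le, rule LeastI)
  moreover have "max_prefix B m x" unfolding max_prefix_def m_def using not_less_Least by blast
  ultimately show ?thesis using that[of m] k(1) by simp
qed

text \<open>As long as the initial segment of length \<open>n\<close> is not maximal, the Vershik map changes nothing
  beyond it; within the towers of level \<open>n\<close> the orbit has not reached the top.\<close>

lemma vershik_not_max:
  assumes x: "x \<in> P" and nm: "\<not> max_prefix B n x"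
  shows "path_vertex B n (vershik_map B x) = path_vertex B n x" "\<And>k. n \<le> k \<Longrightarrow> vershik_map B x k = x k"
    "\<not> min_prefix B n (vershik_map B x)"
proof -
  obtain m where m: "m < n" "max_prefix B m x" "\<not> max_bedge B m (x m)" by (rule not_max_prefixE[OF nm])
  note st = vershik_step[OF x m(2,3)]
  show tail: "\<And>k. n \<le> k \<Longrightarrow> vershik_map B x k = x k" using st(4) m(1) by simp
  show "path_vertex B n (vershik_map B x) = path_vertex B n x" unfolding path_vertex_def using tail by simp
  have "\<not> min_bedge B m (vershik_map B x m)" unfolding st(3) by (rule succ_bedge(3)[OF path_edge[OF x] m(3)])
  then show "\<not> min_prefix B n (vershik_map B x)" unfolding min_prefix_def using m(1) by blast
qed

lemma vershik_same_prefix: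
  assumes x: "x \<in> P" and y: "y \<in> P" and xy: "same_prefix n x y" and nm: "\<not> max_prefix B n x"
  shows "same_prefix n (vershik_map B x) (vershik_map B y)"
proof -
  obtain m where m: "m < n" "max_prefix B m x" "\<not> max_bedge B m (x m)" by (rule not_max_prefixE[OF nm])
  have my: "max_prefix B m y" "\<not> max_bedge B m (y m)"
    using m xy unfolding max_prefix_def same_prefix_def by auto
  note sx = vershik_step[OF x m(2,3)] and sy = vershik_step[OF y my]
  have eqm: "vershik_map B x m = vershik_map B y m"
    using sx(3) sy(3) xy m(1) unfolding same_prefix_def by simp
  then have low: "same_prefix m (vershik_map B x) (vershik_map B y)"
    using extremal_prefix_unique[OF sx(1) sy(1)] sx(2) sy(2) unfolding path_vertex_def by simp
  show ?thesis unfolding same_prefix_def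
  proof (intro allI impI)
    fix k assume "k < n"
    then show "vershik_map B x k = vershik_map B y k"
      using eqm low sx(4)[of k] sy(4)[of k] xy unfolding same_prefix_def by (metis linorder_neqE_nat)
  qed
qed

lemma path_vertex_eq_if_same_prefix:
  assumes "x \<in> P" "y \<in> P" "0 < n" "same_prefix n x y"
  shows "path_vertex B n x = path_vertex B n y"
proof -
  obtain m where m: "n = Suc m" using assms(3) by (cases n) auto
  then have "x m = y m" using assms(4) unfolding same_prefix_def by simp
  then show ?thesis using path_step[OF assms(1), of m] path_step[OF assms(2), of m] m by simp
qed

end

text \<open>The path \<open>q\<close> corresponds to the fixed point of the proximal system that the diagram represents.\<close>

locale bratteli_attractor = ordered_bratteli B
  for B :: "('v, 'e) bratteli" +
  fixes q :: "nat \<Rightarrow> 'e"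
  assumes simple: "essentially_simple B"
    and compact: "compact_space (bratteli_space B)"
    and homeo: "homeomorphic_map (bratteli_space B) (bratteli_space B) (vershik_map B)"
    and attr: "attracts (bratteli_space B) (vershik_map B) q"
begin

abbreviation "Y \<equiv> bratteli_space B"
abbreviation "\<phi> \<equiv> vershik_map B"
abbreviation "\<psi> \<equiv> inv_map Y \<phi>"

lemma homeomorphic_maps: "homeomorphic_maps Y Y \<phi> \<psi>"
  by (rule homeomorphic_maps_inv_map[OF homeo])

sublocale invertible_dynamics P \<phi> \<psi>
proof
  have "continuous_map Y Y \<phi>" "continuous_map Y Y \<psi>" using homeomorphic_maps unfolding homeomorphic_maps_def by auto
  then show "\<phi> x \<in> P" "\<psi> x \<in> P" if "x \<in> P" for x
    using that unfolding continuous_map_def topspace_bratteli_space by auto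
  show "\<psi> (\<phi> x) = x" "\<phi> (\<psi> x) = x" if "x \<in> P" for x
    using that homeomorphic_maps unfolding homeomorphic_maps_def topspace_bratteli_space by auto
qed

lemma fixed_path: "q \<in> P" "\<phi> q = q"
  using attr unfolding attracts_def topspace_bratteli_space by auto

text \<open>On a path that is not maximal the Vershik map replaces an edge by a different one, so a fixed path is
  maximal. The Vershik map sends it to the minimal path, so it is also minimal.\<close>

lemma max_bpath_q: "max_bpath B q"
proof (rule ccontr)
  assume "\<not> max_bpath B q"
  then obtain n where "\<not> max_prefix B n q" using fixed_path(1) unfolding max_bpath_def max_prefix_def by blast
  then obtain m where m: "max_prefix B m q" "\<not> max_bedge B m (q m)" by (rule not_max_prefixE)
  have "\<phi> q m \<noteq> q m" unfolding vershik_step(3)[OF fixed_path(1) m] by (rule succ_bedge(4)[OF path_edge[OF fixed_path(1)] m(2)])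
  then show False using fixed_path(2) by simp
qed

lemma vershik_max_bpath: "max_bpath B x \<Longrightarrow> min_bpath B (\<phi> x)"
  unfolding vershik_map_def using simple theI'[of "min_bpath B"] unfolding essentially_simple_def by simp

lemma min_bpath_q: "min_bpath B q"
  using vershik_max_bpath[OF max_bpath_q] fixed_path(2) by simp

lemma vershik_max_prefix:
  assumes x: "x \<in> P" and mx: "max_prefix B n x"
  shows "min_prefix B n (\<phi> x)"
proof (cases "max_bpath B x")
  case True
  then show ?thesis using vershik_max_bpath unfolding min_bpath_def min_prefix_def by blast
next
  case False
  then obtain k where "\<not> max_prefix B k x" using x unfolding max_bpath_def max_prefix_def by blast
  then obtain m where m: "max_prefix B m x" "\<not> max_bedge B m (x m)" by (rule not_max_prefixE)
  then have "n \<le> m" using mx unfolding max_prefix_def by (meson not_le)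
  then show ?thesis using vershik_step(2)[OF x m] unfolding min_prefix_def by simp
qed

text \<open>The edges of \<open>q\<close> are minimal and maximal at the same time, so each of them is the only edge into its
  range. Hence the tower of the vertex on \<open>q\<close> has height one.\<close>

lemma same_prefix_q:
  assumes x: "x \<in> P"
  shows "path_vertex B n x = path_vertex B n q \<Longrightarrow> same_prefix n x q"
proof (induction n)
  case (Suc n)
  have r: "brng B n (x n) = brng B n (q n)" using Suc.prems path_step x fixed_path(1) by simp
  have qn: "max_bedge B n (q n)" "min_bedge B n (q n)"
    using max_bpath_q min_bpath_q unfolding max_bpath_def min_bpath_def by auto
  have xin: "x n \<in> in_bedges B n (brng B n (q n))" using path_edge[OF x] r unfolding in_bedges_def by auto
  have "q n = x n"
    by (rule order_antisym[OF path_edge[OF fixed_path(1)] xin]) (use qn xin in \<open>auto simp: max_bedge_def min_bedge_def\<close>)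
  then have "path_vertex B n x = path_vertex B n q" unfolding path_vertex_def by simp
  then show ?case using Suc.IH \<open>q n = x n\<close> unfolding same_prefix_def by (auto simp: less_Suc_eq)
qed (simp add: same_prefix_def)

lemma q_prefix: "x \<in> P \<Longrightarrow> path_vertex B n x = path_vertex B n q \<Longrightarrow> min_prefix B n x \<and> max_prefix B n x"
  using same_prefix_q[of x n] max_bpath_q min_bpath_q
  unfolding same_prefix_def max_prefix_def min_prefix_def max_bpath_def min_bpath_def by auto

lemma inverse_not_min:
  assumes x: "x \<in> P" and nm: "\<not> min_prefix B n x"
  shows "\<not> max_prefix B n (\<psi> x)" "path_vertex B n (\<psi> x) = path_vertex B n x"
proof -
  show "\<not> max_prefix B n (\<psi> x)" using vershik_max_prefix[OF g_in[OF x]] fg[OF x] nm by auto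
  from vershik_not_max(1)[OF g_in[OF x] this] show "path_vertex B n (\<psi> x) = path_vertex B n x" using fg[OF x] by simp
qed

text \<open>The Vershik map acts injectively on initial segments: splicing the segment of the preimage of \<open>y\<close> with
  the rest of the preimage of \<open>x\<close> gives a second preimage of \<open>x\<close>.\<close>

lemma inverse_same_prefix:
  assumes x: "x \<in> P" and y: "y \<in> P" and xy: "same_prefix n x y" and n: "0 < n"
    and nm: "\<not> min_prefix B n x"
  shows "same_prefix n (\<psi> x) (\<psi> y)"
proof -
  have nmy: "\<not> min_prefix B n y" using nm xy unfolding min_prefix_def same_prefix_def by auto
  note ux = inverse_not_min[OF x nm] and wy = inverse_not_min[OF y nmy]
  define w where "w k = (if k < n then \<psi> y k else \<psi> x k)" for k
  have "path_vertex B n (\<psi> y) = path_vertex B n (\<psi> x)" using ux(2) wy(2) path_vertex_eq_if_same_prefix[OF x y n xy] by simp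
  then have w: "w \<in> P" unfolding w_def by (rule splice_path[OF g_in[OF y] g_in[OF x]])
  have wp: "same_prefix n w (\<psi> y)" unfolding same_prefix_def w_def by simp
  have nmw: "\<not> max_prefix B n w" using wy(1) wp unfolding max_prefix_def same_prefix_def by auto
  have "\<phi> w = x"
  proof
    fix k
    show "\<phi> w k = x k"
    proof (cases "k < n")
      case True
      then show ?thesis using vershik_same_prefix[OF w g_in[OF y] wp nmw] fg[OF y] xy
        unfolding same_prefix_def by simp
    next
      case False
      then show ?thesis using vershik_not_max(2)[OF w nmw, of k] vershik_not_max(2)[OF g_in[OF x] ux(1), of k] fg[OF x]
        unfolding w_def by simp
    qed
  qed
  then have "w = \<psi> x" using gf[OF w] by simp
  with wp show ?thesis by simp
qed

lemma openin_same_prefix: "openin Y {x \<in> P. same_prefix n x z}"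
proof -
  have coord: "openin Y {x \<in> P. x k = e}" for k e
  proof -
    have "continuous_map Y (discrete_topology (bedges B k)) (\<lambda>x. x k)"
      unfolding bratteli_space_def
      by (intro continuous_map_from_subtopology continuous_map_product_projection) simp
    moreover have "{x \<in> P. x k = e} = {x \<in> topspace Y. x k \<in> {e} \<inter> bedges B k}"
      unfolding topspace_bratteli_space using path_edge by auto
    ultimately show ?thesis
      using openin_continuous_map_preimage[of Y "discrete_topology (bedges B k)" "\<lambda>x. x k" "{e} \<inter> bedges B k"] by simp
  qed
  show ?thesis
  proof (induction n)
    case 0
    then show ?case using openin_topspace[of Y] by (simp add: same_prefix_def topspace_bratteli_space)
  next
    case (Suc n)
    have "{x \<in> P. same_prefix (Suc n) x z} = {x \<in> P. same_prefix n x z} \<inter> {x \<in> P. x n = z n}"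
      unfolding same_prefix_def by (auto simp: less_Suc_eq)
    with Suc coord show ?case by auto
  qed
qed

text \<open>A level at which some path avoids the vertex on \<open>q\<close> has at least two vertices, so the bound on the
  cardinality leaves exactly one vertex besides the one on \<open>q\<close>.\<close>

definition two_vertex_level :: "nat \<Rightarrow> bool" where
  "two_vertex_level n \<longleftrightarrow> card (bverts B n) \<le> 2 \<and> (\<exists>x\<in>P. path_vertex B n x \<noteq> path_vertex B n q)"

text \<open>The floor of a path is counted by the number of backward steps to the base of its tower, where the
  initial segment is minimal.\<close>

definition path_label :: "nat \<Rightarrow> (nat \<Rightarrow> 'e) \<Rightarrow> nat" where
  "path_label n x = (if path_vertex B n x = path_vertex B n q then 0 else Suc (LEAST j. min_prefix B n ((\<psi> ^^ j) x)))"

text \<open>The label of the top floor. At a level with two vertices the choice of the path does not matter, by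
  \<open>extremal_prefix_unique\<close>.\<close>

definition path_height :: "nat \<Rightarrow> nat" where
  "path_height n = path_label n (SOME z. z \<in> P \<and> path_vertex B n z \<noteq> path_vertex B n q \<and> max_prefix B n z)"

lemma two_vertex_level_pos: "two_vertex_level n \<Longrightarrow> 0 < n"
proof (rule ccontr)
  assume g: "two_vertex_level n" and "\<not> 0 < n"
  then have n: "n = 0" by simp
  obtain v where "bverts B 0 = {v}"
    using ordered unfolding ordered_bratteli_diagram_def bratteli_diagram_def by blast
  then have "path_vertex B 0 x = v" if "x \<in> P" for x using path_vertex_in[OF that, of 0] by simp
  with g fixed_path(1) n show False unfolding two_vertex_level_def by auto
qed

lemma two_vertex_level_path_vertex_eq:
  assumes "two_vertex_level n" "x \<in> P" "y \<in> P" "path_vertex B n x \<noteq> path_vertex B n q" "path_vertex B n y \<noteq> path_vertex B n q"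
  shows "path_vertex B n x = path_vertex B n y"
proof (rule ccontr)
  assume "path_vertex B n x \<noteq> path_vertex B n y"
  then have "card {path_vertex B n x, path_vertex B n y, path_vertex B n q} = 3" using assms by auto
  moreover have "{path_vertex B n x, path_vertex B n y, path_vertex B n q} \<subseteq> bverts B n" using path_vertex_in assms fixed_path(1) by auto
  ultimately have "3 \<le> card (bverts B n)" using card_mono[OF diagram(2)] by metis
  then show False using assms(1) unfolding two_vertex_level_def by simp
qed

lemma orbit_hits_q_vertex:
  "\<exists>T. \<forall>y\<in>P. \<exists>t\<le>T. (\<phi> ^^ t) y \<in> {x \<in> P. path_vertex B n x = path_vertex B n q}"
proof (cases "n = 0")
  case False
  have "q \<in> {x \<in> P. same_prefix n x q}" using fixed_path(1) by (simp add: same_prefix_def)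
  then have "\<exists>T. \<forall>y\<in>P. \<exists>t\<le>T. (\<phi> ^^ t) y \<in> {x \<in> P. same_prefix n x q}"
    using attr openin_same_prefix[of n q] unfolding attracts_def topspace_bratteli_space by blast
  moreover have "{x \<in> P. same_prefix n x q} \<subseteq> {x \<in> P. path_vertex B n x = path_vertex B n q}"
    using path_vertex_eq_if_same_prefix[OF _ fixed_path(1)] False by auto
  ultimately show ?thesis by (meson subsetD)
next
  case True
  obtain v where "bverts B 0 = {v}"
    using ordered unfolding ordered_bratteli_diagram_def bratteli_diagram_def by blast
  then have "path_vertex B 0 x = v" if "x \<in> P" for x using path_vertex_in[OF that, of 0] by simp
  then have "\<forall>y\<in>P. \<exists>t\<le>0. (\<phi> ^^ t) y \<in> {x \<in> P. path_vertex B n x = path_vertex B n q}" using True fixed_path(1) by simp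
  then show ?thesis by blast
qed

text \<open>Otherwise the whole backward orbit would avoid the vertex on \<open>q\<close>, and no orbit stays away from the
  neighbourhood of \<open>q\<close> given by this vertex.\<close>

lemma reaches_min:
  assumes x: "x \<in> P" and nq: "path_vertex B n x \<noteq> path_vertex B n q"
  shows "\<exists>j. min_prefix B n ((\<psi> ^^ j) x)"
proof (rule ccontr)
  assume no: "\<not> ?thesis"
  have A: "path_vertex B n ((\<psi> ^^ j) x) = path_vertex B n x" for j
  proof (induction j)
    case (Suc j)
    then show ?case using inverse_not_min(2)[OF gn_in[OF x, of j], of n] no by simp
  qed simp
  obtain T where "\<forall>y\<in>P. \<exists>t\<le>T. (\<phi> ^^ t) y \<in> {x \<in> P. path_vertex B n x = path_vertex B n q}"
    using orbit_hits_q_vertex by blast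
  then obtain t where t: "t \<le> T" "path_vertex B n ((\<phi> ^^ t) ((\<psi> ^^ T) x)) = path_vertex B n q" using gn_in[OF x] by blast
  then have "(\<phi> ^^ t) ((\<psi> ^^ T) x) = (\<psi> ^^ (T - t)) x" using fn_gm[OF x, of t T] by (cases "t = T") auto
  with t A nq show False by simp
qed

lemma path_label_min:
  assumes "path_vertex B n x \<noteq> path_vertex B n q" "min_prefix B n x"
  shows "path_label n x = 1"
proof -
  have "(LEAST j. min_prefix B n ((\<psi> ^^ j) x)) = 0" by (rule Least_equality) (use assms in auto)
  then show ?thesis unfolding path_label_def using assms(1) by simp
qed

lemma path_label_not_min:
  assumes x: "x \<in> P" and nq: "path_vertex B n x \<noteq> path_vertex B n q" and nm: "\<not> min_prefix B n x"
  shows "path_label n x = Suc (path_label n (\<psi> x))" "path_vertex B n (\<psi> x) \<noteq> path_vertex B n q"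
proof -
  show nq': "path_vertex B n (\<psi> x) \<noteq> path_vertex B n q" using inverse_not_min(2)[OF x nm] nq by simp
  obtain j where j: "min_prefix B n ((\<psi> ^^ j) x)" using reaches_min[OF x nq] by blast
  have "\<not> min_prefix B n ((\<psi> ^^ 0) x)" using nm by simp
  from Least_Suc[of "\<lambda>j. min_prefix B n ((\<psi> ^^ j) x)", OF j this]
  have "(LEAST j. min_prefix B n ((\<psi> ^^ j) x)) = Suc (LEAST j. min_prefix B n ((\<psi> ^^ j) (\<psi> x)))"
    unfolding funpow_Suc_shift .
  then show "path_label n x = Suc (path_label n (\<psi> x))" unfolding path_label_def using nq nq' by simp
qed

lemma path_label_Suc:
  assumes x: "x \<in> P" and nq: "path_vertex B n x \<noteq> path_vertex B n q" and nm: "\<not> max_prefix B n x"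
  shows "path_label n (\<phi> x) = Suc (path_label n x)" "path_vertex B n (\<phi> x) = path_vertex B n x"
proof -
  note v = vershik_not_max[OF x nm]
  show "path_vertex B n (\<phi> x) = path_vertex B n x" by (rule v(1))
  then show "path_label n (\<phi> x) = Suc (path_label n x)"
    using path_label_not_min(1)[OF f_in[OF x] _ v(3)] nq gf[OF x] by simp
qed

lemma reaches_max:
  assumes x: "x \<in> P" and nq: "path_vertex B n x \<noteq> path_vertex B n q"
  shows "\<exists>j. max_prefix B n ((\<phi> ^^ j) x) \<and> path_vertex B n ((\<phi> ^^ j) x) = path_vertex B n x \<and>
           path_label n ((\<phi> ^^ j) x) = path_label n x + j"
proof (rule ccontr)
  assume no: "\<not> ?thesis"
  have A: "path_vertex B n ((\<phi> ^^ j) x) = path_vertex B n x \<and> path_label n ((\<phi> ^^ j) x) = path_label n x + j" for j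
  proof (induction j)
    case (Suc j)
    then have "\<not> max_prefix B n ((\<phi> ^^ j) x)" using no by blast
    then show ?case using path_label_Suc[OF fn_in[OF x, of j], of n] Suc nq by simp
  qed simp
  obtain T where "\<forall>y\<in>P. \<exists>t\<le>T. (\<phi> ^^ t) y \<in> {x \<in> P. path_vertex B n x = path_vertex B n q}"
    using orbit_hits_q_vertex by blast
  then show False using x A nq by auto
qed

lemma path_label_exit:
  assumes x: "x \<in> P" and mx: "max_prefix B n x"
  shows "path_label n (\<phi> x) \<le> 1"
  using path_label_min[of n "\<phi> x"] vershik_max_prefix[OF x mx] by (cases "path_vertex B n (\<phi> x) = path_vertex B n q") (auto simp: path_label_def)

lemma path_label_pos: "0 < path_label n x \<longleftrightarrow> path_vertex B n x \<noteq> path_vertex B n q"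
  unfolding path_label_def by simp

lemma path_label_imp_same_prefix:
  assumes g: "two_vertex_level n"
  shows "x \<in> P \<Longrightarrow> y \<in> P \<Longrightarrow> path_label n x = path_label n y \<Longrightarrow> same_prefix n x y"
proof (induction "path_label n x" arbitrary: x y rule: less_induct)
  case less
  show ?case
  proof (cases "path_vertex B n x = path_vertex B n q")
    case True
    then have "path_vertex B n y = path_vertex B n q" using less.prems(3) path_label_pos by metis
    then show ?thesis using same_prefix_q[OF less.prems(1) True] same_prefix_q[OF less.prems(2)]
      unfolding same_prefix_def by simp
  next
    case nqx: False
    then have nqy: "path_vertex B n y \<noteq> path_vertex B n q" using less.prems(3) path_label_pos by metis
    have v: "path_vertex B n x = path_vertex B n y" by (rule two_vertex_level_path_vertex_eq[OF g less.prems(1,2) nqx nqy])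
    have pos: "0 < path_label n (\<psi> z)" if "z \<in> P" "path_vertex B n z \<noteq> path_vertex B n q" "\<not> min_prefix B n z" for z
      using path_label_not_min(2)[OF that] path_label_pos by blast
    show ?thesis
    proof (cases "min_prefix B n x")
      case True
      then have "min_prefix B n y"
        using path_label_min[OF nqx] less.prems path_label_not_min(1)[OF less.prems(2) nqy] pos[OF less.prems(2) nqy]
        by fastforce
      then show ?thesis using extremal_prefix_unique[OF less.prems(1,2) v] True by blast
    next
      case nm: False
      then have nmy: "\<not> min_prefix B n y"
        using path_label_min[OF nqy] less.prems path_label_not_min(1)[OF less.prems(1) nqx] pos[OF less.prems(1) nqx]
        by fastforce
      have "path_label n (\<psi> x) = path_label n (\<psi> y)" "path_label n (\<psi> x) < path_label n x"
        using path_label_not_min(1)[OF less.prems(1) nqx nm] path_label_not_min(1)[OF less.prems(2) nqy nmy]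
          less.prems(3) by auto
      then have "same_prefix n (\<psi> x) (\<psi> y)" using less.hyps g_in less.prems by blast
      then have "same_prefix n (\<phi> (\<psi> x)) (\<phi> (\<psi> y))"
        using vershik_same_prefix g_in less.prems inverse_not_min(1)[OF less.prems(1) nm] by blast
      then show ?thesis using fg less.prems by simp
    qed
  qed
qed

lemma same_prefix_imp_path_label:
  assumes n: "0 < n"
  shows "x \<in> P \<Longrightarrow> y \<in> P \<Longrightarrow> same_prefix n x y \<Longrightarrow> path_label n x = path_label n y"
proof (induction "path_label n x" arbitrary: x y rule: less_induct)
  case less
  have v: "path_vertex B n x = path_vertex B n y" by (rule path_vertex_eq_if_same_prefix[OF less.prems(1,2) n less.prems(3)])
  show ?case
  proof (cases "path_vertex B n x = path_vertex B n q")
    case nqx: False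
    then have nqy: "path_vertex B n y \<noteq> path_vertex B n q" using v by simp
    have mm: "min_prefix B n x \<longleftrightarrow> min_prefix B n y"
      using less.prems(3) unfolding min_prefix_def same_prefix_def by auto
    show ?thesis
    proof (cases "min_prefix B n x")
      case True
      then show ?thesis using path_label_min nqx nqy mm by simp
    next
      case nm: False
      note lx = path_label_not_min(1)[OF less.prems(1) nqx nm]
      note ly = path_label_not_min(1)[OF less.prems(2) nqy nm[unfolded mm]]
      have "path_label n (\<psi> x) = path_label n (\<psi> y)"
        by (rule less.hyps) (use lx g_in less.prems inverse_same_prefix n nm in auto)
      with lx ly show ?thesis by simp
    qed
  qed (use v in \<open>simp add: path_label_def\<close>)
qed

text \<open>The label of a path and its initial segment carry the same information: both can be transported along
  the tower from its base, where the initial segment is unique.\<close>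

lemma path_label_eq_iff:
  assumes "two_vertex_level n" "x \<in> P" "y \<in> P"
  shows "path_label n x = path_label n y \<longleftrightarrow> same_prefix n x y"
  using path_label_imp_same_prefix[OF assms(1)] same_prefix_imp_path_label[OF two_vertex_level_pos[OF assms(1)]] assms by blast

lemma path_height:
  assumes g: "two_vertex_level n" and x: "x \<in> P"
  shows "path_label n x \<le> path_height n"
    "path_vertex B n x \<noteq> path_vertex B n q \<Longrightarrow> path_label n x = path_height n \<longleftrightarrow> max_prefix B n x"
proof -
  define z where "z = (SOME z. z \<in> P \<and> path_vertex B n z \<noteq> path_vertex B n q \<and> max_prefix B n z)"
  have "\<exists>z. z \<in> P \<and> path_vertex B n z \<noteq> path_vertex B n q \<and> max_prefix B n z"
    using g reaches_max fn_in unfolding two_vertex_level_def by metis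
  then have z: "z \<in> P" "path_vertex B n z \<noteq> path_vertex B n q" "max_prefix B n z"
    unfolding z_def by (rule someI2_ex; blast)+
  have h: "path_height n = path_label n z" unfolding path_height_def z_def ..
  have eq: "path_label n y = path_height n \<longleftrightarrow> max_prefix B n y"
    if y: "y \<in> P" "path_vertex B n y \<noteq> path_vertex B n q" for y
  proof
    assume "path_label n y = path_height n"
    then have "same_prefix n y z" using path_label_eq_iff[OF g y(1) z(1)] h by simp
    then show "max_prefix B n y" using z(3) unfolding max_prefix_def same_prefix_def by auto
  next
    assume "max_prefix B n y"
    then have "same_prefix n y z"
      using extremal_prefix_unique[OF y(1) z(1) two_vertex_level_path_vertex_eq[OF g y(1) z(1) y(2) z(2)]] z(3) by blast
    then show "path_label n y = path_height n" using path_label_eq_iff[OF g y(1) z(1)] h by simp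
  qed
  show "path_vertex B n x \<noteq> path_vertex B n q \<Longrightarrow> path_label n x = path_height n \<longleftrightarrow> max_prefix B n x"
    using eq x by blast
  show "path_label n x \<le> path_height n"
  proof (cases "path_vertex B n x = path_vertex B n q")
    case False
    obtain j where j: "max_prefix B n ((\<phi> ^^ j) x)" "path_vertex B n ((\<phi> ^^ j) x) = path_vertex B n x"
      "path_label n ((\<phi> ^^ j) x) = path_label n x + j" using reaches_max[OF x False] by blast
    then have "path_label n x + j = path_height n" using eq[OF fn_in[OF x, of j]] False by simp
    then show ?thesis by simp
  qed (simp add: path_label_def)
qed

theorem tower_labelling_path_label:
  assumes r: "strict_mono r" "\<And>i. two_vertex_level (r i)"
  shows "tower_labelling Y \<phi> \<psi> q (\<lambda>i. path_label (r i)) (\<lambda>i. path_height (r i))"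
proof -
  have maps: "continuous_map Y Y \<phi>" "continuous_map Y Y \<psi>"
    using homeomorphic_maps unfolding homeomorphic_maps_def by auto
  show ?thesis
  proof (unfold_locales, unfold topspace_bratteli_space)
    show "attracts Y \<phi> q" by (rule attr)
    show "openin Y {x \<in> P. path_label (r n) x = k}" for n k
    proof (cases "\<exists>z\<in>P. path_label (r n) z = k")
      case True
      then obtain z where z: "z \<in> P" "path_label (r n) z = k" by blast
      then have "{x \<in> P. path_label (r n) x = k} = {x \<in> P. same_prefix (r n) x z}"
        using path_label_eq_iff[OF r(2) _ z(1), of _ n] by auto
      then show ?thesis using openin_same_prefix by simp
    next
      case False
      then have "{x \<in> P. path_label (r n) x = k} = {}" by blast
      then show ?thesis by (simp only: openin_empty)
    qed
    show "path_label (r n) q = 0" for n unfolding path_label_def by simp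
    show "\<exists>x\<in>P. 0 < path_label (r 0) x" using r(2)[of 0] unfolding two_vertex_level_def path_label_pos by blast
  next
    fix n x assume x: "x \<in> P"
    show "path_label (r n) x \<le> path_height (r n)" by (rule path_height(1)[OF r(2) x])
    show "path_label (r n) (\<phi> x) = Suc (path_label (r n) x)"
      if "0 < path_label (r n) x" "path_label (r n) x < path_height (r n)"
      using path_label_Suc(1)[OF x] path_height(2)[OF r(2) x] that path_label_pos by (metis less_irrefl)
    show "path_label (r n) (\<phi> x) \<le> 1"
      if "path_label (r n) x = 0 \<or> path_label (r n) x = path_height (r n)"
      using path_label_exit[OF x] path_height(2)[OF r(2) x] q_prefix[OF x] that path_label_pos by (metis less_irrefl)
  next
    fix n x y assume xy: "x \<in> P" "y \<in> P" "path_label (r (Suc n)) x = path_label (r (Suc n)) y"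
    have "r n < r (Suc n)" using r(1) by (simp add: strict_mono_def)
    then show "path_label (r n) x = path_label (r n) y"
      using xy path_label_eq_iff[OF r(2) xy(1,2)] unfolding same_prefix_def by (meson less_trans)
  next
    fix x y assume xy: "x \<in> P" "y \<in> P" "\<And>n. path_label (r n) x = path_label (r n) y"
    show "x = y"
    proof
      fix k
      have "k < r (Suc k)" using seq_suble[OF r(1), of "Suc k"] by simp
      then show "x k = y k"
        using xy(3)[of "Suc k"] path_label_eq_iff[OF r(2) xy(1,2)] unfolding same_prefix_def by blast
    qed
  qed (use compact maps gf fg in \<open>auto simp: topspace_bratteli_space\<close>)
qed

text \<open>Rank two means that at most two vertices occur at infinitely many levels, and a path different from
  \<open>q\<close> avoids the vertex on \<open>q\<close> at all sufficiently late levels. The levels with both properties are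
  enumerated.\<close>

theorem rank_two_tower_labelling:
  assumes rank: "bratteli_rank B = 2" and x0: "x0 \<in> P" "x0 \<noteq> q"
  obtains lab h where "tower_labelling Y \<phi> \<psi> q lab h"
proof -
  have freq: "\<exists>n\<ge>m. card (bverts B n) \<le> 2" for m
  proof (rule ccontr)
    assume "\<not> ?thesis"
    then have "eventually (\<lambda>n. 3 \<le> enat (card (bverts B n))) sequentially"
      unfolding eventually_sequentially by (intro exI[of _ m]) (auto simp: numeral_eq_enat)
    then have "3 \<le> bratteli_rank B" unfolding bratteli_rank_def by (rule Liminf_bounded)
    with rank show False by (simp add: numeral_eq_enat)
  qed
  obtain k where k: "x0 k \<noteq> q k" using x0(2) by blast
  have late: "path_vertex B n x0 \<noteq> path_vertex B n q" if "k < n" for n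
    using same_prefix_q[OF x0(1), of n] k that unfolding same_prefix_def by blast
  have "infinite {n. two_vertex_level n}" unfolding infinite_nat_iff_unbounded_le
  proof
    fix m
    obtain n where n: "n \<ge> max m (Suc k)" "card (bverts B n) \<le> 2" using freq by blast
    then have "two_vertex_level n" unfolding two_vertex_level_def using late[of n] x0(1) by auto
    with n show "\<exists>n\<ge>m. n \<in> {n. two_vertex_level n}" by auto
  qed
  then obtain r :: "nat \<Rightarrow> nat" where "strict_mono r" "\<And>i. r i \<in> {n. two_vertex_level n}"
    using infinite_enumerate by blast
  then have "tower_labelling Y \<phi> \<psi> q (\<lambda>i. path_label (r i)) (\<lambda>i. path_height (r i))"
    by (intro tower_labelling_path_label) auto
  then show ?thesis by (rule that)
qed

end

lemma (in ordered_bratteli) vershik_in: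
  assumes "essentially_simple B" and x: "x \<in> P"
  shows "vershik_map B x \<in> P"
proof (cases "max_bpath B x")
  case True
  then have "min_bpath B (vershik_map B x)"
    unfolding vershik_map_def using assms(1) theI'[of "min_bpath B"] unfolding essentially_simple_def by simp
  then show ?thesis unfolding min_bpath_def by blast
next
  case False
  then obtain k where "\<not> max_prefix B k x" using x unfolding max_bpath_def max_prefix_def by blast
  then obtain m where "max_prefix B m x" "\<not> max_bedge B m (x m)" by (rule not_max_prefixE)
  then show ?thesis by (rule vershik_step(1)[OF x])
qed

text \<open>The fixed point is transported to the path space of the diagram, and the resulting labelling of the path
  space is pulled back to \<open>X\<close>.\<close>

lemma rank_two_tower_labelling_exists:
  assumes X: "compact_space X" "homeomorphic_map X X f" and attracting: "attracts X f p"
    and x0: "x0 \<in> topspace X" "x0 \<noteq> p"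
    and B: "bratteli_model X f B" "bratteli_rank B = 2"
  obtains lab h where "tower_labelling X f (inv_map X f) p lab h"
proof -
  have B': "ordered_bratteli_diagram B" "essentially_simple B"
    "conjugate (bratteli_space B) (vershik_map B) X f" using B(1) unfolding bratteli_model_def by auto
  interpret ordered_bratteli B by standard (rule B')
  have "conjugate X f (bratteli_space B) (vershik_map B)"
    by (rule conjugate_sym[OF B'(3)]) (simp add: topspace_bratteli_space vershik_in B'(2))
  then obtain k k' where k: "homeomorphic_map X (bratteli_space B) k"
    "\<And>x. x \<in> topspace X \<Longrightarrow> k' (k x) = x"
    "\<And>x. x \<in> topspace X \<Longrightarrow> k (f x) = vershik_map B (k x)"
    "homeomorphic_map (bratteli_space B) (bratteli_space B) (vershik_map B)"
    by (rule conjugateE[OF _ X(2)]) blast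
  have fin: "f x \<in> topspace X" if "x \<in> topspace X" for x
    using homeomorphic_imp_surjective_map[OF X(2)] that by auto
  have attrB: "attracts (bratteli_space B) (vershik_map B) (k p)"
    by (rule attracts_transport[OF attracting k(1) fin k(3)])
  have comp: "compact_space (bratteli_space B)"
    using X(1) k(1) homeomorphic_compact_space homeomorphic_map_imp_homeomorphic_space by blast
  interpret bratteli_attractor B "k p"
    by unfold_locales (use B'(2) comp k(4) attrB in auto)
  have "k x0 \<in> P" using homeomorphic_imp_surjective_map[OF k(1)] x0(1) topspace_bratteli_space by blast
  moreover have "k x0 \<noteq> k p"
  proof
    assume "k x0 = k p"
    then have "k' (k x0) = k' (k p)" by simp
    then show False using k(2) x0 attracting unfolding attracts_def by simp
  qed
  ultimately obtain lab h where "tower_labelling (bratteli_space B) (vershik_map B)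
      (inv_map (bratteli_space B) (vershik_map B)) (k p) lab h"
    by (rule rank_two_tower_labelling[OF B(2)])
  from tower_labelling_transport[OF this X attracting k(1) refl k(3)] show ?thesis by (rule that)
qed

section \<open>Graph coverings of rank two\<close>

lemma set_vwalk_arcs: "set (vwalk_arcs c) = {(c ! i, c ! Suc i) | i. Suc i < length c}"
proof (induction c rule: vwalk_arcs.induct)
  case (3 x y xs)
  have "{((x # y # xs) ! i, (x # y # xs) ! Suc i) | i. Suc i < length (x # y # xs)} =
      insert (x, y) {((y # xs) ! i, (y # xs) ! Suc i) | i. Suc i < length (y # xs)}" (is "?A = ?B")
  proof (intro equalityI subsetI)
    fix e assume "e \<in> ?A"
    then obtain i where "e = ((x # y # xs) ! i, (x # y # xs) ! Suc i)" "Suc i < length (x # y # xs)" by blast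
    then show "e \<in> ?B" by (cases i) auto
  next
    fix e assume "e \<in> ?B"
    then consider "e = (x, y)" | i where "e = ((y # xs) ! i, (y # xs) ! Suc i)" "Suc i < length (y # xs)" by blast
    then show "e \<in> ?A"
    proof cases
      case 1 then show ?thesis by (intro CollectI exI[of _ 0]) auto
    next
      case (2 i) then show ?thesis by (intro CollectI exI[of _ "Suc i"]) auto
    qed
  qed
  with 3 show ?case by simp
qed auto

text \<open>The shape of the graphs of a proximal rank-two covering: a loop at the center \<open>v\<close> and one further
  circuit \<open>c\<close> through \<open>v\<close>, of length at least \<open>2\<close> as the vertex list has more than two entries.\<close>

definition loop_and_circuit :: "'v pair_pre_digraph \<Rightarrow> 'v \<Rightarrow> 'v list \<Rightarrow> bool" where
  "loop_and_circuit G v c \<longleftrightarrow> 2 < length c \<and> hd c = v \<and> last c = v \<and> distinct (butlast c) \<and>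
     parcs G = insert (v, v) (set (vwalk_arcs c))"

lemma circuit_inj:
  assumes "distinct (butlast c)" "Suc i < length c" "Suc j < length c" "c ! i = c ! j"
  shows "i = j"
proof -
  have "butlast c ! i = c ! i" "butlast c ! j = c ! j" using assms by (auto simp: nth_butlast)
  then show ?thesis using assms nth_eq_iff_index_eq[of "butlast c" i j] by auto
qed

text \<open>The unique circuit of length \<open>1\<close> is a loop. Its arc lies on one of the two circuits of the figure 8, and
  since this circuit repeats no vertex before its end, it is the loop itself, based at the center. The
  other circuit is then longer.\<close>

lemma rank_2_figure8:
  assumes G: "generalized_figure8 G v C" and card: "card C = 2"
    and one: "\<exists>!c. circuit G c \<and> vwalk_length c = 1"
  obtains c where "C = {[v, v], c}" "c \<noteq> [v, v]" "loop_and_circuit G v c"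
proof -
  obtain c0 where c0: "circuit G c0" "vwalk_length c0 = 1" using one by blast
  then have "length c0 = 2" by simp
  then obtain a b where "c0 = [a, b]" by (auto simp: length_Suc_conv numeral_2_eq_2)
  with c0 have c0a: "c0 = [a, a]" "(a, a) \<in> parcs G" unfolding circuit_def vwalk_def by auto
  have C: "\<And>c. c \<in> C \<Longrightarrow> circuit G c \<and> hd c = v" "(\<Union>c\<in>C. set (vwalk_arcs c)) = parcs G"
    using G unfolding generalized_figure8_def by auto
  obtain c1 where c1: "c1 \<in> C" "(a, a) \<in> set (vwalk_arcs c1)" using C(2) c0a by blast
  then obtain i where i: "a = c1 ! i" "a = c1 ! Suc i" "Suc i < length c1" unfolding set_vwalk_arcs by blast
  have d1: "distinct (butlast c1)" "hd c1 = last c1" "hd c1 = v" "vwalk_length c1 \<ge> 1"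
    using C(1)[OF c1(1)] unfolding circuit_def by auto
  have ne: "c1 \<noteq> []" using i by auto
  have last: "\<not> Suc (Suc i) < length c1"
    using circuit_inj[OF d1(1), of i "Suc i"] i by auto
  then have len: "length c1 = Suc (Suc i)" using i by auto
  then have "c1 ! i = c1 ! 0" using i d1(2) ne by (simp add: last_conv_nth hd_conv_nth)
  then have "i = 0" using circuit_inj[OF d1(1), of i 0] i len by auto
  then have "length c1 = 2" using len by simp
  then obtain x y where "c1 = [x, y]" by (auto simp: length_Suc_conv numeral_2_eq_2)
  then have c1v: "c1 = [v, v]" using d1 by auto
  with i \<open>i = 0\<close> have av: "a = v" by auto
  obtain c where c: "C = {c1, c}" "c \<noteq> c1"
    using card c1(1) by (metis card_2_iff insertE insert_commute singletonD)
  then have cc: "circuit G c" "hd c = v" using C(1) by auto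
  then have "vwalk_length c \<noteq> 1" using one c0 c(2) c0a av c1v by auto
  moreover have "vwalk_length c \<ge> 1" "hd c = last c" "distinct (butlast c)"
    using cc unfolding circuit_def by auto
  moreover have "parcs G = insert (v, v) (set (vwalk_arcs c))"
    using C(2) c c1v by auto
  ultimately have "loop_and_circuit G v c" unfolding loop_and_circuit_def using cc(2) by auto
  with that c c1v show ?thesis by auto
qed

text \<open>The loop gets the position \<open>0\<close> and the arcs of the circuit are numbered from \<open>1\<close>. An arc of the circuit
  is determined by its source.\<close>

definition arc_position :: "'v list \<Rightarrow> 'v \<Rightarrow> 'v \<Rightarrow> nat" where
  "arc_position c u w = (if u = w then 0 else Suc (THE i. Suc i < length c \<and> c ! i = u))"

lemma arc_position_loop [simp]: "arc_position c v v = 0"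
  unfolding arc_position_def by simp

lemma loop_and_circuit_nth:
  assumes "loop_and_circuit G v c"
  shows "c ! 0 = v" "c ! (length c - 1) = v" "Suc 0 < length c"
proof -
  have "c \<noteq> []" using assms unfolding loop_and_circuit_def by auto
  then show "c ! 0 = v" "c ! (length c - 1) = v" "Suc 0 < length c"
    using assms hd_conv_nth[of c] last_conv_nth[of c] unfolding loop_and_circuit_def by auto
qed

lemma circuit_step_neq:
  assumes c: "loop_and_circuit G v c" and i: "Suc i < length c"
  shows "c ! i \<noteq> c ! Suc i"
proof
  assume eq: "c ! i = c ! Suc i"
  have d: "distinct (butlast c)" "2 < length c" using c unfolding loop_and_circuit_def by auto
  show False
  proof (cases "Suc (Suc i) < length c")
    case True then show False using circuit_inj[OF d(1), of i "Suc i"] eq i by auto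
  next
    case False
    then have "Suc i = length c - 1" using i by auto
    then have "c ! i = c ! 0" using eq loop_and_circuit_nth[OF c] by simp
    then show False using circuit_inj[OF d(1), of i 0] i d(2) False by auto
  qed
qed

lemma arc_position_circuit:
  assumes c: "loop_and_circuit G v c" and i: "Suc i < length c"
  shows "arc_position c (c ! i) (c ! Suc i) = Suc i"
proof -
  have "(THE j. Suc j < length c \<and> c ! j = c ! i) = i"
    using i circuit_inj[of c] c unfolding loop_and_circuit_def by (intro the_equality) auto
  then show ?thesis unfolding arc_position_def using circuit_step_neq[OF c i] by simp
qed

lemma arc_cases:
  assumes c: "loop_and_circuit G v c" and e: "(u, w) \<in> parcs G"
  obtains "u = v" "w = v" "arc_position c u w = 0"
  | i where "Suc i < length c" "u = c ! i" "w = c ! Suc i" "arc_position c u w = Suc i"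
proof -
  have "(u, w) = (v, v) \<or> (u, w) \<in> set (vwalk_arcs c)" using c e unfolding loop_and_circuit_def by auto
  then show ?thesis
  proof
    assume "(u, w) \<in> set (vwalk_arcs c)"
    then obtain i where "Suc i < length c" "u = c ! i" "w = c ! Suc i" unfolding set_vwalk_arcs by auto
    then show ?thesis using that(2)[of i] arc_position_circuit[OF c] by simp
  qed (use that(1) in simp)
qed

lemma arc_position_inj:
  assumes c: "loop_and_circuit G v c" and e: "(u, w) \<in> parcs G" "(u', w') \<in> parcs G"
    and eq: "arc_position c u w = arc_position c u' w'"
  shows "u = u' \<and> w = w'"
  using arc_cases[OF c e(1)] by cases (use arc_cases[OF c e(2)] eq in \<open>cases; simp\<close>)+

lemma arc_position_le:
  assumes "loop_and_circuit G v c" "(u, w) \<in> parcs G"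
  shows "arc_position c u w \<le> length c - 1"
  using arc_cases[OF assms] by cases auto

lemma arc_position_Suc:
  assumes c: "loop_and_circuit G v c" and e: "(u, w) \<in> parcs G" "(w, z) \<in> parcs G"
    and pos: "0 < arc_position c u w" "arc_position c u w < length c - 1"
  shows "arc_position c w z = Suc (arc_position c u w)"
proof -
  obtain i where i: "Suc i < length c" "w = c ! Suc i" "arc_position c u w = Suc i"
    using arc_cases[OF c e(1)] pos by (cases) auto
  have d: "distinct (butlast c)" using c unfolding loop_and_circuit_def by auto
  have L: "Suc (Suc i) < length c" using i pos by simp
  then have "w \<noteq> v" using circuit_inj[OF d, of "Suc i" 0] i loop_and_circuit_nth(1,3)[OF c] by auto
  then obtain j where j: "Suc j < length c" "w = c ! j" "arc_position c w z = Suc j"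
    using arc_cases[OF c e(2)] by (cases) auto
  have "c ! j = c ! Suc i" using i(2) j(2) by simp
  then have "j = Suc i" by (rule circuit_inj[OF d j(1) L])
  with i(3) j(3) show ?thesis by simp
qed

lemma arc_position_exit:
  assumes c: "loop_and_circuit G v c" and e: "(u, w) \<in> parcs G" "(w, z) \<in> parcs G"
    and pos: "arc_position c u w = 0 \<or> arc_position c u w = length c - 1"
  shows "arc_position c w z \<le> 1"
proof -
  have d: "distinct (butlast c)" using c unfolding loop_and_circuit_def by auto
  have "w = v"
    using arc_cases[OF c e(1)]
  proof cases
    case (2 i)
    then have "Suc i = length c - 1" using pos by auto
    with 2 loop_and_circuit_nth[OF c] show ?thesis by simp
  qed
  from arc_cases[OF c e(2)] show ?thesis
  proof cases
    case (2 i)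
    have "c ! i = c ! 0" using \<open>w = v\<close> 2(2) loop_and_circuit_nth(1)[OF c] by simp
    then have "i = 0" by (rule circuit_inj[OF d 2(1) loop_and_circuit_nth(3)[OF c]])
    with 2(4) show ?thesis by simp
  qed simp
qed

lemma topspace_inv_limit: "topspace (inv_limit G \<phi>) = inv_limit_set G \<phi>"
  unfolding inv_limit_def inv_limit_set_def by (auto simp: topspace_subtopology)

lemma continuous_map_inv_limit_coordinate:
  "continuous_map (inv_limit G \<phi>) (discrete_topology (pverts (G n))) (\<lambda>x. x n)"
  unfolding inv_limit_def
  by (intro continuous_map_from_subtopology continuous_map_product_projection) simp

lemma finite_graph_outgoing:
  "finite_graph G \<Longrightarrow> v \<in> pverts G \<Longrightarrow> \<exists>w. (v, w) \<in> parcs G"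
  unfolding finite_graph_def by blast

lemma finite_graph_arc_verts:
  "finite_graph G \<Longrightarrow> (u, w) \<in> parcs G \<Longrightarrow> u \<in> pverts G \<and> w \<in> pverts G"
  unfolding finite_graph_def pair_fin_digraph_def
  using pair_wf_digraph.arc_fst_in_verts pair_wf_digraph.arc_snd_in_verts by fastforce

text \<open>By directionality, the image at level \<open>n\<close> of a successor of \<open>x (Suc n)\<close> does not depend on the
  choice of the successor; the images of all levels form the only possible value of the map.\<close>

lemma inv_limit_map_unique:
  assumes cov: "graph_covering G \<phi>" and x: "x \<in> inv_limit_set G \<phi>"
  shows "inv_limit_map G \<phi> x \<in> inv_limit_set G \<phi>" "(x n, inv_limit_map G \<phi> x n) \<in> parcs (G n)"
    and "\<And>y. y \<in> inv_limit_set G \<phi> \<Longrightarrow> (\<And>n. (x n, y n) \<in> parcs (G n)) \<Longrightarrow> inv_limit_map G \<phi> x = y"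
proof -
  have xn: "x n \<in> pverts (G n)" "x n = \<phi> (Suc n) (x (Suc n))" for n
    using x unfolding inv_limit_set_def by blast+
  have fin: "finite_graph (G n)" and cover: "graph_cover (G (Suc n)) (G n) (\<phi> (Suc n))" for n
    using cov unfolding graph_covering_def by auto
  have dir: "\<phi> (Suc n) v = \<phi> (Suc n) v'"
    if "(u, v) \<in> parcs (G (Suc n))" "(u, v') \<in> parcs (G (Suc n))" for n u v v'
    using cover[of n] that unfolding graph_cover_def plus_directional_def by blast
  have hom: "(\<phi> (Suc n) u, \<phi> (Suc n) v) \<in> parcs (G n)" if "(u, v) \<in> parcs (G (Suc n))" for n u v
    using cover[of n] that unfolding graph_cover_def graph_hom_def by blast
  obtain w where w: "\<And>n. (x n, w n) \<in> parcs (G n)" using finite_graph_outgoing[OF fin xn(1)] by metis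
  define y where "y n = \<phi> (Suc n) (w (Suc n))" for n
  have yn: "(x n, y n) \<in> parcs (G n)" for n
    unfolding y_def using hom[OF w[of "Suc n"]] xn(2)[of n] by simp
  have yeq: "y n = \<phi> (Suc n) (y (Suc n))" for n
    using dir[OF w[of "Suc n"] yn[of "Suc n"]] by (simp add: y_def)
  have yl: "y \<in> inv_limit_set G \<phi>"
    unfolding inv_limit_set_def using yeq finite_graph_arc_verts[OF fin yn] by blast
  have uniq: "z = z'" if z: "z \<in> inv_limit_set G \<phi>" "\<And>n. (x n, z n) \<in> parcs (G n)"
    and z': "z' \<in> inv_limit_set G \<phi>" "\<And>n. (x n, z' n) \<in> parcs (G n)" for z z'
  proof
    fix n
    have "z n = \<phi> (Suc n) (z (Suc n))" "z' n = \<phi> (Suc n) (z' (Suc n))"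
      using z(1) z'(1) unfolding inv_limit_set_def by blast+
    then show "z n = z' n" using dir[OF z(2) z'(2)] by simp
  qed
  have the: "inv_limit_map G \<phi> x = z" if "z \<in> inv_limit_set G \<phi>" "\<And>n. (x n, z n) \<in> parcs (G n)" for z
    unfolding inv_limit_map_def using that uniq by (intro the_equality) blast+
  then show "\<And>y. y \<in> inv_limit_set G \<phi> \<Longrightarrow> (\<And>n. (x n, y n) \<in> parcs (G n)) \<Longrightarrow> inv_limit_map G \<phi> x = y"
    by blast
  show "inv_limit_map G \<phi> x \<in> inv_limit_set G \<phi>" "(x n, inv_limit_map G \<phi> x n) \<in> parcs (G n)"
    using the[OF yl yn] yl yn by auto
qed

text \<open>Edge-surjectivity lifts the given arc step by step to all higher levels; below, it is projected.\<close>

lemma arc_realised: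
  assumes cov: "graph_covering G \<phi>" and e: "(u, w) \<in> parcs (G N)"
  shows "\<exists>x\<in>inv_limit_set G \<phi>. x N = u \<and> inv_limit_map G \<phi> x N = w"
proof -
  have fin: "finite_graph (G n)" and cover: "graph_cover (G (Suc n)) (G n) (\<phi> (Suc n))" for n
    using cov unfolding graph_covering_def by auto
  have lift: "\<exists>b\<in>parcs (G (Suc n)). map_prod (\<phi> (Suc n)) (\<phi> (Suc n)) b = a" if "a \<in> parcs (G n)" for a n
    using cover[of n] that unfolding graph_cover_def edge_surjective_def by (metis imageE)
  have hom: "map_prod (\<phi> (Suc n)) (\<phi> (Suc n)) a \<in> parcs (G n)" if "a \<in> parcs (G (Suc n))" for n a
    using cover[of n] that unfolding graph_cover_def edge_surjective_def by blast
  \<comment> \<open>the arc at a level \<open>n\<close> below \<open>N\<close>, obtained by applying the covers of index \<open>N\<close> down to \<open>Suc n\<close>\<close>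
  define down where "down n = rec_nat (u, w) (\<lambda>j a. map_prod (\<phi> (N - j)) (\<phi> (N - j)) a) (N - n)" for n
  have "\<exists>a. \<forall>j. (a j \<in> parcs (G (N + j)) \<and> (j = 0 \<longrightarrow> a j = (u, w))) \<and>
      map_prod (\<phi> (Suc (N + j))) (\<phi> (Suc (N + j))) (a (Suc j)) = a j"
  proof (rule dependent_nat_choice)
    show "\<exists>a. a \<in> parcs (G (N + 0)) \<and> (0 = (0::nat) \<longrightarrow> a = (u, w))" using e by simp
    fix a j assume "a \<in> parcs (G (N + j)) \<and> (j = 0 \<longrightarrow> a = (u, w))"
    then obtain b where "b \<in> parcs (G (Suc (N + j)))"
      "map_prod (\<phi> (Suc (N + j))) (\<phi> (Suc (N + j))) b = a" using lift by blast
    then show "\<exists>b. (b \<in> parcs (G (N + Suc j)) \<and> (Suc j = 0 \<longrightarrow> b = (u, w))) \<and>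
        map_prod (\<phi> (Suc (N + j))) (\<phi> (Suc (N + j))) b = a"
      by (intro exI[of _ b] conjI) simp_all
  qed
  then obtain a where a: "\<And>j. a j \<in> parcs (G (N + j))" "a 0 = (u, w)"
    "\<And>j. map_prod (\<phi> (Suc (N + j))) (\<phi> (Suc (N + j))) (a (Suc j)) = a j" by blast
  have down_N: "down N = (u, w)" unfolding down_def by simp
  have down_Suc: "down n = map_prod (\<phi> (Suc n)) (\<phi> (Suc n)) (down (Suc n))" if "n < N" for n
  proof -
    have "N - n = Suc (N - Suc n)" "N - (N - Suc n) = Suc n" using that by auto
    then show ?thesis unfolding down_def by simp
  qed
  have down_in: "down n \<in> parcs (G n)" if "n \<le> N" for n
    using that by (induction n rule: inc_induct) (use e down_N hom down_Suc in auto)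
  define b where "b n = (if n \<le> N then down n else a (n - N))" for n
  have b_in: "b n \<in> parcs (G n)" for n
    unfolding b_def using down_in a(1)[of "n - N"] by auto
  have b_Suc: "b n = map_prod (\<phi> (Suc n)) (\<phi> (Suc n)) (b (Suc n))" for n
  proof -
    consider "n < N" | j where "n = N + j" by (metis le_add_diff_inverse not_le)
    then show ?thesis
    proof cases
      case 1 then show ?thesis unfolding b_def using down_Suc by simp
    next
      case (2 j)
      have "b n = a j" "b (Suc n) = a (Suc j)"
        unfolding b_def using 2 down_N a(2) by (auto simp: Suc_diff_le)
      then show ?thesis using a(3)[of j] 2 by simp
    qed
  qed
  define x y where "x n = fst (b n)" and "y n = snd (b n)" for n
  have xy: "(x n, y n) \<in> parcs (G n)" for n using b_in unfolding x_def y_def by simp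
  have "x n = \<phi> (Suc n) (x (Suc n))" "y n = \<phi> (Suc n) (y (Suc n))" for n
    using arg_cong[OF b_Suc[of n], of fst] arg_cong[OF b_Suc[of n], of snd] unfolding x_def y_def
    by simp_all
  then have "x \<in> inv_limit_set G \<phi>" "y \<in> inv_limit_set G \<phi>"
    unfolding inv_limit_set_def using finite_graph_arc_verts[OF fin xy] by blast+
  then have "x \<in> inv_limit_set G \<phi>" "inv_limit_map G \<phi> x = y"
    using inv_limit_map_unique(3)[OF cov] xy by blast+
  moreover have "x N = u" "y N = w" unfolding x_def y_def b_def using down_N by auto
  ultimately show ?thesis by blast
qed

text \<open>The circuits are indexed by the level of their graph; level \<open>0\<close>, where the graph is a single loop, has
  none.\<close>

locale rank_two_covering =
  fixes G :: "nat \<Rightarrow> 'v pair_pre_digraph" and \<phi> :: "nat \<Rightarrow> 'v \<Rightarrow> 'v"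
    and ctr :: "nat \<Rightarrow> 'v" and circ :: "nat \<Rightarrow> 'v list" and q :: "nat \<Rightarrow> 'v"
  assumes covering: "graph_covering G \<phi>"
    and circ: "\<And>n. loop_and_circuit (G (Suc n)) (ctr (Suc n)) (circ (Suc n))"
    and compact_limit: "compact_space (inv_limit G \<phi>)"
    and homeo: "homeomorphic_map (inv_limit G \<phi>) (inv_limit G \<phi>) (inv_limit_map G \<phi>)"
    and attracts: "attracts (inv_limit G \<phi>) (inv_limit_map G \<phi>) q"
begin

abbreviation "Y \<equiv> inv_limit G \<phi>"
abbreviation "F \<equiv> inv_limit_map G \<phi>"

text \<open>Level \<open>n\<close> of the labelling reads the arc from \<open>y\<close> to its image in the graph of index \<open>Suc n\<close>, the first
  one with two circuits having index \<open>1\<close>.\<close>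

definition arc_label :: "nat \<Rightarrow> (nat \<Rightarrow> 'v) \<Rightarrow> nat" where
  "arc_label n y = arc_position (circ (Suc n)) (y (Suc n)) (F y (Suc n))"

lemma F_in: "y \<in> topspace Y \<Longrightarrow> F y \<in> topspace Y"
  using inv_limit_map_unique(1)[OF covering] by (simp add: topspace_inv_limit)

lemma arc: "y \<in> topspace Y \<Longrightarrow> (y n, F y n) \<in> parcs (G n)"
  using inv_limit_map_unique(2)[OF covering] by (simp add: topspace_inv_limit)

lemma limit_step: "y \<in> topspace Y \<Longrightarrow> y n = \<phi> (Suc n) (y (Suc n))"
  unfolding topspace_inv_limit inv_limit_set_def by blast

lemma arc_label_eq_iff:
  assumes "x \<in> topspace Y" "y \<in> topspace Y"
  shows "arc_label n x = arc_label n y \<longleftrightarrow> x (Suc n) = y (Suc n) \<and> F x (Suc n) = F y (Suc n)"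
  using arc_position_inj[OF circ arc[OF assms(1)] arc[OF assms(2)]] unfolding arc_label_def by metis

theorem tower_labelling_arc_label:
  "tower_labelling Y F (inv_map Y F) q arc_label (\<lambda>n. length (circ (Suc n)) - 1)"
proof -
  have "homeomorphic_maps Y Y F (inv_map Y F)" by (rule homeomorphic_maps_inv_map[OF homeo])
  then have maps: "continuous_map Y Y F" "continuous_map Y Y (inv_map Y F)"
    "\<And>x. x \<in> topspace Y \<Longrightarrow> inv_map Y F (F x) = x" "\<And>x. x \<in> topspace Y \<Longrightarrow> F (inv_map Y F x) = x"
    unfolding homeomorphic_maps_def by auto
  show ?thesis
  proof
    show "attracts Y F q" by (rule attracts)
    then show "arc_label n q = 0" for n unfolding arc_label_def attracts_def by simp
    show "openin Y {x \<in> topspace Y. arc_label n x = k}" for n k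
    proof -
      have coord: "openin Y {x \<in> topspace Y. x (Suc n) = u}" for u
      proof -
        have "{x \<in> topspace Y. x (Suc n) = u} = {x \<in> topspace Y. x (Suc n) \<in> {u} \<inter> pverts (G (Suc n))}"
          unfolding topspace_inv_limit inv_limit_set_def by auto
        then show ?thesis
          using openin_continuous_map_preimage[OF continuous_map_inv_limit_coordinate[of G \<phi> "Suc n"],
              of "{u} \<inter> pverts (G (Suc n))"] by simp
      qed
      have "{x \<in> topspace Y. arc_label n x = k} =
          (\<Union>(u, w)\<in>{(u, w). arc_position (circ (Suc n)) u w = k}.
             {x \<in> topspace Y. x (Suc n) = u} \<inter> {x \<in> topspace Y. F x \<in> {y \<in> topspace Y. y (Suc n) = w}})"
        unfolding arc_label_def using F_in by auto
      moreover have "openin Y \<dots>"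
        using coord openin_continuous_map_preimage[OF maps(1) coord] by (intro openin_Union) auto
      ultimately show ?thesis by simp
    qed
    fix n x assume x: "x \<in> topspace Y"
    show "arc_label n x \<le> length (circ (Suc n)) - 1"
      unfolding arc_label_def by (rule arc_position_le[OF circ arc[OF x]])
    show "arc_label n (F x) = Suc (arc_label n x)"
      if "0 < arc_label n x" "arc_label n x < length (circ (Suc n)) - 1"
      using arc_position_Suc[OF circ arc[OF x] arc[OF F_in[OF x]]] that unfolding arc_label_def by blast
    show "arc_label n (F x) \<le> 1"
      if "arc_label n x = 0 \<or> arc_label n x = length (circ (Suc n)) - 1"
      using arc_position_exit[OF circ arc[OF x] arc[OF F_in[OF x]]] that unfolding arc_label_def by blast
  next
    fix n x y assume xy: "x \<in> topspace Y" "y \<in> topspace Y" "arc_label (Suc n) x = arc_label (Suc n) y"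
    then show "arc_label n x = arc_label n y"
      using arc_label_eq_iff[OF xy(1,2)] limit_step[OF xy(1)] limit_step[OF xy(2)]
        limit_step[OF F_in[OF xy(1)]] limit_step[OF F_in[OF xy(2)]] by metis
  next
    fix x y assume xy: "x \<in> topspace Y" "y \<in> topspace Y" "\<And>n. arc_label n x = arc_label n y"
    then have "x (Suc n) = y (Suc n)" for n using arc_label_eq_iff[OF xy(1,2)] by blast
    then show "x = y" using limit_step[OF xy(1)] limit_step[OF xy(2)] by (metis ext)
  next
    have c: "loop_and_circuit (G (Suc 0)) (ctr (Suc 0)) (circ (Suc 0))" by (rule circ)
    have 1: "Suc 0 < length (circ (Suc 0))" using loop_and_circuit_nth[OF c] by blast
    then have "(circ (Suc 0) ! 0, circ (Suc 0) ! Suc 0) \<in> parcs (G (Suc 0))"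
      using c unfolding loop_and_circuit_def set_vwalk_arcs by blast
    from arc_realised[OF covering this] obtain x where
      x: "x \<in> topspace Y" "x (Suc 0) = circ (Suc 0) ! 0" "F x (Suc 0) = circ (Suc 0) ! Suc 0"
      unfolding topspace_inv_limit by blast
    then have "arc_label 0 x = Suc 0" unfolding arc_label_def using arc_position_circuit[OF c 1] by simp
    with x(1) show "\<exists>x\<in>topspace Y. 0 < arc_label 0 x" by (metis zero_less_Suc)
  qed (use compact_limit maps in auto)
qed

sublocale arc: tower_labelling Y F "inv_map Y F" q arc_label "\<lambda>n. length (circ (Suc n)) - 1"
  by (rule tower_labelling_arc_label)

text \<open>The arc of the loop and the arcs of the circuit are disjoint, so the circuit containing a given arc is
  well defined and is decided by the position of the arc being \<open>0\<close> or not.\<close>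

lemma circuit_coding_eq:
  assumes C: "C 1 = {[ctr 1, ctr 1], circ 1}" "circ 1 \<noteq> [ctr 1, ctr 1]" and x: "x \<in> topspace Y"
  shows "circuit_coding G \<phi> C x = arc.tower_code [ctr 1, ctr 1] (circ 1) x"
proof
  fix i
  define z where "z = iter Y F i x"
  have z: "z \<in> topspace Y" unfolding z_def by (rule arc.iter_in[OF x])
  have c: "loop_and_circuit (G 1) (ctr 1) (circ 1)" using circ[of 0] by simp
  have e: "(z 1, F z 1) \<in> parcs (G 1)" by (rule arc[OF z])
  have "(THE c. c \<in> C 1 \<and> (z 1, F z 1) \<in> set (vwalk_arcs c)) =
      (if arc_label 0 z = 0 then [ctr 1, ctr 1] else circ 1)"
    using arc_cases[OF c e]
  proof cases
    case 1
    have "(ctr 1, ctr 1) \<notin> set (vwalk_arcs (circ 1))"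
      using circuit_step_neq[OF c] unfolding set_vwalk_arcs by fastforce
    with 1 C show ?thesis unfolding arc_label_def by (intro the_equality) (auto split: if_splits)
  next
    case (2 j)
    have "(z 1, F z 1) \<in> set (vwalk_arcs (circ 1))" using 2 unfolding set_vwalk_arcs by blast
    moreover have "z 1 \<noteq> F z 1" using 2 circuit_step_neq[OF c] by simp
    ultimately show ?thesis using 2 C unfolding arc_label_def by (intro the_equality) (auto split: if_splits)
  qed
  moreover have "iter Y F (i + 1) x = F z" unfolding z_def by (rule arc.iter_succ[OF x])
  ultimately show "circuit_coding G \<phi> C x i = arc.tower_code [ctr 1, ctr 1] (circ 1) x i"
    unfolding circuit_coding_def arc.tower_code_def Let_def z_def by simp
qed

theorem circuit_coding_conjugacy:
  assumes C: "C 1 = {[ctr 1, ctr 1], circ 1}" "circ 1 \<noteq> [ctr 1, ctr 1]"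
  shows "homeomorphic_map Y (subtopology (full_shift (C 1)) (coded_set G \<phi> C)) (circuit_coding G \<phi> C)"
    "\<And>x. x \<in> topspace Y \<Longrightarrow> circuit_coding G \<phi> C (F x) = left_shift (circuit_coding G \<phi> C x)"
    "subshift (C 1) (coded_set G \<phi> C)"
proof -
  have im: "coded_set G \<phi> C = arc.tower_code [ctr 1, ctr 1] (circ 1) ` topspace Y"
    unfolding coded_set_def topspace_inv_limit[symmetric] using circuit_coding_eq[where C = C, OF C] by (rule image_cong[OF refl])
  show "homeomorphic_map Y (subtopology (full_shift (C 1)) (coded_set G \<phi> C)) (circuit_coding G \<phi> C)"
    unfolding im C(1)
    by (rule homeomorphic_map_eq[OF arc.conjugate_tower_code(1)[OF C(2)[symmetric]]])
       (simp add: circuit_coding_eq[where C = C, OF C])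
  show "subshift (C 1) (coded_set G \<phi> C)"
    unfolding im C(1) by (rule arc.conjugate_tower_code(2)[OF C(2)[symmetric]])
  show "circuit_coding G \<phi> C (F x) = left_shift (circuit_coding G \<phi> C x)" if "x \<in> topspace Y" for x
    using that F_in by (simp add: circuit_coding_eq[where C = C, OF C] arc.tower_code_f)
qed

end

lemma coding_of_covering:
  assumes X: "compact_space X" "homeomorphic_map X X f" and attracting: "attracts X f p"
    and G: "proximal_KR_covering G \<phi> ctr C"
    and card: "\<forall>n\<ge>1. card (C n) = 2"
    and conj: "conjugate X f (inv_limit G \<phi>) (inv_limit_map G \<phi>)"
  shows "conjugate X f (subtopology (full_shift (C 1)) (coded_set G \<phi> C)) left_shift"
    "subshift (C 1) (coded_set G \<phi> C)"
proof -
  obtain k where k: "homeomorphic_map X (inv_limit G \<phi>) k"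
    "\<And>x. x \<in> topspace X \<Longrightarrow> k (f x) = inv_limit_map G \<phi> (k x)"
    "homeomorphic_map (inv_limit G \<phi>) (inv_limit G \<phi>) (inv_limit_map G \<phi>)"
    by (rule conjugateE[OF conj X(2)]) blast
  have fin: "f x \<in> topspace X" if "x \<in> topspace X" for x
    using homeomorphic_imp_surjective_map[OF X(2)] that by auto
  have KR: "KR_covering G \<phi> ctr C" "\<forall>n\<ge>1. \<exists>!c. circuit (G n) c \<and> vwalk_length c = 1"
    using G unfolding proximal_KR_covering_def by auto
  have "\<exists>c. C (Suc n) = {[ctr (Suc n), ctr (Suc n)], c} \<and> c \<noteq> [ctr (Suc n), ctr (Suc n)] \<and>
      loop_and_circuit (G (Suc n)) (ctr (Suc n)) c" for n
  proof -
    have "generalized_figure8 (G (Suc n)) (ctr (Suc n)) (C (Suc n))" using KR(1) unfolding KR_covering_def by blast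
    moreover have "card (C (Suc n)) = 2" using card by simp
    moreover have "\<exists>!c. circuit (G (Suc n)) c \<and> vwalk_length c = 1" using KR(2)[rule_format, of "Suc n"] by simp
    ultimately show ?thesis by (rule rank_2_figure8) blast
  qed
  then obtain c where c: "\<And>n. C (Suc n) = {[ctr (Suc n), ctr (Suc n)], c n}"
    "\<And>n. c n \<noteq> [ctr (Suc n), ctr (Suc n)]"
    "\<And>n. loop_and_circuit (G (Suc n)) (ctr (Suc n)) (c n)" by metis
  interpret rank_two_covering G \<phi> ctr "\<lambda>n. c (n - 1)" "k p"
  proof
    show "graph_covering G \<phi>" using KR(1) unfolding KR_covering_def by blast
    show "compact_space (inv_limit G \<phi>)"
      using X(1) k(1) homeomorphic_compact_space homeomorphic_map_imp_homeomorphic_space by blast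
    show "attracts (inv_limit G \<phi>) (inv_limit_map G \<phi>) (k p)"
      by (rule attracts_transport[OF attracting k(1) fin k(2)])
  qed (use c(3) k(3) in auto)
  have C1: "C 1 = {[ctr 1, ctr 1], c (1 - 1)}" "c (1 - 1) \<noteq> [ctr 1, ctr 1]" using c(1,2)[of 0] by simp_all
  note coding = circuit_coding_conjugacy[where C = C, OF C1]
  show "subshift (C 1) (coded_set G \<phi> C)" by (rule coding(3))
  have kin: "k x \<in> topspace (inv_limit G \<phi>)" if "x \<in> topspace X" for x
    using homeomorphic_imp_surjective_map[OF k(1)] that by auto
  have "homeomorphic_map X (subtopology (full_shift (C 1)) (coded_set G \<phi> C)) (circuit_coding G \<phi> C \<circ> k)"
    by (rule homeomorphic_map_compose[OF k(1) coding(1)])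
  moreover have "(circuit_coding G \<phi> C \<circ> k) (f x) = left_shift ((circuit_coding G \<phi> C \<circ> k) x)"
    if "x \<in> topspace X" for x
    using coding(2)[OF kin[OF that]] k(2)[OF that] by simp
  ultimately show "conjugate X f (subtopology (full_shift (C 1)) (coded_set G \<phi> C)) left_shift"
    unfolding conjugate_def by blast
qed

section \<open>Proximal Cantor systems\<close>

text \<open>At a point \<open>z\<close> of \<open>N\<close> where the distance to the image is minimal, this minimum bounds from below all
  distances between \<open>(f ^^ n) z\<close> and \<open>(f ^^ n) (f z)\<close>, which are distances of points of \<open>N\<close> to their images.\<close>

lemma closed_invariant_contains_fixed_point:
  assumes X: "compact_space X" and d: "compatible_metric X d" and prox: "proximal X d f"
    and f: "continuous_map X X f" and N: "closedin X N" "N \<noteq> {}" "f ` N \<subseteq> N"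
  shows "\<exists>z\<in>N. f z = z"
proof -
  interpret Metric_space "topspace X" d using d unfolding compatible_metric_def by auto
  have NT: "N \<subseteq> topspace X" using N closedin_subset by blast
  have "continuous_map X euclideanreal (\<lambda>x. d x (f x))"
    using continuous_map_dist[OF d _ f, of id] by simp
  moreover have "compactin X N" using N X closedin_compact_space by blast
  ultimately have "compact ((\<lambda>x. d x (f x)) ` N)"
    using image_compactin by (metis compactin_euclidean_iff)
  then obtain z where z: "z \<in> N" "\<And>x. x \<in> N \<Longrightarrow> d z (f z) \<le> d x (f x)"
    using compact_attains_inf[of "(\<lambda>x. d x (f x)) ` N"] N(2) by auto
  have fN: "(f ^^ n) x \<in> N" if "x \<in> N" for n x
    using that N(3) by (induction n) auto
  have zT: "z \<in> topspace X" "f z \<in> topspace X" using z N NT by auto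
  have "ereal (d z (f z)) \<le> liminf (\<lambda>n. ereal (d ((f ^^ n) z) ((f ^^ n) (f z))))"
  proof (rule Liminf_bounded, rule always_eventually, rule allI)
    fix n
    have "(f ^^ n) (f z) = f ((f ^^ n) z)" by (simp add: funpow_swap1)
    then show "ereal (d z (f z)) \<le> ereal (d ((f ^^ n) z) ((f ^^ n) (f z)))"
      using z fN by simp
  qed
  also have "\<dots> = 0" using prox zT unfolding proximal_def liminf_dist_def by auto
  finally have "d z (f z) \<le> 0" by simp
  then show ?thesis using z zT by (metis mdist_pos_eq not_le)
qed

text \<open>The points whose forward orbit avoids \<open>U\<close> form a closed invariant set without \<open>p\<close>, which must be empty.
  Hence the preimages of \<open>U\<close> under the iterates of \<open>f\<close> cover the compact space.\<close>

lemma attracts_if_in_closed_invariant_sets: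
  assumes X: "compact_space X" and f: "continuous_map X X f" and p: "p \<in> topspace X" "f p = p"
    and attr: "\<And>N. closedin X N \<Longrightarrow> N \<noteq> {} \<Longrightarrow> f ` N \<subseteq> N \<Longrightarrow> p \<in> N"
  shows "attracts X f p"
  unfolding attracts_def
proof (intro conjI allI impI p)
  fix U assume "openin X U \<and> p \<in> U"
  then have U: "openin X U" "p \<in> U" by auto
  have cf: "continuous_map X X (f ^^ i)" for i
  proof (induction i)
    case (Suc i)
    then show ?case using continuous_map_compose[OF Suc f] by (simp add: o_def)
  qed (simp add: id_def)
  define O' where "O' t = {x \<in> topspace X. (f ^^ t) x \<in> U}" for t
  have op: "openin X (O' t)" for t
    unfolding O'_def using openin_continuous_map_preimage[OF cf U(1)] .
  define N where "N = topspace X - (\<Union>t. O' t)"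
  have "closedin X N" unfolding N_def using op by blast
  moreover have "f ` N \<subseteq> N"
  proof -
    have "f x \<in> O' t \<Longrightarrow> x \<in> O' (Suc t)" if "x \<in> topspace X" for x t
      using that unfolding O'_def by (auto simp: funpow_Suc_shift simp del: funpow.simps(2))
    moreover have "f x \<in> topspace X" if "x \<in> topspace X" for x
      using f that by (auto simp: continuous_map_def)
    ultimately show ?thesis unfolding N_def by blast
  qed
  moreover have "p \<notin> N" unfolding N_def O'_def using p(1) U(2) by (auto intro: exI[of _ 0])
  ultimately have "N = {}" using attr by blast
  then have "topspace X \<subseteq> \<Union>(range O')" unfolding N_def by auto
  then obtain \<F> where F: "finite \<F>" "\<F> \<subseteq> range O'" "topspace X \<subseteq> \<Union>\<F>"
    using X op unfolding compact_space_alt by (metis (no_types, lifting) imageE)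
  then obtain I where I: "finite I" "\<F> = O' ` I" by (meson finite_subset_image)
  then obtain T where T: "\<forall>t\<in>I. t \<le> T" using finite_nat_set_iff_bounded_le by blast
  have "\<exists>t\<le>T. (f ^^ t) x \<in> U" if xT: "x \<in> topspace X" for x
  proof -
    obtain t where "t \<in> I" "x \<in> O' t" using F(3) I(2) xT by blast
    with T show ?thesis unfolding O'_def by blast
  qed
  then show "\<exists>T. \<forall>x\<in>topspace X. \<exists>t\<le>T. (f ^^ t) x \<in> U" by auto
qed

text \<open>Each fixed point is a minimal set by itself, so essential minimality allows only one.\<close>

lemma proximal_attracting_fixed_point:
  assumes X: "compact_space X" "topspace X \<noteq> {}" and d: "compatible_metric X d"
    and f: "continuous_map X X f" and prox: "proximal X d f" and ess: "essentially_minimal X f"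
  obtains p where "attracts X f p" "\<And>q. q \<in> topspace X \<Longrightarrow> f q = q \<Longrightarrow> q = p"
proof -
  have Hd: "Hausdorff_space X"
    using d Metric_space.Hausdorff_space_mtopology unfolding compatible_metric_def by metis
  have minimal: "minimal_set X f {z}" if "z \<in> topspace X" "f z = z" for z
  proof -
    have "closedin X {z}" using Hd that(1) by (simp add: closedin_Hausdorff_singleton)
    then show ?thesis unfolding minimal_set_def invariant_closed_def using that by auto
  qed
  have uniq: "z = z'" if "z \<in> topspace X" "f z = z" "z' \<in> topspace X" "f z' = z'" for z z'
    using ess minimal[OF that(1,2)] minimal[OF that(3,4)] unfolding essentially_minimal_def by blast
  have fim: "f ` topspace X \<subseteq> topspace X" using f by (auto simp: continuous_map_def)
  obtain p where p: "p \<in> topspace X" "f p = p"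
    using closed_invariant_contains_fixed_point[OF X(1) d prox f closedin_topspace X(2) fim] by blast
  have attr: "p \<in> N" if N: "closedin X N" "N \<noteq> {}" "f ` N \<subseteq> N" for N
  proof -
    obtain z where "z \<in> N" "f z = z" using closed_invariant_contains_fixed_point[OF X(1) d prox f N] by blast
    then show ?thesis using uniq p closedin_subset[OF N(1)] by blast
  qed
  have "attracts X f p" using attracts_if_in_closed_invariant_sets[OF X(1) f p attr] by blast
  with that uniq p show ?thesis by blast
qed

text \<open>A basic neighbourhood restricts finitely many coordinates, so any other coordinate can be flipped.\<close>

lemma cantor_space_perfect: "\<not> openin cantor_space {b}"
proof
  assume "openin cantor_space {b}"
  then obtain V where V: "b \<in> PiE UNIV V" "finite {i. V i \<noteq> topspace (discrete_topology (UNIV :: bool set))}"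
      "PiE UNIV V \<subseteq> {b}"
    unfolding cantor_space_def using product_topology_open_contains_basis[of _ UNIV "{b}" b] by blast
  obtain i :: nat where "i \<notin> {i. V i \<noteq> topspace (discrete_topology (UNIV :: bool set))}"
    using V(2) ex_new_if_finite infinite_UNIV_nat by blast
  then have "V i = UNIV" by simp
  then have "b(i := \<not> b i) \<in> PiE UNIV V" using V(1) by (auto simp: PiE_iff)
  then have "b(i := \<not> b i) = b" using V(3) by blast
  then show False by (metis fun_upd_same)
qed

lemma cantor_system_perfect:
  assumes "cantor_system X f" "x \<in> topspace X"
  shows "\<not> openin X {x}"
proof
  assume op: "openin X {x}"
  obtain k where k: "homeomorphic_map X cantor_space k"
    using assms(1) unfolding cantor_system_def homeomorphic_space by blast
  have "{x} \<subseteq> topspace X" using assms(2) by simp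
  from homeomorphic_map_openness[OF k this] op have "openin cantor_space (k ` {x})" by blast
  then show False using cantor_space_perfect by simp
qed

theorem theorem6p15:
  fixes X :: "'a topology" and f :: "'a \<Rightarrow> 'a" and d :: "'a \<Rightarrow> 'a \<Rightarrow> real"
  assumes "cantor_system X f"
    and "compatible_metric X d"
    and "proximal X d f"
    and "has_topological_rank X f 2"
  shows "(\<exists>p\<in>topspace X. (\<forall>q\<in>topspace X. f q = q \<longleftrightarrow> q = p) \<and>
            (let K = topspace X - (stable_set X f p \<union> unstable_set X f p)
             in scrambled d f K \<and> scrambled d (inv_map X f) K)) \<and>
         residually_scrambled X d f \<and>
         expansive X d f \<and>
         (\<forall>(G :: nat \<Rightarrow> 'v pair_pre_digraph) \<phi> ctr C.
            bidirectional_covering G \<phi> \<and> proximal_KR_covering G \<phi> ctr C \<and>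
            (\<forall>n\<ge>1. card (C n) = 2) \<and>
            conjugate X f (inv_limit G \<phi>) (inv_limit_map G \<phi>) \<longrightarrow>
            conjugate X f (subtopology (full_shift (C 1)) (coded_set G \<phi> C)) left_shift \<and>
            card (C 1) = 2 \<and> subshift (C 1) (coded_set G \<phi> C))"
proof -
  have X: "compact_space X" "homeomorphic_map X X f"
    using assms(1) unfolding cantor_system_def zero_dim_system_def by auto
  have f: "continuous_map X X f" using X(2) homeomorphic_imp_continuous_map by blast
  have perfect: "\<And>x. x \<in> topspace X \<Longrightarrow> \<not> openin X {x}" using cantor_system_perfect[OF assms(1)] by blast
  have ne: "topspace X \<noteq> {}"
  proof -
    obtain k where "homeomorphic_map X cantor_space k"
      using assms(1) unfolding cantor_system_def homeomorphic_space by blast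
    then have "k ` topspace X = topspace cantor_space" by (rule homeomorphic_imp_surjective_map)
    moreover have "topspace cantor_space = UNIV" unfolding cantor_space_def by simp
    ultimately show ?thesis by auto
  qed
  have ess: "essentially_minimal X f" using assms(4) unfolding has_topological_rank_def by blast
  obtain p where attr: "attracts X f p" and uniq: "\<And>q. q \<in> topspace X \<Longrightarrow> f q = q \<Longrightarrow> q = p"
    by (rule proximal_attracting_fixed_point[OF X(1) ne assms(2) f assms(3) ess]) blast
  have p: "p \<in> topspace X" "f p = p" using attr unfolding attracts_def by auto
  have "topspace X \<noteq> {p}" using perfect[OF p(1)] openin_topspace[of X] by metis
  then obtain x0 where x0: "x0 \<in> topspace X" "x0 \<noteq> p" using p(1) by blast
  obtain B :: "(nat, nat) bratteli" where "bratteli_model X f B" "bratteli_rank B = 2"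
    using assms(4) unfolding has_topological_rank_def by blast
  then obtain lab h where lab: "tower_labelling X f (inv_map X f) p lab h"
    by (rule rank_two_tower_labelling_exists[OF X attr x0])
  interpret forward: metric_tower_labelling X f "inv_map X f" p lab h d
    using lab assms(2) unfolding metric_tower_labelling_def metric_tower_labelling_axioms_def by blast
  interpret backward: metric_tower_labelling X "inv_map X f" f p forward.reversed_lab h d
    by (rule forward.reversed_metric)
  have unstable: "unstable_set X f p = stable_set X (inv_map X f) p"
    unfolding unstable_set_def stable_set_def ..
  have "scrambled d f (topspace X - (stable_set X f p \<union> unstable_set X f p))"
    by (rule forward.scrambled_off_stable_set) blast
  moreover have "scrambled d (inv_map X f) (topspace X - (stable_set X f p \<union> unstable_set X f p))"
    by (rule backward.scrambled_off_stable_set) (unfold unstable, blast)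
  moreover have "\<forall>q\<in>topspace X. f q = q \<longleftrightarrow> q = p" using uniq p by blast
  ultimately have "\<exists>p\<in>topspace X. (\<forall>q\<in>topspace X. f q = q \<longleftrightarrow> q = p) \<and>
            (let K = topspace X - (stable_set X f p \<union> unstable_set X f p)
             in scrambled d f K \<and> scrambled d (inv_map X f) K)"
    unfolding Let_def using p(1) by blast
  moreover have "residually_scrambled X d f" by (rule forward.residually_scrambled[OF perfect])
  moreover have "expansive X d f" by (rule forward.expansive)
  moreover have "conjugate X f (subtopology (full_shift (C 1)) (coded_set G \<phi> C)) left_shift \<and>
            card (C 1) = 2 \<and> subshift (C 1) (coded_set G \<phi> C)"
    if "bidirectional_covering G \<phi> \<and> proximal_KR_covering G \<phi> ctr C \<and>
            (\<forall>n\<ge>1. card (C n) = 2) \<and>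
            conjugate X f (inv_limit G \<phi>) (inv_limit_map G \<phi>)"
    for G :: "nat \<Rightarrow> 'v pair_pre_digraph" and \<phi> ctr C
    using coding_of_covering[OF X attr, of G \<phi> ctr C] that by auto
  ultimately show ?thesis by blast
qed

end
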